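(* Let $\mathcal H$ be a separable infinite-dimensional complex Hilbert space, let $\mathcal K$ be a complex Hilbert space, let $g\ge 1$ and let $x=(x_1,\dots,x_g)$ be freely noncommuting self-adjoint variables. Let $p\in B(\mathcal H)\otimes\mathbb C\langle x\rangle$ be an operator-valued polynomial of degree at most $2d+1$, and let $L=I+\sum_{j=1}^{g}A_jx_j\in B(\mathcal K)\otimes\mathbb C\langle x\rangle$ be a monic linear pencil, where $A_1,\dots,A_g\in B(\mathcal K)$ are self-adjoint. Then the following are equivalent: (i) For every $n\in\mathbb N$ and every $g$-tuple of self-adjoint matrices $X=(X_1,\dots,X_g)\in M_n(\mathbb C)^g$, $p(X)\succeq 0$ whenever $L(X)\succeq 0$. (ii) There exist $q,r\in B(\mathcal H)\otimes\mathbb C\langle x\rangle$ of degree at most $d$ and a unital completely positive map $\pi:\mathcal S_L\to B(\mathcal H)$ such that $$p=r^*r+q^*\pi(L)q,$$ where $\mathcal S_L\subset B(\mathcal K)$ is the unital operator system spanned by $I,A_1,\dots,A_g$.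
   Context: $\langle x\rangle$ is the free monoid on $x_1,\dots,x_g$; elements of $B(\mathcal H)\otimes\mathbb C\langle x\rangle$ are finite sums $p=\sum_w P_w w$ with $P_w\in B(\mathcal H)$, $w\in\langle x\rangle$. The degree of $p$ is the largest length of a word occurring in it. The involution is $p^*=\sum_w P_w^*w^*$, where $w^*$ is the reversed word (so $x_j^*=x_j$). For a tuple $X$ of operators, $p(X)=\sum_w P_w\otimes X^w$ with $X^w=X_{i_1}\cdots X_{i_n}$ for $w=x_{i_1}\cdots x_{i_n}$; in particular $L(X)=I\otimes I+\sum_j A_j\otimes X_j$. $T\succeq0$ means $T$ is positive semidefinite. For a unital completely positive map $\pi$ on $\mathcal S_L$, $\pi(L)=\pi(I)+\sum_j\pi(A_j)x_j$, a monic linear pencil with coefficients in $B(\mathcal H)$. *)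

theory Defs
  imports "HOL-Analysis.Analysis" "HOL-Library.Poly_Mapping"
    "Jordan_Normal_Form.Schur_Decomposition"
begin

section \<open>Complex Hilbert spaces\<close>

class complex_vector = ab_group_add +
  fixes scaleC :: "complex \<Rightarrow> 'a \<Rightarrow> 'a"  (infixr \<open>*\<^sub>C\<close> 75)
  assumes scaleC_add_right: "a *\<^sub>C (x + y) = a *\<^sub>C x + a *\<^sub>C y"
    and scaleC_add_left: "(a + b) *\<^sub>C x = a *\<^sub>C x + b *\<^sub>C x"
    and scaleC_scaleC: "a *\<^sub>C (b *\<^sub>C x) = (a * b) *\<^sub>C x"
    and scaleC_one: "1 *\<^sub>C x = x"

global_interpretation complex_vector: vector_space "scaleC :: complex \<Rightarrow> 'a \<Rightarrow> 'a::complex_vector"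
  defines cspan = complex_vector.span
  by unfold_locales
    (rule scaleC_add_right scaleC_add_left scaleC_scaleC scaleC_one)+

text \<open>
  The norm is the one induced by the inner product: \<open>real_inner\<close> provides
  \<open>norm x = sqrt (inner x x)\<close>, and \<open>inner\<close> is the real part of \<open>cinner\<close>. The complex
  inner product is conjugate linear in the first argument, linear in the second.
\<close>

class complex_hilbert_space = complex_vector + real_inner + complete_space +
  fixes cinner :: "'a \<Rightarrow> 'a \<Rightarrow> complex"
  assumes scaleR_scaleC: "r *\<^sub>R x = complex_of_real r *\<^sub>C x"
    and cinner_commute: "cinner x y = cnj (cinner y x)"
    and cinner_add_right: "cinner x (y + z) = cinner x y + cinner x z"
    and cinner_scaleC_right: "cinner x (c *\<^sub>C y) = c * cinner x y"
    and inner_eq_Re_cinner: "inner x y = Re (cinner x y)"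


section \<open>The algebra of bounded operators\<close>

typedef (overloaded) 'a bop =
  "{T :: 'a::complex_hilbert_space \<Rightarrow> 'a. bounded_linear T \<and> (\<forall>c x. T (c *\<^sub>C x) = c *\<^sub>C T x)}"
  morphisms apply_bop Bop
  by (rule exI[of _ "\<lambda>_. 0"]) (simp add: bounded_linear_zero)

setup_lifting type_definition_bop

lemma bounded_linear_scaleC: "bounded_linear (\<lambda>x::'a::complex_hilbert_space. c *\<^sub>C x)"
proof (rule bounded_linear_intro[where K = "cmod c"])
  show "c *\<^sub>C (x + y) = c *\<^sub>C x + c *\<^sub>C y" for x y :: 'a
    by (rule scaleC_add_right)
  show "c *\<^sub>C (r *\<^sub>R x) = r *\<^sub>R (c *\<^sub>C x)" for r and x :: 'a
    by (simp add: scaleR_scaleC scaleC_scaleC mult.commute)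
  show "norm (c *\<^sub>C x) \<le> norm x * cmod c" for x :: 'a
  proof -
    have "cinner (c *\<^sub>C x) (c *\<^sub>C x) = c * (cnj c * cinner x x)"
      by (metis cinner_commute cinner_scaleC_right complex_cnj_mult)
    also have "\<dots> = complex_of_real ((cmod c)\<^sup>2) * cinner x x"
      by (simp only: mult.assoc[symmetric] complex_norm_square[symmetric])
    finally have "inner (c *\<^sub>C x) (c *\<^sub>C x) = (cmod c)\<^sup>2 * inner x x"
      by (simp add: inner_eq_Re_cinner)
    then show ?thesis
      by (simp add: norm_eq_sqrt_inner real_sqrt_mult mult.commute)
  qed
qed

instantiation bop :: (complex_hilbert_space) "{ring, monoid_mult, complex_vector}"
begin

lift_definition zero_bop :: "'a bop" is "\<lambda>_. 0"
  by (simp add: bounded_linear_zero)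

lift_definition one_bop :: "'a bop" is "\<lambda>x. x"
  by (simp add: bounded_linear_ident)

lift_definition plus_bop :: "'a bop \<Rightarrow> 'a bop \<Rightarrow> 'a bop" is "\<lambda>S T x. S x + T x"
  by (auto simp: bounded_linear_add scaleC_add_right)

lift_definition uminus_bop :: "'a bop \<Rightarrow> 'a bop" is "\<lambda>T x. - T x"
  by (auto simp: bounded_linear_minus)

lift_definition minus_bop :: "'a bop \<Rightarrow> 'a bop \<Rightarrow> 'a bop" is "\<lambda>S T x. S x - T x"
  by (auto simp: bounded_linear_sub complex_vector.scale_right_diff_distrib)

lift_definition times_bop :: "'a bop \<Rightarrow> 'a bop \<Rightarrow> 'a bop" is "\<lambda>S T x. S (T x)"
  by (auto intro: bounded_linear_compose)

lift_definition scaleC_bop :: "complex \<Rightarrow> 'a bop \<Rightarrow> 'a bop" is "\<lambda>c T x. c *\<^sub>C T x"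
  by (auto intro: bounded_linear_compose[OF bounded_linear_scaleC]
      simp: scaleC_scaleC mult.commute)

instance
  by standard
    (transfer; auto simp: algebra_simps scaleC_add_right scaleC_add_left scaleC_scaleC scaleC_one
      linear_add bounded_linear.linear)+

end

definition adj :: "'a::complex_hilbert_space bop \<Rightarrow> 'a bop" where
  "adj T = (THE S. \<forall>x y. cinner (apply_bop S x) y = cinner x (apply_bop T y))"

definition self_adjoint :: "'a::complex_hilbert_space bop \<Rightarrow> bool" where
  "self_adjoint T \<longleftrightarrow> adj T = T"

text \<open>
  \<open>B(\<H>) \<otimes> M\<^sub>n\<close> is identified with the \<open>n \<times> n\<close> matrices over \<open>B(\<H>)\<close>, acting on the
  \<open>n\<close>-fold direct sum of \<open>\<H>\<close>, i.e. on \<open>\<H> \<otimes> \<complex>\<^sup>n\<close>; \<open>P \<otimes> X\<close> has the entries \<open>X\<^sub>i\<^sub>j P\<close>.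
  The order on the complex numbers is the one in which \<open>0 \<le> z\<close> means that \<open>z\<close> is real
  and nonnegative.
\<close>

definition psd :: "'a::complex_hilbert_space bop mat \<Rightarrow> bool" where
  "psd T \<longleftrightarrow> square_mat T \<and>
     (\<forall>v. 0 \<le> (\<Sum>i<dim_row T. \<Sum>j<dim_row T. cinner (v i) (apply_bop (T $$ (i, j)) (v j))))"

definition unital_cp_on ::
    "'a::complex_hilbert_space bop set \<Rightarrow> ('a bop \<Rightarrow> 'b::complex_hilbert_space bop) \<Rightarrow> bool" where
  "unital_cp_on S \<pi> \<longleftrightarrow>
     (\<forall>a\<in>S. \<forall>b\<in>S. \<pi> (a + b) = \<pi> a + \<pi> b) \<and>
     (\<forall>c. \<forall>a\<in>S. \<pi> (c *\<^sub>C a) = c *\<^sub>C \<pi> a) \<and>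
     \<pi> 1 = 1 \<and>
     (\<forall>n. \<forall>T \<in> carrier_mat n n. elements_mat T \<subseteq> S \<longrightarrow> psd T \<longrightarrow> psd (map_mat \<pi> T))"


section \<open>Operator-valued noncommutative polynomials\<close>

text \<open>
  The free monoid, written additively so that the product of finitely supported functions
  on it is the convolution product.
\<close>

datatype 'a free_monoid = Word (letters: "'a list")

instantiation free_monoid :: (type) monoid_add
begin

definition zero_free_monoid :: "'a free_monoid" where
  "0 = Word []"

definition plus_free_monoid :: "'a free_monoid \<Rightarrow> 'a free_monoid \<Rightarrow> 'a free_monoid" where
  "v + w = Word (letters v @ letters w)"

instance
  by standard (simp_all add: zero_free_monoid_def plus_free_monoid_def)

end

type_synonym ('g, 'h) opoly = "'g free_monoid \<Rightarrow>\<^sub>0 'h bop"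

definition opoly_degree :: "('g, 'h::complex_hilbert_space) opoly \<Rightarrow> nat" where
  "opoly_degree p = Max (insert 0 ((\<lambda>w. length (letters w)) ` Poly_Mapping.keys p))"

definition opoly_star :: "('g, 'h::complex_hilbert_space) opoly \<Rightarrow> ('g, 'h) opoly" where
  "opoly_star p = (\<Sum>w\<in>Poly_Mapping.keys p.
     Poly_Mapping.single (Word (rev (letters w))) (adj (Poly_Mapping.lookup p w)))"

definition word_eval :: "nat \<Rightarrow> ('g \<Rightarrow> complex mat) \<Rightarrow> 'g free_monoid \<Rightarrow> complex mat" where
  "word_eval n X w = foldr (\<lambda>j M. X j * M) (letters w) (1\<^sub>m n)"

definition opoly_eval ::
    "nat \<Rightarrow> ('g \<Rightarrow> complex mat) \<Rightarrow> ('g, 'h::complex_hilbert_space) opoly \<Rightarrow> 'h bop mat" where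
  "opoly_eval n X p = mat n n (\<lambda>ij. \<Sum>w\<in>Poly_Mapping.keys p.
     (word_eval n X w $$ ij) *\<^sub>C Poly_Mapping.lookup p w)"

text \<open>The pencil \<open>B\<^sub>0 + \<Sum>\<^sub>j B\<^sub>j x\<^sub>j\<close>; it is monic if \<open>B\<^sub>0 = 1\<close>.\<close>

definition pencil ::
    "'h::complex_hilbert_space bop \<Rightarrow> ('g::finite \<Rightarrow> 'h bop) \<Rightarrow> ('g, 'h) opoly" where
  "pencil B0 B = Poly_Mapping.single 0 B0 + (\<Sum>j\<in>UNIV. Poly_Mapping.single (Word [j]) (B j))"

end

theory Submission
  imports Defs
begin

text \<open>
  A certificate is a linear image of Gram data. Let \<open>V\<close> be the column of all words of length at most
  \<open>d\<close>. Then \<open>r\<^sup>* r = V\<^sup>* G V\<close> with a positive semidefinite block matrix \<open>G\<close>, and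
  \<open>q\<^sup>* \<pi>(L) q = V\<^sup>* \<Phi>(L) V\<close>, where \<open>\<Phi>(a) = Q\<^sup>* \<pi>(a) Q\<close> is a completely positive map from the
  operator system to block matrices. So \<open>p\<close> has to be found in the image of a convex cone of pairs
  \<open>(G, \<Phi>)\<close>. Conversely a certificate gives positivity because \<open>\<pi>\<close> is completely positive and
  \<open>L(X)\<close> is a positive matrix over the operator system (\<open>psd_certificate\<close>).
  
  Suppose that \<open>p\<close> is positive on the matricial domain of \<open>L\<close>, and compress \<open>p\<close> to the first \<open>m\<close>
  vectors of an orthonormal basis of \<open>\<H>\<close>. The cone is then finite-dimensional and its image is
  closed, because the Gram data are bounded by the coefficients of the polynomial: pair them
  with the moments of a small tuple on a truncated Fock space, where \<open>L(X)\<close> is bounded below and the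
  words applied to the vacuum are linearly independent (\<open>ex_strictly_positive_moments\<close>). If the
  compression were not in the image, the residual of a nearest point would be a separating
  functional. Polynomials of degree at most \<open>2 d + 1\<close> split into two words of length at most \<open>d\<close>
  with at most one letter in between, so the functional defines an inner product on the
  polynomials of degree at most \<open>d\<close> together with one Hermitian form for each letter
  (\<open>truncated_GNS\<close>). In an orthonormal basis these forms are matrices \<open>X\<close>. The functional is
  nonnegative on the vector compressions of the operator system, which says that \<open>L(X)\<close> is positive;
  and it is negative at \<open>p\<close>, which says that \<open>p(X)\<close> is not. This contradiction is
  \<open>finite_certificate\<close>.
  
  The bounds do not depend on \<open>m\<close>, so Tychonoff's theorem yields Gram data for \<open>p\<close> itself
  (\<open>infinite_certificate\<close>). Since \<open>\<H>\<close> is separable and infinite-dimensional, a positive semidefinite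
  kernel on a countable set is the Gram matrix of vectors of \<open>\<H>\<close> (\<open>kolmogorov_decomposition\<close>). These
  vectors are the columns of \<open>r\<close> and \<open>q\<close>; the map \<open>\<pi>\<close> is determined by \<open>\<Phi>\<close> on the closed range of \<open>Q\<close>
  and is filled up by a vector state on the orthogonal complement (\<open>realize_dual_kernel\<close>,
  \<open>ex_unital_cp\<close>).
\<close>

section \<open>Bounded operators on a Hilbert space\<close>

lemma cinner_add_left:
  "cinner (x + y) z = cinner x z + cinner (y::'a::complex_hilbert_space) z"
  by (metis cinner_add_right cinner_commute complex_cnj_add)

lemma cinner_scaleC_left:
  "cinner (c *\<^sub>C x) y = cnj c * cinner x (y::'a::complex_hilbert_space)"
  by (metis cinner_commute cinner_scaleC_right complex_cnj_mult)

lemma cinner_self: "cinner x x = complex_of_real ((norm (x::'a::complex_hilbert_space))\<^sup>2)"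
proof -
  have "Im (cinner x x) = 0"
    using arg_cong[OF cinner_commute[of x x], of Im] by simp
  moreover have "Re (cinner x x) = (norm x)\<^sup>2"
    by (simp flip: inner_eq_Re_cinner add: power2_norm_eq_inner)
  ultimately show ?thesis by (simp add: complex_eq_iff)
qed

lemma norm_scaleC: "norm (c *\<^sub>C (x::'a::complex_hilbert_space)) = cmod c * norm x"
proof -
  have "complex_of_real ((norm (c *\<^sub>C x))\<^sup>2) = (c * cnj c) * complex_of_real ((norm x)\<^sup>2)"
    unfolding cinner_self[symmetric] by (simp add: cinner_scaleC_left cinner_scaleC_right)
  also have "\<dots> = complex_of_real ((cmod c * norm x)\<^sup>2)"
    by (simp add: complex_norm_square[symmetric] power_mult_distrib)
  finally have "(norm (c *\<^sub>C x))\<^sup>2 = (cmod c * norm x)\<^sup>2"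
    by (simp only: of_real_eq_iff)
  then show ?thesis by (simp add: power2_eq_iff_nonneg)
qed

lemma cinner_Cauchy_Schwarz:
  "cmod (cinner x y) \<le> norm x * norm (y::'a::complex_hilbert_space)"
proof (cases "cinner x y = 0")
  case False
  define z where "z = cinner x y"
  \<comment> \<open>The factor \<open>u\<close> rotates \<open>y\<close> so that the inner product becomes \<open>cmod z\<close>.\<close>
  define u where "u = cnj z / cmod z"
  have z: "cmod z \<noteq> 0" using False by (simp add: z_def)
  have u: "cmod u = 1" using z by (simp add: u_def norm_divide)
  have "cinner x (u *\<^sub>C y) = cmod z"
    using z complex_norm_square[of z]
    by (simp add: cinner_scaleC_right z_def[symmetric] u_def field_simps power2_eq_square)
  then have "cmod z = inner x (u *\<^sub>C y)" by (simp add: inner_eq_Re_cinner)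
  also have "\<dots> \<le> norm x * norm (u *\<^sub>C y)" by (rule norm_cauchy_schwarz)
  finally show ?thesis by (simp add: norm_scaleC u z_def)
qed simp

interpretation cinner: bounded_bilinear "cinner :: 'a::complex_hilbert_space \<Rightarrow> 'a \<Rightarrow> complex"
proof
  show "\<exists>K. \<forall>a b. cmod (cinner a b) \<le> norm (a::'a) * norm b * K"
    by (rule exI[of _ 1]) (simp add: cinner_Cauchy_Schwarz)
qed (simp_all add: cinner_add_left cinner_add_right scaleR_scaleC cinner_scaleC_left
    cinner_scaleC_right scaleR_conv_of_real)

interpretation scaleC: bounded_bilinear "scaleC :: complex \<Rightarrow> 'a::complex_hilbert_space \<Rightarrow> 'a"
proof
  show "\<exists>K. \<forall>a b. norm (a *\<^sub>C (b::'a)) \<le> norm a * norm b * K"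
    by (rule exI[of _ 1]) (simp add: norm_scaleC)
qed (simp_all add: scaleC_add_left scaleC_add_right scaleR_scaleC scaleC_scaleC
    scaleR_conv_of_real mult.commute)

lemma cinner_ext:
  assumes "\<And>z. cinner z x = cinner z (y::'a::complex_hilbert_space)" shows "x = y"
proof -
  have "cinner (x - y) (x - y) = 0" by (simp add: cinner.diff_right assms)
  then show ?thesis by (simp add: cinner_self)
qed

lemma zero_le_complex_iff: "0 \<le> (z::complex) \<longleftrightarrow> 0 \<le> Re z \<and> Im z = 0"
  by (auto simp: less_eq_complex_def)

lemma complex_zero_le_sum: "(\<And>i. i \<in> I \<Longrightarrow> 0 \<le> f i) \<Longrightarrow> 0 \<le> (\<Sum>i\<in>I. (f i :: complex))"
  by (auto simp: zero_le_complex_iff intro!: sum_nonneg)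

lemma bounded_linear_apply_bop: "bounded_linear (apply_bop T)"
  using apply_bop[of T] by simp

lemma apply_bop_scaleC: "apply_bop T (c *\<^sub>C x) = c *\<^sub>C apply_bop T x"
  using apply_bop[of T] by simp

lemmas apply_bop_add = linear_add[OF bounded_linear.linear[OF bounded_linear_apply_bop]]
lemmas apply_bop_sum = linear_sum[OF bounded_linear.linear[OF bounded_linear_apply_bop]]
lemmas apply_bop_zero [simp] = linear_0[OF bounded_linear.linear[OF bounded_linear_apply_bop]]

lemma apply_bop_bound:
  obtains K where "K > 0" "\<And>x. norm (apply_bop T x) \<le> K * norm x"
  using bounded_linear.pos_bounded[OF bounded_linear_apply_bop[of T]] by (auto simp: mult.commute)

lemma apply_one_bop [simp]: "apply_bop 1 x = x"
  by transfer simp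
lemma apply_zero_bop [simp]: "apply_bop 0 x = 0"
  by transfer simp
lemma apply_plus_bop: "apply_bop (S + T) x = apply_bop S x + apply_bop T x"
  by transfer simp
lemma apply_minus_bop: "apply_bop (S - T) x = apply_bop S x - apply_bop T x"
  by transfer simp
lemma apply_times_bop: "apply_bop (S * T) x = apply_bop S (apply_bop T x)"
  by transfer simp
lemma apply_scaleC_bop: "apply_bop (c *\<^sub>C T) x = c *\<^sub>C apply_bop T x"
  by transfer simp
lemma apply_sum_bop: "apply_bop (\<Sum>i\<in>I. T i) x = (\<Sum>i\<in>I. apply_bop (T i) x)"
  by (induction I rule: infinite_finite_induct) (auto simp: apply_plus_bop)

lemma bop_eqI: "(\<And>x. apply_bop S x = apply_bop T x) \<Longrightarrow> S = T"
  by (metis apply_bop_inject ext)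

lemma apply_Bop:
  "bounded_linear T \<Longrightarrow> (\<And>c x. T (c *\<^sub>C x) = c *\<^sub>C T x) \<Longrightarrow> apply_bop (Bop T) x = T x"
  by (subst Bop_inverse) auto

text \<open>
  The representing vector minimises \<open>J x = (norm x)\<^sup>2 - 2 f x\<close>. By the parallelogram law a
  minimising sequence is Cauchy.
\<close>

lemma Riesz_real:
  fixes f :: "'a::{real_inner,complete_space} \<Rightarrow> real"
  assumes f: "bounded_linear f"
  shows "\<exists>y. \<forall>x. f x = inner y x"
proof -
  interpret f: bounded_linear f by fact
  obtain K where K: "K > 0" "\<And>x. \<bar>f x\<bar> \<le> K * norm x"
    using f.pos_bounded by (auto simp: mult.commute)
  define J where "J x = (norm x)\<^sup>2 - 2 * f x" for x
  have Jlow: "J x \<ge> - K\<^sup>2" for x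
  proof -
    have "f x \<le> K * norm x" using K(2)[of x] by auto
    moreover have "(norm x - K)\<^sup>2 \<ge> 0" by simp
    ultimately show ?thesis by (simp add: J_def power2_diff algebra_simps)
  qed
  define m where "m = Inf (range J)"
  have bdd: "bdd_below (range J)" using Jlow by (auto intro!: bdd_belowI[of _ "- K\<^sup>2"])
  have mle: "m \<le> J x" for x unfolding m_def by (rule cInf_lower[OF _ bdd]) simp
  have "\<exists>x. J x < m + 1 / real (Suc n)" for n
  proof -
    have "Inf (range J) < m + 1 / real (Suc n)" by (simp add: m_def)
    then show ?thesis using cInf_less_iff[OF _ bdd] by auto
  qed
  then obtain X where X: "\<And>n. J (X n) < m + 1 / real (Suc n)" by metis
  have par: "J x + J y = 2 * J ((1/2) *\<^sub>R (x + y)) + (norm (x - y))\<^sup>2 / 2" for x y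
    by (simp add: J_def power2_norm_eq_inner f.add f.scaleR inner_simps inner_commute field_simps)
  have "Cauchy X"
  proof (rule CauchyI)
    fix e :: real assume e: "0 < e"
    obtain N where N: "4 / real (Suc N) < e\<^sup>2"
      using reals_Archimedean[of "e\<^sup>2 / 4"] e by (auto simp: field_simps)
    show "\<exists>M. \<forall>i\<ge>M. \<forall>j\<ge>M. norm (X i - X j) < e"
    proof (intro exI[of _ N] allI impI)
      fix i j assume ij: "N \<le> i" "N \<le> j"
      have *: "1 / real (Suc k) \<le> 1 / real (Suc N)" if "N \<le> k" for k
        using that by (intro divide_left_mono) auto
      have "(norm (X i - X j))\<^sup>2 / 2 = J (X i) + J (X j) - 2 * J ((1/2) *\<^sub>R (X i + X j))"
        using par[of "X i" "X j"] by simp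
      also have "\<dots> < 2 / real (Suc N)"
        using X[of i] X[of j] *[OF ij(1)] *[OF ij(2)] mle[of "(1/2) *\<^sub>R (X i + X j)"] by simp
      finally have "(norm (X i - X j))\<^sup>2 < e\<^sup>2" using N by simp
      then show "norm (X i - X j) < e" using e by (simp add: power2_less_imp_less)
    qed
  qed
  then obtain y where y: "X \<longlonglongrightarrow> y" using Cauchy_convergent convergent_def by blast
  have "(\<lambda>n. J (X n)) \<longlonglongrightarrow> J y"
    unfolding J_def by (intro tendsto_intros f.tendsto y)
  moreover have "(\<lambda>n. m + 1 / real (Suc n)) \<longlonglongrightarrow> m + 0"
    by (intro tendsto_intros LIMSEQ_inverse_real_of_nat[unfolded inverse_eq_divide])
  ultimately have "J y \<le> m + 0"
    by (rule LIMSEQ_le) (use X less_imp_le in blast)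
  then have Jy: "J y \<le> m" by simp
  have "f h = inner y h" for h
  proof (cases "h = 0")
    case False
    define \<delta> where "\<delta> = f h - inner y h"
    \<comment> \<open>The step at which the quadratic polynomial \<open>t \<mapsto> J (y + t h)\<close> would be minimal.\<close>
    define t where "t = \<delta> / inner h h"
    have "J (y + t *\<^sub>R h) = J y - 2 * t * \<delta> + t\<^sup>2 * inner h h"
      by (simp add: J_def power2_norm_eq_inner f.add f.scaleR inner_simps inner_commute
          algebra_simps \<delta>_def) (simp add: power2_eq_square)
    also have "t\<^sup>2 * inner h h = t * \<delta>" using False by (simp add: t_def power2_eq_square)
    finally have "t * \<delta> \<le> 0" using mle[of "y + t *\<^sub>R h"] Jy by (simp add: mult.commute)
    then have "\<delta> * \<delta> / inner h h \<le> 0" by (simp add: t_def)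
    then have "\<delta> * \<delta> \<le> 0" using False inner_gt_zero_iff[of h] by (simp add: divide_le_0_iff not_le[symmetric])
    then have "\<delta> = 0" by (auto simp: mult_le_0_iff)
    then show ?thesis by (simp add: \<delta>_def)
  qed (simp add: f.zero)
  then show ?thesis by blast
qed

lemma Riesz_complex:
  fixes f :: "'a::complex_hilbert_space \<Rightarrow> complex"
  assumes f: "bounded_linear f" and fc: "\<And>c x. f (c *\<^sub>C x) = c * f x"
  shows "\<exists>y. \<forall>x. f x = cinner y x"
proof -
  have "bounded_linear (\<lambda>x. Re (f x))"
    by (rule bounded_linear_compose[OF bounded_linear_Re f])
  from Riesz_real[OF this] obtain y where y: "\<And>x. Re (f x) = inner y x" by blast
  have "f x = cinner y x" for x
  proof (rule complex_eqI)
    show "Re (f x) = Re (cinner y x)" by (simp add: y inner_eq_Re_cinner)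
    show "Im (f x) = Im (cinner y x)"
      using y[of "\<i> *\<^sub>C x"] by (simp add: fc inner_eq_Re_cinner cinner_scaleC_right)
  qed
  then show ?thesis by blast
qed

text \<open>
  The definite description behind \<open>adj\<close> denotes: the Riesz vector of the functional
  \<open>y \<mapsto> cinner x (apply_bop T y)\<close> depends linearly and boundedly on \<open>x\<close>.
\<close>

lemma cinner_adj_left: "cinner (apply_bop (adj T) x) y = cinner x (apply_bop T y)"
proof -
  have "\<exists>s. \<forall>y. cinner x (apply_bop T y) = cinner s y" for x
    by (intro Riesz_complex bounded_linear_compose[OF cinner.bounded_linear_right]
        bounded_linear_apply_bop)
      (simp add: apply_bop_scaleC cinner_scaleC_right)
  then obtain S where S: "\<And>x y. cinner x (apply_bop T y) = cinner (S x) y" by metis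
  obtain K where K: "K > 0" "\<And>x. norm (apply_bop T x) \<le> K * norm x"
    by (rule apply_bop_bound[of T]) blast
  have S': "cinner y (S x) = cinner (apply_bop T y) x" for x y
    by (metis S cinner_commute)
  have add: "S (x + y) = S x + S y" for x y
    by (rule cinner_ext) (simp add: S' cinner_add_right)
  have sc: "S (c *\<^sub>C x) = c *\<^sub>C S x" for c x
    by (rule cinner_ext) (simp add: S' cinner_scaleC_right)
  have bd: "norm (S x) \<le> norm x * K" for x
  proof (cases "S x = 0")
    case False
    have "(norm (S x))\<^sup>2 = cmod (cinner x (apply_bop T (S x)))"
      by (simp add: S cinner_self norm_power)
    also have "\<dots> \<le> norm x * norm (apply_bop T (S x))"
      by (rule cinner_Cauchy_Schwarz)
    also have "\<dots> \<le> norm x * (K * norm (S x))" by (simp add: K mult_left_mono)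
    finally show ?thesis using False by (simp add: power2_eq_square mult.assoc[symmetric])
  qed (use K in simp)
  have "bounded_linear S"
    by (rule bounded_linear_intro[where K = K]) (simp_all add: add sc bd scaleR_scaleC)
  then have *: "apply_bop (Bop S) x = S x" for x by (rule apply_Bop) (rule sc)
  have "\<exists>!S. \<forall>x y. cinner (apply_bop S x) y = cinner x (apply_bop T y)"
  proof (rule ex1I[of _ "Bop S"])
    fix S' assume a: "\<forall>x y. cinner (apply_bop S' x) y = cinner x (apply_bop T y)"
    show "S' = Bop S"
      by (rule bop_eqI, rule cinner_ext) (metis * S a cinner_commute)
  qed (simp add: * S)
  from theI'[OF this] show ?thesis unfolding adj_def by blast
qed

lemma cinner_adj_right: "cinner x (apply_bop (adj T) y) = cinner (apply_bop T x) y"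
  by (metis cinner_adj_left cinner_commute)

lemma adj_zero [simp]: "adj 0 = 0"
  by (rule bop_eqI, rule cinner_ext) (simp add: cinner_adj_right cinner.zero_left cinner.zero_right)

lemma self_adjoint_cinner:
  "self_adjoint T \<Longrightarrow> cinner (apply_bop T x) y = cinner x (apply_bop T y)"
  using cinner_adj_left[of T x y] by (simp add: self_adjoint_def)

text \<open>
  Density of the linear span. Combinations are indexed by the family and not by its range,
  because the families below may contain repetitions and zero vectors.
\<close>

definition total_family :: "('i \<Rightarrow> 'a::complex_hilbert_space) \<Rightarrow> bool" where
  "total_family \<rho> \<longleftrightarrow>
     (\<forall>x. \<forall>e>0. \<exists>J c. finite J \<and> norm (x - (\<Sum>i\<in>J. c i *\<^sub>C \<rho> i)) < e)"

lemma total_family_seq: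
  assumes "total_family \<rho>"
  shows "\<exists>J c. (\<forall>n. finite (J n)) \<and> (\<lambda>n. \<Sum>i\<in>J n. c n i *\<^sub>C \<rho> i) \<longlonglongrightarrow> x"
proof -
  have "\<exists>J c. finite J \<and> norm (x - (\<Sum>i\<in>J. c i *\<^sub>C \<rho> i)) < inverse (real (Suc n))" for n
    using assms unfolding total_family_def by simp
  then obtain J c where *: "\<And>n. finite (J n)"
    "\<And>n. norm (x - (\<Sum>i\<in>J n. c n i *\<^sub>C \<rho> i)) < inverse (real (Suc n))" by metis
  have "(\<lambda>n. (\<Sum>i\<in>J n. c n i *\<^sub>C \<rho> i) - x) \<longlonglongrightarrow> 0"
    by (rule Lim_null_comparison[OF _ LIMSEQ_inverse_real_of_nat])
      (use *(2) in \<open>auto simp: norm_minus_commute intro!: always_eventually less_imp_le\<close>)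
  then show ?thesis using *(1)
    by (intro exI[of _ J] exI[of _ c]) (simp add: LIM_zero_iff)
qed

lemma lincomb_diff:
  fixes \<rho> :: "'i \<Rightarrow> 'a::complex_vector"
  assumes "finite J" "finite J'"
  shows "(\<Sum>i\<in>J. c i *\<^sub>C \<rho> i) - (\<Sum>i\<in>J'. c' i *\<^sub>C \<rho> i) =
    (\<Sum>i\<in>J\<union>J'. ((if i \<in> J then c i else 0) - (if i \<in> J' then c' i else 0)) *\<^sub>C \<rho> i)"
proof -
  have "(\<Sum>i\<in>J. c i *\<^sub>C \<rho> i) = (\<Sum>i\<in>J\<union>J'. (if i \<in> J then c i else 0) *\<^sub>C \<rho> i)"
    using assms by (intro sum.mono_neutral_cong_left) auto
  moreover have "(\<Sum>i\<in>J'. c' i *\<^sub>C \<rho> i) = (\<Sum>i\<in>J\<union>J'. (if i \<in> J' then c' i else 0) *\<^sub>C \<rho> i)"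
    using assms by (intro sum.mono_neutral_cong_left) auto
  ultimately show ?thesis
    by (simp add: complex_vector.scale_left_diff_distrib sum_subtractf)
qed

text \<open>
  The norm estimate makes the assignment \<open>\<rho> i \<mapsto> \<sigma> i\<close> well defined on linear combinations, even if the
  \<open>\<rho> i\<close> are dependent, and Lipschitz continuous there, so that it extends from the dense span.
\<close>

lemma bop_extension:
  fixes \<rho> \<sigma> :: "'i \<Rightarrow> 'a::complex_hilbert_space"
  assumes tot: "total_family \<rho>"
    and bd: "\<And>J c. finite J \<Longrightarrow>
      norm (\<Sum>i\<in>J. c i *\<^sub>C \<sigma> i) \<le> M * norm (\<Sum>i\<in>J. c i *\<^sub>C \<rho> i)"
  shows "\<exists>T. \<forall>i. apply_bop T (\<rho> i) = \<sigma> i"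
proof -
  define N where "N = max M 1"
  have bdN: "norm (\<Sum>i\<in>J. c i *\<^sub>C \<sigma> i) \<le> N * norm (\<Sum>i\<in>J. c i *\<^sub>C \<rho> i)" if "finite J" for J c
    by (rule order_trans[OF bd[OF that]]) (simp add: N_def mult_right_mono)
  define s where "s x = (SOME (J, c). finite J \<and> x = (\<Sum>i\<in>J. c i *\<^sub>C \<rho> i))" for x
  define f where "f x = (case s x of (J, c) \<Rightarrow> \<Sum>i\<in>J. c i *\<^sub>C \<sigma> i)" for x
  define D where "D = {x. \<exists>J c. finite J \<and> x = (\<Sum>i\<in>J. c i *\<^sub>C \<rho> i)}"
  have f: "f (\<Sum>i\<in>J. c i *\<^sub>C \<rho> i) = (\<Sum>i\<in>J. c i *\<^sub>C \<sigma> i)" if J: "finite J" for J c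
  proof -
    define x where "x = (\<Sum>i\<in>J. c i *\<^sub>C \<rho> i)"
    obtain J' c' where s: "s x = (J', c')" by force
    have "case s x of (J, c) \<Rightarrow> finite J \<and> x = (\<Sum>i\<in>J. c i *\<^sub>C \<rho> i)"
      unfolding s_def by (rule someI[of _ "(J, c)"]) (simp add: x_def J)
    then have J': "finite J'" "x = (\<Sum>i\<in>J'. c' i *\<^sub>C \<rho> i)" by (auto simp: s)
    have "norm ((\<Sum>i\<in>J. c i *\<^sub>C \<sigma> i) - (\<Sum>i\<in>J'. c' i *\<^sub>C \<sigma> i))
        \<le> N * norm ((\<Sum>i\<in>J. c i *\<^sub>C \<rho> i) - (\<Sum>i\<in>J'. c' i *\<^sub>C \<rho> i))"
      unfolding lincomb_diff[OF J J'(1)] using J J'(1) by (intro bdN) auto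
    also have "\<dots> = 0" using J' by (simp add: x_def)
    finally have "(\<Sum>i\<in>J. c i *\<^sub>C \<sigma> i) = (\<Sum>i\<in>J'. c' i *\<^sub>C \<sigma> i)" by simp
    then show ?thesis by (simp add: f_def s flip: x_def)
  qed
  have lip: "norm (f x - f y) \<le> N * norm (x - y)" if "x \<in> D" "y \<in> D" for x y
  proof -
    obtain J c J' c' where *: "finite J" "x = (\<Sum>i\<in>J. c i *\<^sub>C \<rho> i)"
      "finite J'" "y = (\<Sum>i\<in>J'. c' i *\<^sub>C \<rho> i)"
      using \<open>x \<in> D\<close> \<open>y \<in> D\<close> unfolding D_def by blast
    show ?thesis unfolding * f[OF *(1)] f[OF *(3)] lincomb_diff[OF *(1,3)]
      using * by (intro bdN) auto
  qed
  have "uniformly_continuous_on D f"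
    by (rule lipschitz_on_uniformly_continuous[of N])
      (use lip in \<open>auto simp: lipschitz_on_def dist_norm N_def\<close>)
  then obtain g where g: "uniformly_continuous_on (closure D) g" "\<And>x. x \<in> D \<Longrightarrow> f x = g x"
    by (rule uniformly_continuous_on_extension_on_closure) blast
  have "closure D = UNIV"
  proof -
    have "x \<in> closure D" for x
    proof -
      obtain J c where J: "\<forall>n. finite (J n)" "(\<lambda>n. \<Sum>i\<in>J n. c n i *\<^sub>C \<rho> i) \<longlonglongrightarrow> x"
        using total_family_seq[OF tot, of x] by (elim exE conjE) (rule that)
      note J = J(1)[rule_format] J(2)
      show ?thesis unfolding closure_sequential
        by (rule exI[of _ "\<lambda>n. \<Sum>i\<in>J n. c n i *\<^sub>C \<rho> i"]) (use J in \<open>auto simp: D_def\<close>)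
    qed
    then show ?thesis by blast
  qed
  then have cg: "continuous_on UNIV g"
    using g(1) uniformly_continuous_imp_continuous by auto
  have tg: "(\<lambda>n. g (X n)) \<longlonglongrightarrow> g x" if "X \<longlonglongrightarrow> x" for X x
    using cg that continuous_on_tendsto_compose by fastforce
  have gJ: "g (\<Sum>i\<in>J. c i *\<^sub>C \<rho> i) = (\<Sum>i\<in>J. c i *\<^sub>C \<sigma> i)" if "finite J" for J c
    using f[OF that] g(2) that unfolding D_def by (metis (mono_tags, lifting) mem_Collect_eq)
  have diff: "g (x - y) = g x - g y" for x y
  proof -
    obtain J c where J: "\<forall>n. finite (J n)" "(\<lambda>n. \<Sum>i\<in>J n. c n i *\<^sub>C \<rho> i) \<longlonglongrightarrow> x"
      using total_family_seq[OF tot, of x] by (elim exE conjE) (rule that)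
    note J = J(1)[rule_format] J(2)
    obtain J' c' where J': "\<forall>n. finite (J' n)" "(\<lambda>n. \<Sum>i\<in>J' n. c' n i *\<^sub>C \<rho> i) \<longlonglongrightarrow> y"
      using total_family_seq[OF tot, of y] by (elim exE conjE) (rule that)
    note J' = J'(1)[rule_format] J'(2)
    have 0: "(\<lambda>n. g ((\<Sum>i\<in>J n. c n i *\<^sub>C \<rho> i) - (\<Sum>i\<in>J' n. c' n i *\<^sub>C \<rho> i))) =
      (\<lambda>n. g (\<Sum>i\<in>J n. c n i *\<^sub>C \<rho> i) - g (\<Sum>i\<in>J' n. c' n i *\<^sub>C \<rho> i))"
    proof
      fix n
      show "g ((\<Sum>i\<in>J n. c n i *\<^sub>C \<rho> i) - (\<Sum>i\<in>J' n. c' n i *\<^sub>C \<rho> i)) =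
        g (\<Sum>i\<in>J n. c n i *\<^sub>C \<rho> i) - g (\<Sum>i\<in>J' n. c' n i *\<^sub>C \<rho> i)"
        unfolding gJ[OF J(1)] gJ[OF J'(1)] lincomb_diff[OF J(1) J'(1)]
        using J(1) J'(1) by (intro gJ) auto
    qed
    have "(\<lambda>n. g ((\<Sum>i\<in>J n. c n i *\<^sub>C \<rho> i) - (\<Sum>i\<in>J' n. c' n i *\<^sub>C \<rho> i))) \<longlonglongrightarrow> g (x - y)"
      by (intro tg tendsto_diff J J')
    moreover have "(\<lambda>n. g (\<Sum>i\<in>J n. c n i *\<^sub>C \<rho> i) - g (\<Sum>i\<in>J' n. c' n i *\<^sub>C \<rho> i)) \<longlonglongrightarrow> g x - g y"
      by (intro tg tendsto_diff J J')
    ultimately show ?thesis unfolding 0 by (rule LIMSEQ_unique)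
  qed
  have sc: "g (b *\<^sub>C x) = b *\<^sub>C g x" for b x
  proof -
    obtain J c where J: "\<forall>n. finite (J n)" "(\<lambda>n. \<Sum>i\<in>J n. c n i *\<^sub>C \<rho> i) \<longlonglongrightarrow> x"
      using total_family_seq[OF tot, of x] by (elim exE conjE) (rule that)
    note J = J(1)[rule_format] J(2)
    have 0: "(\<lambda>n. g (b *\<^sub>C (\<Sum>i\<in>J n. c n i *\<^sub>C \<rho> i))) = (\<lambda>n. b *\<^sub>C g (\<Sum>i\<in>J n. c n i *\<^sub>C \<rho> i))"
    proof
      fix n
      show "g (b *\<^sub>C (\<Sum>i\<in>J n. c n i *\<^sub>C \<rho> i)) = b *\<^sub>C g (\<Sum>i\<in>J n. c n i *\<^sub>C \<rho> i)"
        using gJ[OF J(1)[of n], of "\<lambda>i. b * c n i"] gJ[OF J(1)[of n], of "c n"]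
        by (simp add: complex_vector.scale_sum_right scaleC_scaleC)
    qed
    have "(\<lambda>n. g (b *\<^sub>C (\<Sum>i\<in>J n. c n i *\<^sub>C \<rho> i))) \<longlonglongrightarrow> g (b *\<^sub>C x)"
      by (intro tg scaleC.tendsto tendsto_const J)
    moreover have "(\<lambda>n. b *\<^sub>C g (\<Sum>i\<in>J n. c n i *\<^sub>C \<rho> i)) \<longlonglongrightarrow> b *\<^sub>C g x"
      by (intro tg scaleC.tendsto tendsto_const J)
    ultimately show ?thesis unfolding 0 by (rule LIMSEQ_unique)
  qed
  have bound: "norm (g x) \<le> norm x * N" for x
  proof -
    obtain J c where J: "\<forall>n. finite (J n)" "(\<lambda>n. \<Sum>i\<in>J n. c n i *\<^sub>C \<rho> i) \<longlonglongrightarrow> x"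
      using total_family_seq[OF tot, of x] by (elim exE conjE) (rule that)
    note J = J(1)[rule_format] J(2)
    have le: "norm (g (\<Sum>i\<in>J n. c n i *\<^sub>C \<rho> i)) \<le> N * norm (\<Sum>i\<in>J n. c n i *\<^sub>C \<rho> i)" for n
      unfolding gJ[OF J(1)] by (rule bdN[OF J(1)])
    have "(\<lambda>n. norm (g (\<Sum>i\<in>J n. c n i *\<^sub>C \<rho> i))) \<longlonglongrightarrow> norm (g x)"
      by (intro tg tendsto_norm J)
    moreover have "(\<lambda>n. N * norm (\<Sum>i\<in>J n. c n i *\<^sub>C \<rho> i)) \<longlonglongrightarrow> N * norm x"
      by (intro tendsto_intros J)
    ultimately have "norm (g x) \<le> N * norm x"
      by (rule LIMSEQ_le) (use le in simp)
    then show ?thesis by (simp add: mult.commute)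
  qed
  have add: "g (x + y) = g x + g y" for x y
    using diff[of "x + y" y] by simp
  have bl: "bounded_linear g"
    by (rule bounded_linear_intro[OF add _ bound]) (simp add: scaleR_scaleC sc)
  have "g (\<rho> i) = \<sigma> i" for i
    using gJ[of "{i}" "\<lambda>_. 1"] by simp
  then show ?thesis using apply_Bop[OF bl sc] by metis
qed

section \<open>Orthonormal bases\<close>

lemma total_family_if_spans_total:
  fixes \<rho> :: "'i \<Rightarrow> 'a::complex_hilbert_space"
  assumes tot: "total_family e"
    and ex: "\<And>k. \<exists>J c. finite J \<and> e k = (\<Sum>i\<in>J. c i *\<^sub>C \<rho> i)"
  shows "total_family \<rho>"
  unfolding total_family_def
proof (intro allI impI)
  fix x and \<epsilon> :: real assume "\<epsilon> > 0"
  then obtain J c where J: "finite J" "norm (x - (\<Sum>k\<in>J. c k *\<^sub>C e k)) < \<epsilon>"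
    using tot unfolding total_family_def by metis
  obtain I b where I: "\<And>k. finite (I k)" "\<And>k. e k = (\<Sum>i\<in>I k. b k i *\<^sub>C \<rho> i)"
    using ex by metis
  define N where "N = (\<Union>k\<in>J. I k)"
  have N: "finite N" using J I by (simp add: N_def)
  have "(\<Sum>k\<in>J. c k *\<^sub>C e k) = (\<Sum>k\<in>J. \<Sum>i\<in>N. (c k * (if i \<in> I k then b k i else 0)) *\<^sub>C \<rho> i)"
  proof (rule sum.cong[OF refl])
    fix k assume k: "k \<in> J"
    have "e k = (\<Sum>i\<in>N. (if i \<in> I k then b k i else 0) *\<^sub>C \<rho> i)"
      unfolding I(2)[of k] by (rule sum.mono_neutral_cong_left) (use N k in \<open>auto simp: N_def\<close>)
    then show "c k *\<^sub>C e k = (\<Sum>i\<in>N. (c k * (if i \<in> I k then b k i else 0)) *\<^sub>C \<rho> i)"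
      by (simp add: complex_vector.scale_sum_right scaleC_scaleC)
  qed
  also have "\<dots> = (\<Sum>i\<in>N. (\<Sum>k\<in>J. c k * (if i \<in> I k then b k i else 0)) *\<^sub>C \<rho> i)"
    by (subst sum.swap) (simp add: complex_vector.scale_sum_left)
  finally show "\<exists>J c. finite J \<and> norm (x - (\<Sum>i\<in>J. c i *\<^sub>C \<rho> i)) < \<epsilon>"
    using J(2) N by (intro exI[of _ N] exI[of _ "\<lambda>i. (\<Sum>k\<in>J. c k * (if i \<in> I k then b k i else 0))"]) simp
qed

text \<open>Orthogonalisation keeps vectors that depend on earlier ones as zero vectors:
  division by zero gives zero.\<close>

fun gram_schmidt_seq :: "(nat \<Rightarrow> 'a::complex_hilbert_space) \<Rightarrow> nat \<Rightarrow> 'a" where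
  "gram_schmidt_seq x n = x n - (\<Sum>k<n. (cinner (gram_schmidt_seq x k) (x n)
      / cinner (gram_schmidt_seq x k) (gram_schmidt_seq x k)) *\<^sub>C gram_schmidt_seq x k)"

declare gram_schmidt_seq.simps [simp del]

lemma gram_schmidt_seq_orthogonal_less:
  "j < n \<Longrightarrow> cinner (gram_schmidt_seq x j) (gram_schmidt_seq x n) = 0"
proof (induction n arbitrary: j rule: less_induct)
  case (less n)
  let ?f = "gram_schmidt_seq x"
  have orth: "cinner (?f j) (?f k) = 0" if "k < n" "k \<noteq> j" for k
    using less.IH[of k j] less.IH[of j k] that less.prems cinner_commute[of "?f j" "?f k"]
    by (cases "j < k") auto
  have "cinner (?f j) (?f n) = cinner (?f j) (x n) - (\<Sum>k<n. (cinner (?f k) (x n)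
      / cinner (?f k) (?f k)) * cinner (?f j) (?f k))"
    by (subst gram_schmidt_seq.simps)
      (simp add: cinner.diff_right cinner.sum_right cinner_scaleC_right)
  also have "(\<Sum>k<n. (cinner (?f k) (x n) / cinner (?f k) (?f k)) * cinner (?f j) (?f k))
     = (\<Sum>k\<in>{j}. (cinner (?f k) (x n) / cinner (?f k) (?f k)) * cinner (?f j) (?f k))"
    by (rule sum.mono_neutral_right) (use less.prems orth in auto)
  also have "\<dots> = cinner (?f j) (x n)"
    by (cases "?f j = 0") (auto simp: cinner_self cinner.zero_left)
  finally show ?case by simp
qed

lemma gram_schmidt_seq_orthogonal:
  "j \<noteq> n \<Longrightarrow> cinner (gram_schmidt_seq x j) (gram_schmidt_seq x n) = 0"
  using gram_schmidt_seq_orthogonal_less[of j n x] gram_schmidt_seq_orthogonal_less[of n j x]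
    cinner_commute[of "gram_schmidt_seq x j" "gram_schmidt_seq x n"]
  by (cases "j < n") auto

lemma gram_schmidt_seq_expand:
  "x n = (\<Sum>k\<le>n. ((if k = n then 1 else cinner (gram_schmidt_seq x k) (x n)
      / cinner (gram_schmidt_seq x k) (gram_schmidt_seq x k))) *\<^sub>C gram_schmidt_seq x k)"
proof -
  have "x n = gram_schmidt_seq x n + (\<Sum>k<n. (cinner (gram_schmidt_seq x k) (x n)
      / cinner (gram_schmidt_seq x k) (gram_schmidt_seq x k)) *\<^sub>C gram_schmidt_seq x k)"
    by (subst gram_schmidt_seq.simps) simp
  then show ?thesis
    by (subst lessThan_Suc_atMost[symmetric]) (simp add: add.commute)
qed

definition orthonormal_basis :: "(nat \<Rightarrow> 'a::complex_hilbert_space) \<Rightarrow> bool" where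
  "orthonormal_basis e \<longleftrightarrow> (\<forall>i j. cinner (e i) (e j) = (if i = j then 1 else 0)) \<and> total_family e"

text \<open>
  Orthogonalise a dense sequence and drop the zero vectors. If only finitely many vectors were
  left, the orthogonal projection onto their span would be the identity on a total family, hence
  everywhere, and the space would be finite-dimensional.
\<close>

lemma ex_orthonormal_basis:
  assumes sep: "separable_space (euclidean :: 'h::complex_hilbert_space topology)"
    and inf: "\<not> (\<exists>B :: 'h set. finite B \<and> cspan B = UNIV)"
  shows "\<exists>e :: nat \<Rightarrow> 'h. orthonormal_basis e"
proof -
  obtain C :: "'h set" where C: "countable C" "closure C = UNIV"
    using sep by (auto simp: separable_space_def)
  then have "C \<noteq> {}" by auto
  then obtain x :: "nat \<Rightarrow> 'h" where x: "range x = C"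
    using C(1) uncountable_def by blast
  let ?f = "gram_schmidt_seq x"
  define N where "N = {n. ?f n \<noteq> 0}"
  have dense: "\<exists>n. norm (y - x n) < \<epsilon>" if eps: "\<epsilon> > 0" for y \<epsilon>
  proof -
    have "y \<in> closure C" using C by simp
    then obtain z where "z \<in> C" "dist z y < \<epsilon>"
      using eps closure_approachable[of y C] by blast
    then show ?thesis using x by (auto simp: dist_norm norm_minus_commute)
  qed
  have totf: "total_family ?f"
    unfolding total_family_def
  proof (intro allI impI)
    fix y :: 'h and \<epsilon> :: real assume "\<epsilon> > 0"
    then obtain n where n: "norm (y - x n) < \<epsilon>" using dense by blast
    then show "\<exists>J c. finite J \<and> norm (y - (\<Sum>i\<in>J. c i *\<^sub>C ?f i)) < \<epsilon>"
      using gram_schmidt_seq_expand[of x n]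
      by (intro exI[of _ "{..n}"] exI[of _ "\<lambda>k. if k = n then 1 else cinner (?f k) (x n) / cinner (?f k) (?f k)"])
        simp
  qed
  have infN: "infinite N"
  proof
    assume fin: "finite N"
    define P where "P y = (\<Sum>k\<in>N. (cinner (?f k) y / cinner (?f k) (?f k)) *\<^sub>C ?f k)" for y
    have Pf: "P (?f n) = ?f n" for n
    proof (cases "n \<in> N")
      case True
      have "P (?f n) = (\<Sum>k\<in>{n}. (cinner (?f k) (?f n) / cinner (?f k) (?f k)) *\<^sub>C ?f k)"
        unfolding P_def
        by (rule sum.mono_neutral_right) (use True fin in \<open>auto simp: gram_schmidt_seq_orthogonal\<close>)
      then show ?thesis using True by (simp add: N_def cinner_self)
    next
      case False
      then show ?thesis by (simp add: N_def P_def cinner.zero_right)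
    qed
    have P_lin: "P (\<Sum>i\<in>J. c i *\<^sub>C g i) = (\<Sum>i\<in>J. c i *\<^sub>C P (g i))" for J :: "nat set" and c g
      unfolding P_def
      by (simp add: cinner.sum_right cinner_scaleC_right sum_divide_distrib
          complex_vector.scale_sum_left complex_vector.scale_sum_right scaleC_scaleC)
        (subst sum.swap, simp)
    have P_id: "P y = y" for y
    proof -
      obtain J c where J: "\<forall>n. finite (J n)" "(\<lambda>n. \<Sum>i\<in>J n. c n i *\<^sub>C ?f i) \<longlonglongrightarrow> y"
        using total_family_seq[OF totf, of y] by (elim exE conjE) (rule that)
      note J = J(1)[rule_format] J(2)
      have "(\<lambda>n. P (\<Sum>i\<in>J n. c n i *\<^sub>C ?f i)) \<longlonglongrightarrow> P y"
        unfolding P_def by (intro tendsto_sum scaleC.tendsto tendsto_divide cinner.tendsto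
            tendsto_const J(2)) (auto simp: N_def cinner_self)
      then have "(\<lambda>n. \<Sum>i\<in>J n. c n i *\<^sub>C ?f i) \<longlonglongrightarrow> P y"
        by (simp only: P_lin Pf)
      from LIMSEQ_unique[OF this J(2)] show ?thesis .
    qed
    have "y \<in> cspan (?f ` N)" for y
      by (subst P_id[symmetric], unfold P_def)
        (intro complex_vector.span_sum complex_vector.span_scale complex_vector.span_base imageI)
    then have "cspan (?f ` N) = UNIV" by auto
    then show False using inf fin by blast
  qed
  define e where "e k = complex_of_real (1 / norm (?f (enumerate N k))) *\<^sub>C ?f (enumerate N k)" for k
  have nz: "?f (enumerate N k) \<noteq> 0" for k
    using enumerate_in_set[OF infN, of k] by (simp add: N_def)
  have on: "cinner (e i) (e j) = (if i = j then 1 else 0)" for i j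
  proof (cases "i = j")
    case True
    have "norm (e j) = 1"
      unfolding e_def norm_scaleC norm_of_real using nz[of j] by simp
    then have "cinner (e j) (e j) = 1" by (simp add: cinner_self)
    then show ?thesis using True by simp
  next
    case False
    then have "enumerate N i \<noteq> enumerate N j" using infN inj_enumerate[of N] by (auto dest: injD)
    then show ?thesis using False
      by (simp add: e_def cinner_scaleC_left cinner_scaleC_right gram_schmidt_seq_orthogonal)
  qed
  have "total_family e"
  proof (rule total_family_if_spans_total[OF totf])
    fix n show "\<exists>J c. finite J \<and> ?f n = (\<Sum>i\<in>J. c i *\<^sub>C e i)"
    proof (cases "n \<in> N")
      case True
      then obtain k where k: "n = enumerate N k" using enumerate_Ex infN by metis
      have "?f n = (\<Sum>i\<in>{k}. complex_of_real (norm (?f n)) *\<^sub>C e i)"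
        using nz[of k] by (simp add: e_def k scaleC_scaleC flip: of_real_mult)
      then show ?thesis
        by (intro exI[of _ "{k}"] exI[of _ "\<lambda>_. complex_of_real (norm (?f n))"]) simp
    qed (auto simp: N_def intro!: exI[of _ "{}"])
  qed
  then show ?thesis using on by (intro exI[of _ e]) (simp add: orthonormal_basis_def)
qed

lemma bop_eqI_total:
  assumes e: "total_family e" and eq: "\<And>i j. cinner (e i) (apply_bop S (e j)) = cinner (e i) (apply_bop T (e j))"
  shows "S = T"
proof (rule bop_eqI)
  have lim: "(\<lambda>n. apply_bop R (X n)) \<longlonglongrightarrow> apply_bop R x" if "X \<longlonglongrightarrow> x" for X x R
    by (rule bounded_linear.tendsto[OF bounded_linear_apply_bop that])
  have 1: "apply_bop S (e j) = apply_bop T (e j)" for j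
  proof (rule cinner_ext)
    fix z
    obtain J c where J: "\<forall>n. finite (J n)" "(\<lambda>n. \<Sum>i\<in>J n. c n i *\<^sub>C e i) \<longlonglongrightarrow> z"
      using total_family_seq[OF e, of z] by (elim exE conjE) (rule that)
    have "(\<lambda>n. cinner (\<Sum>i\<in>J n. c n i *\<^sub>C e i) (apply_bop S (e j))) \<longlonglongrightarrow> cinner z (apply_bop S (e j))"
      by (intro cinner.tendsto J tendsto_const)
    moreover have "(\<lambda>n. cinner (\<Sum>i\<in>J n. c n i *\<^sub>C e i) (apply_bop S (e j))) \<longlonglongrightarrow> cinner z (apply_bop T (e j))"
      unfolding cinner.sum_left cinner_scaleC_left eq
      unfolding cinner.sum_left[symmetric] cinner_scaleC_left[symmetric]
      by (intro cinner.tendsto J tendsto_const)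
    ultimately show "cinner z (apply_bop S (e j)) = cinner z (apply_bop T (e j))"
      by (rule LIMSEQ_unique)
  qed
  fix x
  obtain J c where J: "\<forall>n. finite (J n)" "(\<lambda>n. \<Sum>i\<in>J n. c n i *\<^sub>C e i) \<longlonglongrightarrow> x"
    using total_family_seq[OF e, of x] by (elim exE conjE) (rule that)
  have "(\<lambda>n. apply_bop S (\<Sum>i\<in>J n. c n i *\<^sub>C e i)) \<longlonglongrightarrow> apply_bop S x"
    by (rule lim[OF J(2)])
  moreover have "(\<lambda>n. apply_bop S (\<Sum>i\<in>J n. c n i *\<^sub>C e i)) \<longlonglongrightarrow> apply_bop T x"
    using lim[OF J(2), of T] by (simp only: apply_bop_sum apply_bop_scaleC 1)
  ultimately show "apply_bop S x = apply_bop T x"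
    by (rule LIMSEQ_unique)
qed

section \<open>Gram vectors of positive semidefinite kernels\<close>

definition psd_kernel :: "('i \<Rightarrow> 'i \<Rightarrow> complex) \<Rightarrow> bool" where
  "psd_kernel K \<longleftrightarrow>
     (\<forall>J c. finite J \<longrightarrow> 0 \<le> (\<Sum>i\<in>J. \<Sum>j\<in>J. cnj (c i) * c j * K i j))"

lemma psd_kernelD:
  "psd_kernel K \<Longrightarrow> finite J \<Longrightarrow> 0 \<le> (\<Sum>i\<in>J. \<Sum>j\<in>J. cnj (c i) * c j * K i j)"
  by (simp add: psd_kernel_def)

lemma psd_kernel_diag: "psd_kernel K \<Longrightarrow> 0 \<le> K i i"
  using psd_kernelD[of K "{i}" "\<lambda>_. 1"] by simp

lemma psd_kernel_pair:
  assumes "psd_kernel K" "i \<noteq> j"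
  shows "0 \<le> K i i + b * K i j + cnj b * K j i + cnj b * b * K j j"
  using psd_kernelD[OF assms(1), of "{i, j}" "\<lambda>x. if x = i then 1 else b"] assms(2)
  by (simp add: algebra_simps)

lemma psd_kernel_hermitian:
  assumes "psd_kernel K" shows "K j i = cnj (K i j)"
proof (cases "i = j")
  case True
  then show ?thesis using psd_kernel_diag[OF assms, of i]
    by (simp add: zero_le_complex_iff complex_eq_iff)
next
  case False
  from psd_kernel_pair[OF assms False, of 1] psd_kernel_pair[OF assms False, of \<i>]
    psd_kernel_diag[OF assms, of i] psd_kernel_diag[OF assms, of j]
  show ?thesis by (simp add: zero_le_complex_iff complex_eq_iff)
qed

lemma psd_kernel_zero_diag:
  assumes "psd_kernel K" "K i i = 0" shows "K i j = 0"
proof (cases "i = j")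
  case False
  define r where "r = Re (K j j)"
  have h: "K j i = cnj (K i j)" by (rule psd_kernel_hermitian[OF assms(1)])
  have rr: "0 \<le> r" using psd_kernel_diag[OF assms(1), of j] by (simp add: r_def zero_le_complex_iff)
  \<comment> \<open>The form at \<open>(1, b)\<close> is \<open>2 Re (b K i j) + |b|^2 K j j\<close>; take \<open>b\<close> a small multiple of \<open>- cnj (K i j)\<close>.\<close>
  define \<epsilon> where "\<epsilon> = 1 / (1 + r)"
  have e: "\<epsilon> > 0" "\<epsilon> * r < 1" using rr by (simp_all add: \<epsilon>_def)
  define b where "b = - complex_of_real \<epsilon> * cnj (K i j)"
  have "0 \<le> Re (K i i + b * K i j + cnj b * K j i + cnj b * b * K j j)"
    using psd_kernel_pair[OF assms(1) False, of b] by (simp add: zero_le_complex_iff)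
  also have "\<dots> = - 2 * \<epsilon> * (cmod (K i j))\<^sup>2 + \<epsilon>\<^sup>2 * (cmod (K i j))\<^sup>2 * r"
    unfolding b_def h r_def cmod_power2
    by (simp add: assms(2) power2_eq_square algebra_simps)
  also have "\<dots> = \<epsilon> * (cmod (K i j))\<^sup>2 * (\<epsilon> * r - 2)"
    by (simp add: power2_eq_square algebra_simps)
  finally have "0 \<le> (\<epsilon> * (\<epsilon> * r - 2)) * (cmod (K i j))\<^sup>2" by (simp add: mult.commute mult.left_commute)
  moreover have "\<epsilon> * (\<epsilon> * r - 2) < 0" using e by (simp add: mult_less_0_iff)
  ultimately have "(cmod (K i j))\<^sup>2 \<le> 0"
    using e by (auto simp: zero_le_mult_iff)
  then show ?thesis by simp
qed (use assms in simp)

text \<open>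
  The form of the Schur complement is the minimum of the given form over the coefficient at \<open>p\<close>. If
  the pivot \<open>K p p\<close> is zero, the convention \<open>x / 0 = 0\<close> leaves the kernel unchanged.
\<close>

lemma psd_kernel_Schur_complement:
  fixes K :: "'i \<Rightarrow> 'i \<Rightarrow> complex"
  assumes K: "psd_kernel K"
  shows "psd_kernel (\<lambda>i j. K i j - K i p * K p j / K p p)"
  unfolding psd_kernel_def
proof (intro allI impI)
  fix J :: "'i set" and c :: "'i \<Rightarrow> complex" assume J: "finite J"
  show "0 \<le> (\<Sum>i\<in>J. \<Sum>j\<in>J. cnj (c i) * c j * (K i j - K i p * K p j / K p p))"
  proof (cases "K p p = 0")
    case True
    then show ?thesis using psd_kernelD[OF K J] by simp
  next
    case False
    define c0 where "c0 i = (if i \<in> J then c i else 0)" for i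
    define J' where "J' = insert p J"
    have J': "finite J'" "p \<in> J'" using J by (auto simp: J'_def)
    define S where "S = (\<Sum>j\<in>J'. c0 j * K p j)"
    \<comment> \<open>The minimiser: the form is \<open>t \<mapsto> Q + 2 Re (cnj t S) + |t|^2 K p p\<close>.\<close>
    define t where "t = - S / K p p"
    define d where "d i = c0 i + (if i = p then t else 0)" for i
    have Kpp: "cnj (K p p) = K p p" using psd_kernel_hermitian[OF K, of p p] by simp
    have S': "(\<Sum>i\<in>J'. cnj (c0 i) * K i p) = cnj S"
      by (simp add: S_def psd_kernel_hermitian[OF K, of _ p])
    have delta: "(\<Sum>i\<in>J'. (if i = p then t else 0) * f i) = t * f p"
      "(\<Sum>i\<in>J'. cnj (if i = p then t else 0) * f i) = cnj t * f p" for f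
      using J' by (simp_all add: if_distrib[where f = "\<lambda>x. x * _"] if_distrib[where f = cnj] cong: if_cong)
    have row: "(\<Sum>j\<in>J'. d j * K i j) = (\<Sum>j\<in>J'. c0 j * K i j) + t * K i p" for i
      by (simp add: d_def distrib_right sum.distrib delta)
    have "(\<Sum>i\<in>J'. \<Sum>j\<in>J'. cnj (d i) * d j * K i j) = (\<Sum>i\<in>J'. cnj (d i) * (\<Sum>j\<in>J'. d j * K i j))"
      by (simp add: sum_distrib_left mult.assoc)
    also have "\<dots> = (\<Sum>i\<in>J'. cnj (d i) * ((\<Sum>j\<in>J'. c0 j * K i j) + t * K i p))"
      by (simp only: row)
    also have "\<dots> = (\<Sum>i\<in>J'. cnj (c0 i) * ((\<Sum>j\<in>J'. c0 j * K i j) + t * K i p))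
        + cnj t * ((\<Sum>j\<in>J'. c0 j * K p j) + t * K p p)"
      by (simp add: d_def distrib_right sum.distrib delta)
    also have "(\<Sum>i\<in>J'. cnj (c0 i) * ((\<Sum>j\<in>J'. c0 j * K i j) + t * K i p))
        = (\<Sum>i\<in>J'. \<Sum>j\<in>J'. cnj (c0 i) * c0 j * K i j) + t * cnj S"
      by (simp add: distrib_left sum.distrib sum_distrib_left mult.assoc mult.left_commute S'[symmetric])
    also have "(\<Sum>j\<in>J'. c0 j * K p j) + t * K p p = 0"
      using False by (simp add: t_def S_def)
    finally have "0 \<le> (\<Sum>i\<in>J'. \<Sum>j\<in>J'. cnj (c0 i) * c0 j * K i j) + t * cnj S"
      using psd_kernelD[OF K J'(1), of d] by simp
    also have "t * cnj S = - (\<Sum>i\<in>J'. \<Sum>j\<in>J'. cnj (c0 i) * c0 j * (K i p * K p j / K p p))"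
      unfolding S'[symmetric] unfolding t_def S_def
      by (simp add: sum_product sum_distrib_left sum_distrib_right sum_divide_distrib mult_ac)
        (subst sum.swap, simp add: mult_ac)
    also have "(\<Sum>i\<in>J'. \<Sum>j\<in>J'. cnj (c0 i) * c0 j * K i j)
        + - (\<Sum>i\<in>J'. \<Sum>j\<in>J'. cnj (c0 i) * c0 j * (K i p * K p j / K p p))
        = (\<Sum>i\<in>J'. \<Sum>j\<in>J'. cnj (c0 i) * c0 j * (K i j - K i p * K p j / K p p))"
      by (simp add: right_diff_distrib sum_subtractf)
    also have "\<dots> = (\<Sum>i\<in>J. \<Sum>j\<in>J. cnj (c i) * c j * (K i j - K i p * K p j / K p p))"
    proof (rule sum.mono_neutral_cong_right)
      show "finite J'" "J \<subseteq> J'" using J' by (auto simp: J'_def)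
      show "(\<Sum>j\<in>J'. cnj (c0 i) * c0 j * (K i j - K i p * K p j / K p p)) =
        (\<Sum>j\<in>J. cnj (c i) * c j * (K i j - K i p * K p j / K p p))" if "i \<in> J" for i
        by (rule sum.mono_neutral_cong_right) (use J that in \<open>auto simp: J'_def c0_def\<close>)
    qed (simp add: c0_def)
    finally show ?thesis .
  qed
qed

text \<open>
  The successive Schur complements of Gaussian elimination without pivoting.
\<close>

fun cholesky_rest :: "(nat \<Rightarrow> nat \<Rightarrow> complex) \<Rightarrow> nat \<Rightarrow> nat \<Rightarrow> nat \<Rightarrow> complex" where
  "cholesky_rest K 0 i j = K i j"
| "cholesky_rest K (Suc k) i j = cholesky_rest K k i j
     - cholesky_rest K k i k * cholesky_rest K k k j / cholesky_rest K k k k"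

lemma psd_cholesky_rest: "psd_kernel K \<Longrightarrow> psd_kernel (cholesky_rest K k)"
proof (induction k)
  case (Suc k)
  then show ?case using psd_kernel_Schur_complement[of "cholesky_rest K k" k] by simp
qed (simp add: psd_kernel_def)

lemma cholesky_rest_zero:
  assumes "psd_kernel K" shows "i < k \<Longrightarrow> cholesky_rest K k i j = 0"
proof (induction k arbitrary: i j)
  case (Suc k)
  show ?case
  proof (cases "i = k")
    case True
    then show ?thesis
      using psd_kernel_zero_diag[OF psd_cholesky_rest[OF assms], of k k j] by (cases "cholesky_rest K k k k = 0") auto
  next
    case False
    then show ?thesis using Suc by simp
  qed
qed simp

text \<open>
  After \<open>n\<close> elimination steps the first \<open>n\<close> rows and columns of the remainder vanish. So each entry of
  an infinite matrix is a finite sum of products of its Cholesky factors. Columns with zero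
  pivot vanish.
\<close>

lemma cholesky:
  assumes K: "psd_kernel K"
  obtains l :: "nat \<Rightarrow> nat \<Rightarrow> complex" where
    "\<And>i k. i < k \<Longrightarrow> l i k = 0"
    "\<And>i k. l k k = 0 \<Longrightarrow> l i k = 0"
    "\<And>i j n. i < n \<Longrightarrow> K i j = (\<Sum>k<n. cnj (l i k) * l j k)"
proof
  let ?R = "cholesky_rest K"
  define l where "l j k = ?R k k j / complex_of_real (sqrt (Re (?R k k k)))" for j k
  have psd: "psd_kernel (?R k)" for k by (rule psd_cholesky_rest[OF K])
  have Rkk: "?R k k k = complex_of_real (Re (?R k k k))" "0 \<le> Re (?R k k k)" for k
    using psd_kernel_diag[OF psd, of k k] by (auto simp: zero_le_complex_iff complex_eq_iff)
  have herm: "?R k j i = cnj (?R k i j)" for k i j by (rule psd_kernel_hermitian[OF psd])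
  have z: "?R k i j = 0" if "i < k" for k i j by (rule cholesky_rest_zero[OF K that])
  show "l i k = 0" if "i < k" for i k
    using z[OF that, of k] herm[of k k i] by (simp add: l_def)
  show "l i k = 0" if "l k k = 0" for i k
  proof -
    have "Re (?R k k k) = 0 \<or> ?R k k k = 0" using that by (auto simp: l_def)
    then have "?R k k k = 0" using Rkk[of k] by auto
    from psd_kernel_zero_diag[OF psd this] show ?thesis by (simp add: l_def)
  qed
  have prod: "cnj (l i k) * l j k = ?R k i k * ?R k k j / ?R k k k" for i j k
  proof -
    have "complex_of_real (sqrt (Re (?R k k k))) * complex_of_real (sqrt (Re (?R k k k))) = ?R k k k"
      using Rkk[of k] by (simp flip: of_real_mult)
    then show ?thesis using herm[of k i k] by (simp add: l_def)
  qed
  have "K i j - ?R n i j = (\<Sum>k<n. cnj (l i k) * l j k)" for i j n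
    by (induction n) (simp_all add: prod)
  then show "K i j = (\<Sum>k<n. cnj (l i k) * l j k)" if "i < n" for i j n
    using z[OF that] by (metis diff_zero)
qed

text \<open>
  Kolmogorov decomposition inside a given Hilbert space with basis \<open>e\<close>: the kernel is the Gram
  matrix of vectors \<open>\<rho> i\<close>. The basis vectors \<open>e k\<close>, \<open>k \<in> V\<close>, belonging to the zero pivots are
  orthogonal to all of them and fill up the space.
\<close>

lemma kolmogorov_decomposition_nat:
  fixes e :: "nat \<Rightarrow> 'h::complex_hilbert_space"
  assumes e: "orthonormal_basis e" and K: "psd_kernel K"
  obtains \<rho> :: "nat \<Rightarrow> 'h" and V where
    "\<And>i j. cinner (\<rho> i) (\<rho> j) = K i j"
    "\<And>k i. k \<in> V \<Longrightarrow> cinner (e k) (\<rho> i) = 0"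
    "total_family (case_sum \<rho> (\<lambda>k. if k \<in> V then e k else 0))"
proof -
  have ee: "cinner (e i) (e j) = (if i = j then 1 else 0)" for i j
    using e by (simp add: orthonormal_basis_def)
  obtain l where l: "\<And>i k. i < k \<Longrightarrow> l i k = 0" "\<And>i k. l k k = 0 \<Longrightarrow> l i k = 0"
    "\<And>i j n. i < n \<Longrightarrow> K i j = (\<Sum>k<n. cnj (l i k) * l j k)"
    by (rule cholesky[OF K]) (rule that; assumption)
  define \<rho> where "\<rho> i = (\<Sum>k\<le>i. l i k *\<^sub>C e k)" for i
  define V where "V = {k. l k k = 0}"
  have \<rho>_ext: "\<rho> i = (\<Sum>k<n. l i k *\<^sub>C e k)" if "i < n" for i n
    unfolding \<rho>_def by (rule sum.mono_neutral_cong_left) (use that l(1) in auto)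
  have ek: "cinner (e k) (\<rho> i) = l i k" for i k
  proof -
    have "cinner (e k) (\<rho> i) = (\<Sum>k'<Suc (i + k). l i k' * (if k = k' then 1 else 0))"
      by (simp only: \<rho>_ext[of i "Suc (i + k)"] cinner.sum_right cinner_scaleC_right ee)
    also have "\<dots> = l i k" by (simp add: sum.delta' if_distrib cong: if_cong)
    finally show ?thesis .
  qed
  have gram: "cinner (\<rho> i) (\<rho> j) = K i j" for i j
    unfolding l(3)[of i "Suc i" j, OF lessI]
    by (subst \<rho>_ext[of i "Suc i"]) (simp_all only: lessI cinner.sum_left cinner_scaleC_left ek)
  let ?w = "case_sum \<rho> (\<lambda>k. if k \<in> V then e k else 0)"
  define D where "D = {x. \<exists>J c. finite J \<and> x = (\<Sum>i\<in>J. c i *\<^sub>C ?w i)}"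
  have Dw: "?w i \<in> D" for i
    unfolding D_def by (auto intro!: exI[of _ "{i}"] exI[of _ "\<lambda>_. 1"])
  have Dsc: "c *\<^sub>C x \<in> D" if "x \<in> D" for c x
  proof -
    obtain J b where J: "finite J" "x = (\<Sum>i\<in>J. b i *\<^sub>C ?w i)" using \<open>x \<in> D\<close> D_def by blast
    have "c *\<^sub>C x = (\<Sum>i\<in>J. (c * b i) *\<^sub>C ?w i)" by (simp add: J complex_vector.scale_sum_right scaleC_scaleC)
    then show ?thesis unfolding D_def
      using J(1) by (intro CollectI exI[of _ J] exI[of _ "\<lambda>i. c * b i"]) simp
  qed
  have Ddiff: "x - y \<in> D" if "x \<in> D" "y \<in> D" for x y
  proof -
    obtain J b J' b' where *: "finite J" "x = (\<Sum>i\<in>J. b i *\<^sub>C ?w i)" "finite J'" "y = (\<Sum>i\<in>J'. b' i *\<^sub>C ?w i)"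
      using \<open>x \<in> D\<close> \<open>y \<in> D\<close> D_def by blast
    show ?thesis unfolding D_def *(2) *(4) lincomb_diff[OF *(1,3)]
      by (intro CollectI exI[of _ "J \<union> J'"] exI[of _ "\<lambda>i. (if i \<in> J then b i else 0) - (if i \<in> J' then b' i else 0)"])
        (use * in auto)
  qed
  have De: "e k \<in> D" for k
  proof (induction k rule: less_induct)
    case (less k)
    show ?case
    proof (cases "k \<in> V")
      case True
      then show ?thesis using Dw[of "Inr k"] by simp
    next
      case False
      have "(\<rho> k - (\<Sum>m\<in>N. l k m *\<^sub>C e m)) \<in> D" if "finite N" "N \<subseteq> {..<k}" for N
        using that
      proof (induction N rule: finite_induct)
        case empty
        then show ?case using Dw[of "Inl k"] by simp
      next
        case (insert m N)
        then have "\<rho> k - (\<Sum>m\<in>N. l k m *\<^sub>C e m) - l k m *\<^sub>C e m \<in> D"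
          by (intro Ddiff[OF _ Dsc[OF less.IH]]) auto
        then show ?case using insert by (simp add: algebra_simps)
      qed
      from this[of "{..<k}"] have "\<rho> k - (\<Sum>m<k. l k m *\<^sub>C e m) \<in> D" by simp
      also have "\<rho> k - (\<Sum>m<k. l k m *\<^sub>C e m) = l k k *\<^sub>C e k"
        unfolding \<rho>_def by (subst lessThan_Suc_atMost[symmetric]) simp
      finally have "(1 / l k k) *\<^sub>C (l k k *\<^sub>C e k) \<in> D" by (rule Dsc)
      then show ?thesis using False by (simp add: scaleC_scaleC V_def)
    qed
  qed
  have "total_family ?w"
  proof (rule total_family_if_spans_total)
    show "total_family e" using e by (simp add: orthonormal_basis_def)
    show "\<exists>J c. finite J \<and> e k = (\<Sum>i\<in>J. c i *\<^sub>C ?w i)" for k using De[of k] by (simp add: D_def)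
  qed
  then show ?thesis using that[of \<rho> V] gram ek by (auto simp: V_def l(2))
qed

lemma psd_kernel_to_nat:
  fixes K :: "'i::countable \<Rightarrow> 'i \<Rightarrow> complex"
  assumes K: "psd_kernel K"
  shows "psd_kernel (\<lambda>m n. if m \<in> range (to_nat :: 'i \<Rightarrow> nat) \<and> n \<in> range (to_nat :: 'i \<Rightarrow> nat)
    then K (from_nat m) (from_nat n) else 0)"
  unfolding psd_kernel_def
proof (intro allI impI)
  fix J :: "nat set" and c :: "nat \<Rightarrow> complex" assume J: "finite J"
  let ?K = "\<lambda>m n. if m \<in> range (to_nat :: 'i \<Rightarrow> nat) \<and> n \<in> range (to_nat :: 'i \<Rightarrow> nat)
    then K (from_nat m) (from_nat n) else 0"
  define I :: "'i set" where "I = to_nat -` J"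
  have I: "finite I" unfolding I_def by (intro finite_vimageI J inj_to_nat)
  have r: "(\<Sum>m\<in>J. f m) = (\<Sum>i\<in>I. f (to_nat i))" if "\<And>m. m \<notin> range (to_nat :: 'i \<Rightarrow> nat) \<Longrightarrow> f m = 0" for f :: "nat \<Rightarrow> complex"
  proof -
    have "(\<Sum>m\<in>J. f m) = (\<Sum>m\<in>to_nat ` I. f m)"
      by (rule sum.mono_neutral_right) (use J that in \<open>auto simp: I_def\<close>)
    also have "\<dots> = (\<Sum>i\<in>I. f (to_nat i))"
      by (subst sum.reindex) (auto simp: inj_on_def)
    finally show ?thesis .
  qed
  have "(\<Sum>m\<in>J. \<Sum>n\<in>J. cnj (c m) * c n * ?K m n)
      = (\<Sum>i\<in>I. \<Sum>j\<in>I. cnj (c (to_nat i)) * c (to_nat j) * K i j)"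
    by (subst r, simp, subst r) auto
  then show "0 \<le> (\<Sum>m\<in>J. \<Sum>n\<in>J. cnj (c m) * c n * ?K m n)"
    using psd_kernelD[OF K I, of "\<lambda>i. c (to_nat i)"] by simp
qed

lemma kolmogorov_decomposition:
  fixes K :: "'i::countable \<Rightarrow> 'i \<Rightarrow> complex" and e :: "nat \<Rightarrow> 'h::complex_hilbert_space"
  assumes e: "orthonormal_basis e" and K: "psd_kernel K"
  obtains \<rho> :: "'i \<Rightarrow> 'h" and V where
    "\<And>i j. cinner (\<rho> i) (\<rho> j) = K i j"
    "\<And>k i. k \<in> V \<Longrightarrow> cinner (e k) (\<rho> i) = 0"
    "total_family (case_sum \<rho> (\<lambda>k. if k \<in> V then e k else 0))"
proof -
  obtain \<rho> :: "nat \<Rightarrow> 'h" and V where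
    *: "\<And>i j. cinner (\<rho> i) (\<rho> j) = (if i \<in> range (to_nat :: 'i \<Rightarrow> nat) \<and> j \<in> range (to_nat :: 'i \<Rightarrow> nat)
      then K (from_nat i) (from_nat j) else 0)"
    "\<And>k i. k \<in> V \<Longrightarrow> cinner (e k) (\<rho> i) = 0"
    "total_family (case_sum \<rho> (\<lambda>k. if k \<in> V then e k else 0))"
    by (rule kolmogorov_decomposition_nat[OF e psd_kernel_to_nat[OF K]]) (rule that; assumption)
  let ?\<rho> = "\<lambda>i::'i. \<rho> (to_nat i)"
  have "total_family (case_sum ?\<rho> (\<lambda>k. if k \<in> V then e k else 0))"
  proof (rule total_family_if_spans_total[OF *(3)])
    fix x :: "nat + nat"
    consider (a) i :: 'i where "x = Inl (to_nat i)" | (b) m where "x = Inl m" "m \<notin> range (to_nat :: 'i \<Rightarrow> nat)" | (c) k where "x = Inr k"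
      by (cases x) auto
    then show "\<exists>J c. finite J \<and> case_sum \<rho> (\<lambda>k. if k \<in> V then e k else 0) x
        = (\<Sum>i\<in>J. c i *\<^sub>C case_sum ?\<rho> (\<lambda>k. if k \<in> V then e k else 0) i)"
    proof cases
      case a
      then show ?thesis by (intro exI[of _ "{Inl i}"] exI[of _ "\<lambda>_. 1"]) simp
    next
      case b
      then have "cinner (\<rho> m) (\<rho> m) = 0" by (simp add: *(1))
      then have "\<rho> m = 0" by (simp add: cinner_self)
      then show ?thesis using b by (intro exI[of _ "{}"]) simp
    next
      case c
      then show ?thesis by (intro exI[of _ "{Inr k}"] exI[of _ "\<lambda>_. 1"]) simp
    qed
  qed
  then show ?thesis using that[of ?\<rho> V] *(1,2) by simp
qed

section \<open>Evaluation at tuples of Hermitian matrices\<close>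

lemma cnj_mat_adjoint:
  assumes "X \<in> carrier_mat n n" "mat_adjoint X = X" "i < n" "j < n"
  shows "cnj (X $$ (i, j)) = X $$ (j, i)"
proof -
  have "X $$ (j, i) = mat_adjoint X $$ (j, i)" using assms(2) by simp
  also have "\<dots> = cnj (X $$ (i, j))"
    using assms(1,3,4) by (simp add: mat_adjoint_def mat_of_rows_index)
  finally show ?thesis by simp
qed

lemma mat_adjointI:
  assumes "X \<in> carrier_mat n n" "\<And>i j. i < n \<Longrightarrow> j < n \<Longrightarrow> cnj (X $$ (i, j)) = X $$ (j, i)"
  shows "mat_adjoint X = X"
  by (rule eq_matI) (use assms in \<open>auto simp: mat_adjoint_def mat_of_rows_index\<close>)

abbreviation word_entry :: "nat \<Rightarrow> ('g \<Rightarrow> complex mat) \<Rightarrow> 'g list \<Rightarrow> nat \<Rightarrow> nat \<Rightarrow> complex" where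
  "word_entry n X w i j \<equiv> word_eval n X (Word w) $$ (i, j)"

definition hermitian_tuple :: "nat \<Rightarrow> ('g \<Rightarrow> complex mat) \<Rightarrow> bool" where
  "hermitian_tuple n X \<longleftrightarrow> (\<forall>j. X j \<in> carrier_mat n n \<and> mat_adjoint (X j) = X j)"

lemma hermitian_tuple_carrier: "hermitian_tuple n X \<Longrightarrow> X j \<in> carrier_mat n n"
  by (simp add: hermitian_tuple_def)

lemma word_eval_carrier [simp]: "hermitian_tuple n X \<Longrightarrow> word_eval n X (Word w) \<in> carrier_mat n n"
  by (induction w) (auto simp: word_eval_def hermitian_tuple_def intro!: mult_carrier_mat[of _ n n _ n])

lemma mat_mult_entry:
  "A \<in> carrier_mat n n \<Longrightarrow> B \<in> carrier_mat n n \<Longrightarrow> i < n \<Longrightarrow> j < n \<Longrightarrow>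
    (A * B) $$ (i, j) = (\<Sum>k<n. A $$ (i, k) * B $$ (k, j))"
  by (auto simp: scalar_prod_def atLeast0LessThan)

lemma word_entry_Nil: "i < n \<Longrightarrow> j < n \<Longrightarrow> word_entry n X [] i j = (if i = j then 1 else 0)"
  by (simp add: word_eval_def)

lemma word_entry_Cons:
  assumes "hermitian_tuple n X" "i < n" "j < n"
  shows "word_entry n X (g # w) i j = (\<Sum>k<n. X g $$ (i, k) * word_entry n X w k j)"
proof -
  have "word_eval n X (Word (g # w)) = X g * word_eval n X (Word w)" by (simp add: word_eval_def)
  then show ?thesis
    using mat_mult_entry[OF hermitian_tuple_carrier[OF assms(1)] word_eval_carrier[OF assms(1)] assms(2,3)] by simp
qed

lemma word_eval_append:
  assumes "hermitian_tuple n X"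
  shows "word_eval n X (Word (v @ w)) = word_eval n X (Word v) * word_eval n X (Word w)"
proof (induction v)
  case Nil
  then show ?case using word_eval_carrier[OF assms, of w] by (simp add: word_eval_def)
next
  case (Cons g v)
  have "word_eval n X (Word ((g # v) @ w)) = X g * word_eval n X (Word (v @ w))" by (simp add: word_eval_def)
  also have "\<dots> = X g * (word_eval n X (Word v) * word_eval n X (Word w))" by (simp only: Cons)
  also have "\<dots> = (X g * word_eval n X (Word v)) * word_eval n X (Word w)"
    by (rule assoc_mult_mat[OF hermitian_tuple_carrier[OF assms] word_eval_carrier[OF assms]
          word_eval_carrier[OF assms], symmetric])
  also have "X g * word_eval n X (Word v) = word_eval n X (Word (g # v))" by (simp add: word_eval_def)
  finally show ?case .
qed

lemma word_entry_append:
  assumes "hermitian_tuple n X" "i < n" "j < n"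
  shows "word_entry n X (v @ w) i j = (\<Sum>k<n. word_entry n X v i k * word_entry n X w k j)"
  unfolding word_eval_append[OF assms(1)] by (rule mat_mult_entry) (use assms in simp_all)

lemma word_entry_singleton:
  assumes "hermitian_tuple n X" "i < n" "j < n"
  shows "word_entry n X [g] i j = X g $$ (i, j)"
proof -
  have "word_entry n X [g] i j = (\<Sum>k<n. X g $$ (i, k) * (if k = j then 1 else 0))"
    unfolding word_entry_Cons[OF assms] by (intro sum.cong refl) (simp add: word_entry_Nil assms)
  then show ?thesis using assms by (simp add: if_distrib cong: if_cong)
qed

lemma word_entry_rev:
  assumes X: "hermitian_tuple n X"
  shows "i < n \<Longrightarrow> j < n \<Longrightarrow> word_entry n X (rev w) i j = cnj (word_entry n X w j i)"
proof (induction w arbitrary: i j)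
  case Nil
  then show ?case by (simp add: word_entry_Nil)
next
  case (Cons g w)
  have "word_entry n X (rev (g # w)) i j = (\<Sum>k<n. word_entry n X (rev w) i k * word_entry n X [g] k j)"
    using word_entry_append[OF X Cons.prems, of "rev w" "[g]"] by simp
  also have "\<dots> = (\<Sum>k<n. cnj (word_entry n X w k i) * cnj (X g $$ (j, k)))"
    using X Cons by (intro sum.cong refl)
      (auto simp: word_entry_singleton hermitian_tuple_def intro!: cnj_mat_adjoint[symmetric])
  also have "\<dots> = cnj (word_entry n X (g # w) j i)"
    using Cons.prems by (simp add: word_entry_Cons[OF X] mult.commute)
  finally show ?case .
qed

definition eval_entry :: "nat \<Rightarrow> ('g \<Rightarrow> complex mat) \<Rightarrow> ('g, 'h::complex_hilbert_space) opoly \<Rightarrow> nat \<Rightarrow> nat \<Rightarrow> 'h bop" where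
  "eval_entry n X p i j = (\<Sum>w\<in>Poly_Mapping.keys p. word_eval n X w $$ (i, j) *\<^sub>C Poly_Mapping.lookup p w)"

lemma opoly_eval_entry: "i < n \<Longrightarrow> j < n \<Longrightarrow> opoly_eval n X p $$ (i, j) = eval_entry n X p i j"
  by (simp add: opoly_eval_def eval_entry_def)

lemma opoly_eval_carrier [simp]: "opoly_eval n X p \<in> carrier_mat n n"
  by (simp add: opoly_eval_def)

lemma eval_entry_superset:
  assumes "finite S" "Poly_Mapping.keys p \<subseteq> S"
  shows "eval_entry n X p i j = (\<Sum>w\<in>S. word_eval n X w $$ (i, j) *\<^sub>C Poly_Mapping.lookup p w)"
  unfolding eval_entry_def
  by (rule sum.mono_neutral_left) (use assms in \<open>auto simp: in_keys_iff\<close>)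

lemma eval_entry_add: "eval_entry n X (p + q) i j = eval_entry n X p i j + eval_entry n X q i j"
proof -
  let ?S = "Poly_Mapping.keys p \<union> Poly_Mapping.keys q"
  have S: "finite ?S" "Poly_Mapping.keys p \<subseteq> ?S" "Poly_Mapping.keys q \<subseteq> ?S" "Poly_Mapping.keys (p + q) \<subseteq> ?S"
    using keys_add[of p q] by auto
  show ?thesis
    unfolding eval_entry_superset[OF S(1,2)] eval_entry_superset[OF S(1,3)] eval_entry_superset[OF S(1,4)]
    by (simp add: lookup_add scaleC_add_right sum.distrib)
qed

lemma eval_entry_zero [simp]: "eval_entry n X 0 i j = 0"
  by (simp add: eval_entry_def)

lemma eval_entry_sum: "eval_entry n X (\<Sum>s\<in>S. p s) i j = (\<Sum>s\<in>S. eval_entry n X (p s) i j)"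
  by (induction S rule: infinite_finite_induct) (auto simp: eval_entry_add)

lemma eval_entry_single [simp]:
  "eval_entry n X (Poly_Mapping.single w P) i j = word_eval n X w $$ (i, j) *\<^sub>C P"
  by (cases "P = 0") (auto simp: eval_entry_def)

lemma opoly_sum_single:
  fixes p :: "('g, 'h::complex_hilbert_space) opoly"
  assumes "finite S" "Poly_Mapping.keys p \<subseteq> S"
  shows "p = (\<Sum>w\<in>S. Poly_Mapping.single w (Poly_Mapping.lookup p w))"
proof (rule poly_mapping_eqI)
  fix k
  have "Poly_Mapping.lookup (\<Sum>w\<in>S. Poly_Mapping.single w (Poly_Mapping.lookup p w)) k
      = (\<Sum>w\<in>S. if w = k then Poly_Mapping.lookup p w else 0)"
    by (simp add: lookup_sum lookup_single when_def)
  also have "\<dots> = Poly_Mapping.lookup p k"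
    using assms by (auto simp: in_keys_iff)
  finally show "Poly_Mapping.lookup p k = Poly_Mapping.lookup (\<Sum>w\<in>S. Poly_Mapping.single w (Poly_Mapping.lookup p w)) k" ..
qed

lemma bop_scaleC_mult: "(a *\<^sub>C S) * (b *\<^sub>C T) = (a * b) *\<^sub>C (S * (T :: 'h::complex_hilbert_space bop))"
  by (rule bop_eqI) (simp add: apply_times_bop apply_scaleC_bop apply_bop_scaleC scaleC_scaleC)

lemma eval_entry_mult:
  assumes X: "hermitian_tuple n X" and ij: "i < n" "j < n"
  shows "eval_entry n X (p * q) i j = (\<Sum>k<n. eval_entry n X p i k * eval_entry n X q k j)"
proof -
  let ?P = "Poly_Mapping.keys p" and ?Q = "Poly_Mapping.keys q"
  have "p * q = (\<Sum>v\<in>?P. Poly_Mapping.single v (Poly_Mapping.lookup p v)) * (\<Sum>w\<in>?Q. Poly_Mapping.single w (Poly_Mapping.lookup q w))"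
    using opoly_sum_single[of ?P p] opoly_sum_single[of ?Q q] by simp
  also have "\<dots> = (\<Sum>v\<in>?P. \<Sum>w\<in>?Q. Poly_Mapping.single (v + w) (Poly_Mapping.lookup p v * Poly_Mapping.lookup q w))"
    by (simp add: sum_product mult_single)
  finally have "eval_entry n X (p * q) i j
      = (\<Sum>v\<in>?P. \<Sum>w\<in>?Q. word_eval n X (v + w) $$ (i, j) *\<^sub>C (Poly_Mapping.lookup p v * Poly_Mapping.lookup q w))"
    by (simp only: eval_entry_sum eval_entry_single)
  also have "\<dots> = (\<Sum>v\<in>?P. \<Sum>w\<in>?Q. \<Sum>k<n. (word_eval n X v $$ (i, k) *\<^sub>C Poly_Mapping.lookup p v) * (word_eval n X w $$ (k, j) *\<^sub>C Poly_Mapping.lookup q w))"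
  proof (intro sum.cong refl)
    fix v w
    have "word_eval n X (v + w) $$ (i, j) = (\<Sum>k<n. word_eval n X v $$ (i, k) * word_eval n X w $$ (k, j))"
      using word_entry_append[OF X ij, of "letters v" "letters w"]
      by (simp add: plus_free_monoid_def)
    then show "word_eval n X (v + w) $$ (i, j) *\<^sub>C (Poly_Mapping.lookup p v * Poly_Mapping.lookup q w)
      = (\<Sum>k<n. (word_eval n X v $$ (i, k) *\<^sub>C Poly_Mapping.lookup p v) * (word_eval n X w $$ (k, j) *\<^sub>C Poly_Mapping.lookup q w))"
      by (simp add: bop_scaleC_mult complex_vector.scale_sum_left)
  qed
  also have "\<dots> = (\<Sum>k<n. \<Sum>v\<in>?P. \<Sum>w\<in>?Q. (word_eval n X v $$ (i, k) *\<^sub>C Poly_Mapping.lookup p v) * (word_eval n X w $$ (k, j) *\<^sub>C Poly_Mapping.lookup q w))"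
    by (subst (2) sum.swap, subst sum.swap) rule
  also have "\<dots> = (\<Sum>k<n. eval_entry n X p i k * eval_entry n X q k j)"
    by (simp add: eval_entry_def sum_product)
  finally show ?thesis .
qed

lemma eval_entry_star:
  assumes X: "hermitian_tuple n X" and ij: "i < n" "j < n"
  shows "cinner u (apply_bop (eval_entry n X (opoly_star p) i j) v) = cinner (apply_bop (eval_entry n X p j i) u) v"
proof -
  have "word_eval n X (Word (rev (letters w))) $$ (i, j) = cnj (word_eval n X w $$ (j, i))" for w
    using word_entry_rev[OF X ij, of "letters w"] by simp
  then have "eval_entry n X (opoly_star p) i j
      = (\<Sum>w\<in>Poly_Mapping.keys p. cnj (word_eval n X w $$ (j, i)) *\<^sub>C adj (Poly_Mapping.lookup p w))"
    by (simp only: opoly_star_def eval_entry_sum eval_entry_single)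
  then show ?thesis
    by (simp add: eval_entry_def[of n X p] apply_sum_bop apply_scaleC_bop
        cinner.sum_left cinner.sum_right cinner_scaleC_left cinner_scaleC_right cinner_adj_right)
qed

lemma eval_entry_pencil:
  assumes X: "hermitian_tuple n X" and ij: "i < n" "j < n"
  shows "eval_entry n X (pencil B0 B) i j = (if i = j then 1 else 0) *\<^sub>C B0 + (\<Sum>g\<in>UNIV. X g $$ (i, j) *\<^sub>C B g)"
  using word_entry_Nil[OF ij, of X] word_entry_singleton[OF X ij]
  by (simp add: pencil_def eval_entry_add eval_entry_sum zero_free_monoid_def)

lemma psd_eval_iff:
  "psd (opoly_eval n X p) \<longleftrightarrow>
    (\<forall>v. 0 \<le> (\<Sum>i<n. \<Sum>j<n. cinner (v i) (apply_bop (eval_entry n X p i j) (v j))))"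
proof -
  have d: "dim_row (opoly_eval n X p) = n" "dim_col (opoly_eval n X p) = n"
    by (simp_all add: opoly_eval_def)
  have "(\<Sum>i<n. \<Sum>j<n. cinner (v i) (apply_bop (opoly_eval n X p $$ (i, j)) (v j)))
    = (\<Sum>i<n. \<Sum>j<n. cinner (v i) (apply_bop (eval_entry n X p i j) (v j)))" for v
    by (intro sum.cong refl) (simp add: opoly_eval_entry)
  then show ?thesis by (simp add: psd_def d)
qed

definition eval_act :: "nat \<Rightarrow> ('g \<Rightarrow> complex mat) \<Rightarrow> ('g, 'h::complex_hilbert_space) opoly \<Rightarrow> (nat \<Rightarrow> 'h) \<Rightarrow> nat \<Rightarrow> 'h" where
  "eval_act n X p v i = (\<Sum>j<n. apply_bop (eval_entry n X p i j) (v j))"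

text \<open>
  The evaluation is multiplicative and turns \<open>opoly_star\<close> into the adjoint.
\<close>

lemma eval_act_star_mult_form:
  assumes X: "hermitian_tuple n X"
  shows "(\<Sum>i<n. cinner (v i) (eval_act n X (opoly_star q * p) v i))
    = (\<Sum>i<n. cinner (eval_act n X q v i) (eval_act n X p v i))"
proof -
  have "eval_act n X (opoly_star q * p) v i = (\<Sum>k<n. apply_bop (eval_entry n X (opoly_star q) i k) (eval_act n X p v k))" if "i < n" for i
    using that unfolding eval_act_def
    by (simp add: eval_entry_mult[OF X] apply_sum_bop apply_times_bop apply_bop_sum)
      (rule sum.swap)
  then have "(\<Sum>i<n. cinner (v i) (eval_act n X (opoly_star q * p) v i))
    = (\<Sum>i<n. \<Sum>k<n. cinner (v i) (apply_bop (eval_entry n X (opoly_star q) i k) (eval_act n X p v k)))"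
    by (simp add: cinner.sum_right)
  also have "\<dots> = (\<Sum>i<n. \<Sum>k<n. cinner (apply_bop (eval_entry n X q k i) (v i)) (eval_act n X p v k))"
    by (intro sum.cong refl eval_entry_star[OF X]) auto
  also have "\<dots> = (\<Sum>k<n. cinner (eval_act n X q v k) (eval_act n X p v k))"
    by (subst sum.swap) (simp add: eval_act_def cinner.sum_left)
  finally show ?thesis .
qed

lemma psd_eval_act: "psd (opoly_eval n X p) \<longleftrightarrow> (\<forall>v. 0 \<le> (\<Sum>i<n. cinner (v i) (eval_act n X p v i)))"
  by (simp add: psd_eval_iff eval_act_def cinner.sum_right)

lemma eval_act_mult:
  assumes X: "hermitian_tuple n X" and i: "i < n"
  shows "eval_act n X (p * q) v i = eval_act n X p (eval_act n X q v) i"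
  using i unfolding eval_act_def
  by (simp add: eval_entry_mult[OF X] apply_sum_bop apply_times_bop apply_bop_sum)
    (rule sum.swap)

text \<open>
  The entries of \<open>L(X)\<close> lie in the operator system, and \<open>\<pi>\<close> maps \<open>L(X)\<close> entrywise to \<open>\<pi>(L)(X)\<close>.
\<close>

lemma psd_certificate:
  fixes A :: "'g::finite \<Rightarrow> 'k::complex_hilbert_space bop" and q r :: "('g, 'h::complex_hilbert_space) opoly"
  assumes X: "hermitian_tuple n X" and L: "psd (opoly_eval n X (pencil 1 A))"
    and \<pi>: "unital_cp_on (cspan (insert 1 (range A))) \<pi>"
  shows "psd (opoly_eval n X (opoly_star r * r + opoly_star q * pencil (\<pi> 1) (\<lambda>j. \<pi> (A j)) * q))"
proof -
  let ?S = "cspan (insert 1 (range A))"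
  let ?T = "opoly_eval n X (pencil 1 A)"
  have add: "\<pi> (a + b) = \<pi> a + \<pi> b" if "a \<in> ?S" "b \<in> ?S" for a b
    using \<pi> that by (simp add: unital_cp_on_def)
  have sc: "\<pi> (c *\<^sub>C a) = c *\<^sub>C \<pi> a" if "a \<in> ?S" for a c
    using \<pi> that by (simp add: unital_cp_on_def)
  have one: "1 \<in> ?S" and A: "A g \<in> ?S" for g
    by (auto intro: complex_vector.span_base)
  have sm: "(\<Sum>g\<in>N. c g *\<^sub>C A g) \<in> ?S \<and> \<pi> (\<Sum>g\<in>N. c g *\<^sub>C A g) = (\<Sum>g\<in>N. c g *\<^sub>C \<pi> (A g))" if "finite N" for N c
    using that
  proof (induction N rule: finite_induct)
    case empty
    show ?case using sc[OF one, of 0] by (simp add: complex_vector.span_zero)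
  next
    case (insert g N)
    then show ?case using add[of "c g *\<^sub>C A g" "\<Sum>g\<in>N. c g *\<^sub>C A g"] sc[OF A, of "c g" g] A[of g]
      by (simp add: complex_vector.span_add complex_vector.span_scale)
  qed
  have entry: "eval_entry n X (pencil 1 A) i j \<in> ?S"
    "\<pi> (eval_entry n X (pencil 1 A) i j) = eval_entry n X (pencil (\<pi> 1) (\<lambda>j. \<pi> (A j))) i j"
    if "i < n" "j < n" for i j
    unfolding eval_entry_pencil[OF X that]
    using sm[of UNIV "\<lambda>g. X g $$ (i, j)"] one
    by (simp_all only: finite add sc complex_vector.span_add complex_vector.span_scale)
  have "elements_mat ?T \<subseteq> ?S"
    by (auto simp: elements_mat_def opoly_eval_entry entry opoly_eval_def[of n X "pencil 1 A"]
        simp flip: eval_entry_def)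
  then have "psd (map_mat \<pi> ?T)"
    using \<pi> L opoly_eval_carrier unfolding unital_cp_on_def by blast
  also have "map_mat \<pi> ?T = opoly_eval n X (pencil (\<pi> 1) (\<lambda>j. \<pi> (A j)))"
    by (rule eq_matI) (auto simp: opoly_eval_def simp flip: eval_entry_def simp: entry)
  finally have pL: "0 \<le> (\<Sum>i<n. cinner (v i) (eval_act n X (pencil (\<pi> 1) (\<lambda>j. \<pi> (A j))) v i))" for v
    by (simp add: psd_eval_act)
  show ?thesis unfolding psd_eval_act
  proof
    fix v
    let ?Q = "pencil (\<pi> 1) (\<lambda>j. \<pi> (A j))"
    have 1: "0 \<le> (\<Sum>i<n. cinner (v i) (eval_act n X (opoly_star r * r) v i))"
      unfolding eval_act_star_mult_form[OF X]
      by (intro complex_zero_le_sum) (simp add: cinner_self zero_le_complex_iff)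
    have "(\<Sum>i<n. cinner (v i) (eval_act n X (opoly_star q * (?Q * q)) v i))
       = (\<Sum>i<n. cinner (eval_act n X q v i) (eval_act n X ?Q (eval_act n X q v) i))"
      unfolding eval_act_star_mult_form[OF X] by (intro sum.cong refl) (simp add: eval_act_mult[OF X])
    then have 2: "0 \<le> (\<Sum>i<n. cinner (v i) (eval_act n X (opoly_star q * ?Q * q) v i))"
      using pL by (simp add: mult.assoc)
    have "(\<Sum>i<n. cinner (v i) (eval_act n X (opoly_star r * r + opoly_star q * ?Q * q) v i))
      = (\<Sum>i<n. cinner (v i) (eval_act n X (opoly_star r * r) v i)) + (\<Sum>i<n. cinner (v i) (eval_act n X (opoly_star q * ?Q * q) v i))"
      by (simp add: eval_act_def eval_entry_add apply_plus_bop sum.distrib cinner_add_right)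
    then show "0 \<le> (\<Sum>i<n. cinner (v i) (eval_act n X (opoly_star r * r + opoly_star q * ?Q * q) v i))"
      using 1 2 by (simp add: zero_le_complex_iff)
  qed
qed

section \<open>The cone of Gram data\<close>

text \<open>
  The components of the Gram data are indexed by \<open>'g option option\<close>: the symbol \<open>None\<close> stands for the
  square \<open>r\<^sup>* r\<close>, and \<open>Some s\<close> for the coefficients of the pencil, where \<open>s = None\<close> is the constant term
  and \<open>s = Some g\<close> the linear term of the letter \<open>g\<close>. \<open>symbol_word\<close> is the word that the
  component inserts between the words on its two sides.
\<close>

fun pencil_coeff :: "('g \<Rightarrow> 'k::complex_hilbert_space bop) \<Rightarrow> 'g option \<Rightarrow> 'k bop" where
  "pencil_coeff A None = 1"
| "pencil_coeff A (Some g) = A g"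

abbreviation pencil_op :: "('g \<Rightarrow> 'k::complex_hilbert_space bop) \<Rightarrow> 'g option \<Rightarrow> 'k \<Rightarrow> 'k" where
  "pencil_op A s \<equiv> apply_bop (pencil_coeff A s)"

fun symbol_word :: "'g option option \<Rightarrow> 'g list" where
  "symbol_word (Some (Some g)) = [g]"
| "symbol_word _ = []"

lemma length_symbol_word: "length (symbol_word \<sigma>) \<le> 1"
  by (cases \<sigma> rule: symbol_word.cases) auto

lemma sum_UNIV_option:
  fixes f :: "'a::finite option \<Rightarrow> 'b::comm_monoid_add"
  shows "(\<Sum>\<sigma>\<in>UNIV. f \<sigma>) = f None + (\<Sum>s\<in>UNIV. f (Some s))"
  by (simp add: UNIV_option_conv sum.reindex)

text \<open>
  \<open>t\<close> encodes a pair of matrices: the scalar matrix \<open>t None\<close>, and the matrix over the operator system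
  with the entries \<open>(\<Sum>s. t (Some s) i j *\<^sub>C pencil_coeff A s)\<close>. Both are required to be positive
  semidefinite.
\<close>

definition coeff_positive ::
    "('g::finite \<Rightarrow> 'k::complex_hilbert_space bop) \<Rightarrow> 'i set \<Rightarrow> ('g option option \<Rightarrow> 'i \<Rightarrow> 'i \<Rightarrow> complex) \<Rightarrow> bool" where
  "coeff_positive A J t \<longleftrightarrow>
     (\<forall>c. 0 \<le> (\<Sum>i\<in>J. \<Sum>j\<in>J. t None i j * (cnj (c i) * c j))) \<and>
     (\<forall>k. 0 \<le> (\<Sum>i\<in>J. \<Sum>j\<in>J. \<Sum>s\<in>UNIV. t (Some s) i j * cinner (k i) (pencil_op A s (k j))))"

text \<open>
  The cone of Gram data, defined as a dual cone: \<open>Z None\<close> is a positive semidefinite kernel and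
  \<open>Z (Some s)\<close> is the value at \<open>pencil_coeff A s\<close> of a completely positive map. As a system of
  inequalities this is a closed condition, and it makes sense even if the coefficients of the pencil are
  linearly dependent.
\<close>

definition dual_positive ::
    "('g::finite \<Rightarrow> 'k::complex_hilbert_space bop) \<Rightarrow> ('g option option \<Rightarrow> 'i \<Rightarrow> 'i \<Rightarrow> complex) \<Rightarrow> bool" where
  "dual_positive A Z \<longleftrightarrow>
     (\<forall>J t. finite J \<longrightarrow> coeff_positive A J t \<longrightarrow> 0 \<le> (\<Sum>i\<in>J. \<Sum>j\<in>J. \<Sum>\<sigma>\<in>UNIV. t \<sigma> i j * Z \<sigma> i j))"

lemma dual_positiveD:
  "dual_positive A Z \<Longrightarrow> finite J \<Longrightarrow> coeff_positive A J t \<Longrightarrow> 0 \<le> (\<Sum>i\<in>J. \<Sum>j\<in>J. \<Sum>\<sigma>\<in>UNIV. t \<sigma> i j * Z \<sigma> i j)"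
  by (simp add: dual_positive_def)

lemma complex_zero_le_add: "0 \<le> (a::complex) \<Longrightarrow> 0 \<le> b \<Longrightarrow> 0 \<le> a + b"
  by (simp add: zero_le_complex_iff)

lemma complex_zero_le_scale: "0 \<le> r \<Longrightarrow> 0 \<le> (a::complex) \<Longrightarrow> 0 \<le> complex_of_real r * a"
  by (simp add: zero_le_complex_iff)

lemma dual_positive_zero: "dual_positive A (\<lambda>\<sigma> i j. 0)"
  by (simp add: dual_positive_def)

lemma dual_positive_add:
  assumes "dual_positive A Z" "dual_positive A Z'"
  shows "dual_positive A (\<lambda>\<sigma> i j. Z \<sigma> i j + Z' \<sigma> i j)"
  using assms unfolding dual_positive_def
  by (simp add: distrib_left sum.distrib complex_zero_le_add)

lemma dual_positive_scale:
  fixes Z :: "'g::finite option option \<Rightarrow> 'i \<Rightarrow> 'i \<Rightarrow> complex"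
  assumes "dual_positive A Z" "0 \<le> r"
  shows "dual_positive A (\<lambda>\<sigma> i j. complex_of_real r * Z \<sigma> i j)"
  unfolding dual_positive_def
proof (intro allI impI)
  fix J :: "'i set" and t assume "finite J" "coeff_positive A J t"
  then have "0 \<le> complex_of_real r * (\<Sum>i\<in>J. \<Sum>j\<in>J. \<Sum>\<sigma>\<in>UNIV. t \<sigma> i j * Z \<sigma> i j)"
    using assms dual_positiveD complex_zero_le_scale by blast
  then show "0 \<le> (\<Sum>i\<in>J. \<Sum>j\<in>J. \<Sum>\<sigma>\<in>UNIV. t \<sigma> i j * (complex_of_real r * Z \<sigma> i j))"
    by (simp add: sum_distrib_left mult.left_commute)
qed

lemma closed_dual_positive: "closed {z. dual_positive A (\<lambda>\<sigma> i j. z (\<sigma>, i, j))}"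
proof -
  have 0: "closed {w::complex. 0 \<le> w}"
    unfolding zero_le_complex_iff
    by (intro closed_Collect_conj closed_Collect_le closed_Collect_eq continuous_intros)
  have "closed {z. finite J \<longrightarrow> coeff_positive A J t \<longrightarrow> 0 \<le> (\<Sum>i\<in>J. \<Sum>j\<in>J. \<Sum>\<sigma>\<in>UNIV. t \<sigma> i j * z (\<sigma>, i, j))}" for J t
  proof -
    have c: "continuous_on UNIV (\<lambda>z::_ \<Rightarrow> complex. \<Sum>i\<in>J. \<Sum>j\<in>J. \<Sum>\<sigma>\<in>UNIV. t \<sigma> i j * z (\<sigma>, i, j))"
      by (intro continuous_intros continuous_on_product_coordinates)
    show ?thesis using closed_vimage[OF 0 c]
      by (cases "finite J \<and> coeff_positive A J t") (auto simp: vimage_def)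
  qed
  then show ?thesis
    unfolding dual_positive_def by (intro closed_Collect_all)
qed

text \<open>
  The elementary members of the cone: a square of rank one, and the compression
  \<open>a \<mapsto> (cinner (k i) (a (k j)))\<close> of the operator system to a family of vectors. Nonnegativity on these
  is all that is needed of a separating functional.
\<close>

fun atom_kernel :: "('g \<Rightarrow> 'k::complex_hilbert_space bop) \<Rightarrow> ('i \<Rightarrow> complex) \<Rightarrow> ('i \<Rightarrow> 'k) \<Rightarrow> 'g option option \<Rightarrow> 'i \<Rightarrow> 'i \<Rightarrow> complex" where
  "atom_kernel A c k None i j = cnj (c i) * c j"
| "atom_kernel A c k (Some s) i j = cinner (k i) (pencil_op A s (k j))"

lemma sum_atom_kernel:
  fixes A :: "'g::finite \<Rightarrow> 'k::complex_hilbert_space bop"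
  shows "(\<Sum>i\<in>J. \<Sum>j\<in>J. \<Sum>\<sigma>\<in>UNIV. t \<sigma> i j * atom_kernel A c k \<sigma> i j)
    = (\<Sum>i\<in>J. \<Sum>j\<in>J. t None i j * (cnj (c i) * c j)) +
      (\<Sum>i\<in>J. \<Sum>j\<in>J. \<Sum>s\<in>UNIV. t (Some s) i j * cinner (k i) (pencil_op A s (k j)))"
  by (simp add: sum_UNIV_option[of "\<lambda>\<sigma>. t \<sigma> _ _ * atom_kernel A c k \<sigma> _ _"] sum.distrib)

lemma dual_positive_atom: "dual_positive A (atom_kernel A c k)"
  unfolding dual_positive_def coeff_positive_def sum_atom_kernel
  by (auto intro: complex_zero_le_add)

lemma coeff_positive_subset:
  fixes A :: "'g::finite \<Rightarrow> 'k::complex_hilbert_space bop"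
  assumes t: "coeff_positive A J t" and J: "finite J" "J' \<subseteq> J"
  shows "coeff_positive A J' t"
  unfolding coeff_positive_def
proof (intro conjI allI)
  fix c :: "_ \<Rightarrow> complex"
  define c' where "c' i = (if i \<in> J' then c i else 0)" for i
  have "(\<Sum>i\<in>J'. \<Sum>j\<in>J'. t None i j * (cnj (c i) * c j)) = (\<Sum>i\<in>J. \<Sum>j\<in>J. t None i j * (cnj (c' i) * c' j))"
  proof (rule sum.mono_neutral_cong_left)
    show "(\<Sum>j\<in>J'. t None i j * (cnj (c i) * c j)) = (\<Sum>j\<in>J. t None i j * (cnj (c' i) * c' j))" if "i \<in> J'" for i
      by (rule sum.mono_neutral_cong_left) (use J that in \<open>auto simp: c'_def\<close>)
  qed (use J in \<open>auto simp: c'_def\<close>)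
  then show "0 \<le> (\<Sum>i\<in>J'. \<Sum>j\<in>J'. t None i j * (cnj (c i) * c j))"
    using t by (simp add: coeff_positive_def)
next
  fix k :: "_ \<Rightarrow> 'k"
  define k' where "k' i = (if i \<in> J' then k i else 0)" for i
  have "(\<Sum>i\<in>J'. \<Sum>j\<in>J'. \<Sum>s\<in>UNIV. t (Some s) i j * cinner (k i) (pencil_op A s (k j)))
    = (\<Sum>i\<in>J. \<Sum>j\<in>J. \<Sum>s\<in>UNIV. t (Some s) i j * cinner (k' i) (pencil_op A s (k' j)))"
  proof (rule sum.mono_neutral_cong_left)
    show "(\<Sum>j\<in>J'. \<Sum>s\<in>UNIV. t (Some s) i j * cinner (k i) (pencil_op A s (k j)))
      = (\<Sum>j\<in>J. \<Sum>s\<in>UNIV. t (Some s) i j * cinner (k' i) (pencil_op A s (k' j)))" if "i \<in> J'" for i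
      by (rule sum.mono_neutral_cong_left) (use J that in \<open>auto simp: k'_def cinner.zero_right\<close>)
  qed (use J in \<open>auto simp: k'_def cinner.zero_left\<close>)
  then show "0 \<le> (\<Sum>i\<in>J'. \<Sum>j\<in>J'. \<Sum>s\<in>UNIV. t (Some s) i j * cinner (k i) (pencil_op A s (k j)))"
    using t by (simp add: coeff_positive_def)
qed

lemma dual_positive_restrict:
  fixes Z :: "'g::finite option option \<Rightarrow> 'i \<Rightarrow> 'i \<Rightarrow> complex"
  assumes Z: "dual_positive A Z"
  shows "dual_positive A (\<lambda>\<sigma> i j. if i \<in> S \<and> j \<in> S then Z \<sigma> i j else 0)"
  unfolding dual_positive_def
proof (intro allI impI)
  fix J :: "'i set" and t assume J: "finite J" and t: "coeff_positive A J t"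
  have "(\<Sum>i\<in>J. \<Sum>j\<in>J. \<Sum>\<sigma>\<in>UNIV. t \<sigma> i j * (if i \<in> S \<and> j \<in> S then Z \<sigma> i j else 0))
    = (\<Sum>i\<in>J\<inter>S. \<Sum>j\<in>J\<inter>S. \<Sum>\<sigma>\<in>UNIV. t \<sigma> i j * Z \<sigma> i j)"
  proof (rule sum.mono_neutral_cong_right)
    show "(\<Sum>j\<in>J. \<Sum>\<sigma>\<in>UNIV. t \<sigma> i j * (if i \<in> S \<and> j \<in> S then Z \<sigma> i j else 0))
      = (\<Sum>j\<in>J\<inter>S. \<Sum>\<sigma>\<in>UNIV. t \<sigma> i j * Z \<sigma> i j)" if "i \<in> J\<inter>S" for i
      by (rule sum.mono_neutral_cong_right) (use J that in auto)
  qed (use J in auto)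
  moreover have "coeff_positive A (J \<inter> S) t" using t J by (rule coeff_positive_subset) simp
  ultimately show "0 \<le> (\<Sum>i\<in>J. \<Sum>j\<in>J. \<Sum>\<sigma>\<in>UNIV. t \<sigma> i j * (if i \<in> S \<and> j \<in> S then Z \<sigma> i j else 0))"
    using dual_positiveD[OF Z] J by simp
qed

lemma sum_swap4:
  "(\<Sum>p\<in>P. \<Sum>q\<in>Q. \<Sum>i\<in>I. \<Sum>j\<in>J. f p q i j) = (\<Sum>i\<in>I. \<Sum>j\<in>J. \<Sum>p\<in>P. \<Sum>q\<in>Q. f p q i j)"
proof -
  have "(\<Sum>p\<in>P. \<Sum>q\<in>Q. \<Sum>i\<in>I. \<Sum>j\<in>J. f p q i j) = (\<Sum>p\<in>P. \<Sum>i\<in>I. \<Sum>q\<in>Q. \<Sum>j\<in>J. f p q i j)"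
    by (rule sum.cong[OF refl], rule sum.swap)
  also have "\<dots> = (\<Sum>i\<in>I. \<Sum>p\<in>P. \<Sum>q\<in>Q. \<Sum>j\<in>J. f p q i j)" by (rule sum.swap)
  also have "\<dots> = (\<Sum>i\<in>I. \<Sum>p\<in>P. \<Sum>j\<in>J. \<Sum>q\<in>Q. f p q i j)"
    by (rule sum.cong[OF refl], rule sum.cong[OF refl], rule sum.swap)
  also have "\<dots> = (\<Sum>i\<in>I. \<Sum>j\<in>J. \<Sum>p\<in>P. \<Sum>q\<in>Q. f p q i j)"
    by (rule sum.cong[OF refl], rule sum.swap)
  finally show ?thesis .
qed

lemma sum_swap3:
  "(\<Sum>p\<in>P. \<Sum>q\<in>Q. \<Sum>i\<in>I. f p q i) = (\<Sum>i\<in>I. \<Sum>p\<in>P. \<Sum>q\<in>Q. f p q i)"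
  using sum_swap4[of "\<lambda>p q i j. f p q i" "{()}" I Q P] by simp

lemma cinner_sum_sum:
  "cinner (\<Sum>p\<in>P. x p) (\<Sum>q\<in>Q. y q) = (\<Sum>p\<in>P. \<Sum>q\<in>Q. cinner (x p) (y q :: 'a::complex_hilbert_space))"
  by (subst cinner.sum_left) (simp only: cinner.sum_right)

text \<open>
  Congruence by the rectangular scalar matrix \<open>\<alpha>\<close>.
\<close>

lemma coeff_positive_compress:
  fixes A :: "'g::finite \<Rightarrow> 'k::complex_hilbert_space bop" and \<alpha> :: "'i \<Rightarrow> 'j \<Rightarrow> complex"
  assumes t: "coeff_positive A J t"
  shows "coeff_positive A J' (\<lambda>\<sigma> p q. \<Sum>i\<in>J. \<Sum>j\<in>J. cnj (\<alpha> i p) * \<alpha> j q * t \<sigma> i j)"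
  unfolding coeff_positive_def
proof (intro conjI allI)
  fix c :: "'j \<Rightarrow> complex"
  have "(\<Sum>p\<in>J'. \<Sum>q\<in>J'. (\<Sum>i\<in>J. \<Sum>j\<in>J. cnj (\<alpha> i p) * \<alpha> j q * t None i j) * (cnj (c p) * c q))
    = (\<Sum>p\<in>J'. \<Sum>q\<in>J'. \<Sum>i\<in>J. \<Sum>j\<in>J. t None i j * ((cnj (\<alpha> i p) * cnj (c p)) * (\<alpha> j q * c q)))"
    by (simp add: sum_distrib_right sum_distrib_left mult_ac)
  also have "\<dots> = (\<Sum>i\<in>J. \<Sum>j\<in>J. \<Sum>p\<in>J'. \<Sum>q\<in>J'. t None i j * ((cnj (\<alpha> i p) * cnj (c p)) * (\<alpha> j q * c q)))"
    by (rule sum_swap4)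
  also have "\<dots> = (\<Sum>i\<in>J. \<Sum>j\<in>J. t None i j * (cnj (\<Sum>p\<in>J'. \<alpha> i p * c p) * (\<Sum>q\<in>J'. \<alpha> j q * c q)))"
    unfolding cnj_sum complex_cnj_mult sum_product by (simp only: sum_distrib_left)
  finally show "0 \<le> (\<Sum>p\<in>J'. \<Sum>q\<in>J'. (\<Sum>i\<in>J. \<Sum>j\<in>J. cnj (\<alpha> i p) * \<alpha> j q * t None i j) * (cnj (c p) * c q))"
    using t[unfolded coeff_positive_def, THEN conjunct1, rule_format, of "\<lambda>i. \<Sum>p\<in>J'. \<alpha> i p * c p"]
    by (simp only:)
next
  fix k :: "'j \<Rightarrow> 'k"
  let ?B = "\<lambda>s. pencil_op A s"
  have "(\<Sum>p\<in>J'. \<Sum>q\<in>J'. \<Sum>s\<in>UNIV. (\<Sum>i\<in>J. \<Sum>j\<in>J. cnj (\<alpha> i p) * \<alpha> j q * t (Some s) i j) * cinner (k p) (?B s (k q)))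
    = (\<Sum>p\<in>J'. \<Sum>q\<in>J'. \<Sum>s\<in>UNIV. \<Sum>i\<in>J. \<Sum>j\<in>J. t (Some s) i j * cinner (\<alpha> i p *\<^sub>C k p) (?B s (\<alpha> j q *\<^sub>C k q)))"
    by (simp add: sum_distrib_right sum_distrib_left mult_ac apply_bop_scaleC cinner_scaleC_left cinner_scaleC_right)
  also have "\<dots> = (\<Sum>p\<in>J'. \<Sum>q\<in>J'. \<Sum>i\<in>J. \<Sum>j\<in>J. \<Sum>s\<in>UNIV. t (Some s) i j * cinner (\<alpha> i p *\<^sub>C k p) (?B s (\<alpha> j q *\<^sub>C k q)))"
    by (rule sum.cong[OF refl], rule sum.cong[OF refl], rule sum_swap3[symmetric])
  also have "\<dots> = (\<Sum>i\<in>J. \<Sum>j\<in>J. \<Sum>p\<in>J'. \<Sum>q\<in>J'. \<Sum>s\<in>UNIV. t (Some s) i j * cinner (\<alpha> i p *\<^sub>C k p) (?B s (\<alpha> j q *\<^sub>C k q)))"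
    by (rule sum_swap4)
  also have "\<dots> = (\<Sum>i\<in>J. \<Sum>j\<in>J. \<Sum>s\<in>UNIV. \<Sum>p\<in>J'. \<Sum>q\<in>J'. t (Some s) i j * cinner (\<alpha> i p *\<^sub>C k p) (?B s (\<alpha> j q *\<^sub>C k q)))"
  proof (intro sum.cong refl)
    fix i j
    show "(\<Sum>p\<in>J'. \<Sum>q\<in>J'. \<Sum>s\<in>UNIV. t (Some s) i j * cinner (\<alpha> i p *\<^sub>C k p) (?B s (\<alpha> j q *\<^sub>C k q)))
      = (\<Sum>s\<in>UNIV. \<Sum>p\<in>J'. \<Sum>q\<in>J'. t (Some s) i j * cinner (\<alpha> i p *\<^sub>C k p) (?B s (\<alpha> j q *\<^sub>C k q)))"
      by (rule sum_swap3)
  qed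
  also have "\<dots> = (\<Sum>i\<in>J. \<Sum>j\<in>J. \<Sum>s\<in>UNIV. t (Some s) i j * cinner (\<Sum>p\<in>J'. \<alpha> i p *\<^sub>C k p) (?B s (\<Sum>q\<in>J'. \<alpha> j q *\<^sub>C k q)))"
    by (simp only: apply_bop_sum cinner_sum_sum sum_distrib_left)
  finally show "0 \<le> (\<Sum>p\<in>J'. \<Sum>q\<in>J'. \<Sum>s\<in>UNIV. (\<Sum>i\<in>J. \<Sum>j\<in>J. cnj (\<alpha> i p) * \<alpha> j q * t (Some s) i j) * cinner (k p) (?B s (k q)))"
    using t by (simp add: coeff_positive_def)
qed

lemma pencil_coeff_self_adjoint:
  assumes "\<And>g. self_adjoint (A g)"
  shows "cinner x (pencil_op A s y) = cinner (pencil_op A s x) y"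
  using self_adjoint_cinner[OF assms] by (cases s) simp_all

lemma pencil_coeff_bound:
  fixes A :: "'g::finite \<Rightarrow> 'k::complex_hilbert_space bop"
  obtains C where "1 \<le> C" "\<And>s x. norm (pencil_op A s x) \<le> C * norm x"
proof -
  have "\<forall>s. \<exists>K>0. \<forall>x. norm (pencil_op A s x) \<le> K * norm x"
    by (metis apply_bop_bound)
  then obtain K where K: "\<And>s. K s > 0" "\<And>s x. norm (pencil_op A s x) \<le> K s * norm x"
    by metis
  have "norm (pencil_op A s x) \<le> max 1 (\<Sum>s\<in>UNIV. K s) * norm x" for s x
  proof -
    have "K s \<le> (\<Sum>s\<in>UNIV. K s)" using K(1) less_imp_le by (intro member_le_sum) auto
    then show ?thesis by (intro order_trans[OF K(2)] mult_right_mono) auto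
  qed
  then show ?thesis using that[of "max 1 (\<Sum>s\<in>UNIV. K s)"] by simp
qed

lemma psd_kernel_dual_None:
  fixes Z :: "'g::finite option option \<Rightarrow> 'i \<Rightarrow> 'i \<Rightarrow> complex" and A :: "'g \<Rightarrow> 'k::complex_hilbert_space bop"
  assumes Z: "dual_positive A Z" shows "psd_kernel (Z None)"
  unfolding psd_kernel_def
proof (intro allI impI)
  fix J :: "'i set" and c :: "'i \<Rightarrow> complex" assume J: "finite J"
  define t where "t \<sigma> i j = (if \<sigma> = None then cnj (c i) * c j else 0)" for \<sigma> :: "'g option option" and i j
  have "coeff_positive A J t"
    unfolding coeff_positive_def t_def
  proof (intro conjI allI)
    fix b
    have "(\<Sum>i\<in>J. \<Sum>j\<in>J. (if None = None then cnj (c i) * c j else 0) * (cnj (b i) * b j))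
      = cnj (\<Sum>i\<in>J. c i * b i) * (\<Sum>j\<in>J. c j * b j)"
      unfolding cnj_sum sum_product by (simp add: mult_ac)
    also have "\<dots> = complex_of_real ((cmod (\<Sum>i\<in>J. c i * b i))\<^sup>2)" by (simp only: complex_norm_square mult.commute)
    also have "0 \<le> \<dots>" by (simp add: zero_le_complex_iff)
    finally show "0 \<le> (\<Sum>i\<in>J. \<Sum>j\<in>J. (if (None::'g option option) = None then cnj (c i) * c j else 0) * (cnj (b i) * b j))"
      by simp
  qed simp
  from dual_positiveD[OF Z J this]
  show "0 \<le> (\<Sum>i\<in>J. \<Sum>j\<in>J. cnj (c i) * c j * Z None i j)"
    by (simp add: t_def sum_UNIV_option[of "\<lambda>\<sigma>. (if \<sigma> = None then _ else _) * Z \<sigma> _ _"])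
qed

text \<open>
  Pair with the rank-one multiples of \<open>C + \<delta> B\<close>, which is a positive operator for each coefficient \<open>B\<close> of
  the pencil.
\<close>

lemma psd_kernel_dual_Some:
  fixes Z :: "'g::finite option option \<Rightarrow> 'i \<Rightarrow> 'i \<Rightarrow> complex" and A :: "'g \<Rightarrow> 'k::complex_hilbert_space bop"
  assumes Z: "dual_positive A Z" and sa: "\<And>g. self_adjoint (A g)"
    and C: "\<And>s x. norm (pencil_op A s x) \<le> C * norm x"
    and \<delta>: "\<bar>\<delta>\<bar> \<le> 1"
  shows "psd_kernel (\<lambda>i j. complex_of_real C * Z (Some None) i j + complex_of_real \<delta> * Z (Some s) i j)"
  unfolding psd_kernel_def
proof (intro allI impI)
  fix J :: "'i set" and c :: "'i \<Rightarrow> complex" assume J: "finite J"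
  define f where "f \<sigma> = complex_of_real (if \<sigma> = Some None then C else 0) + complex_of_real (if \<sigma> = Some s then \<delta> else 0)"
    for \<sigma> :: "'g option option"
  define t where "t \<sigma> i j = cnj (c i) * c j * f \<sigma>" for \<sigma> :: "'g option option" and i j
  have f_sum: "(\<Sum>s'\<in>UNIV. f (Some s') * g s') = complex_of_real C * g None + complex_of_real \<delta> * g s" for g :: "'g option \<Rightarrow> complex"
    by (simp add: f_def distrib_right sum.distrib if_distrib[where f = "\<lambda>x. complex_of_real x * _"] cong: if_cong)
  have "coeff_positive A J t"
    unfolding coeff_positive_def
  proof (intro conjI allI)
    fix k :: "'i \<Rightarrow> 'k"
    let ?B = "\<lambda>s. pencil_op A s"
    define \<kappa> where "\<kappa> = (\<Sum>i\<in>J. c i *\<^sub>C k i)"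
    have "(\<Sum>i\<in>J. \<Sum>j\<in>J. \<Sum>s\<in>UNIV. t (Some s) i j * cinner (k i) (?B s (k j)))
      = (\<Sum>i\<in>J. \<Sum>j\<in>J. \<Sum>s\<in>UNIV. f (Some s) * cinner (c i *\<^sub>C k i) (?B s (c j *\<^sub>C k j)))"
      by (simp add: t_def apply_bop_scaleC cinner_scaleC_left cinner_scaleC_right mult_ac)
    also have "\<dots> = (\<Sum>s\<in>UNIV. \<Sum>i\<in>J. \<Sum>j\<in>J. f (Some s) * cinner (c i *\<^sub>C k i) (?B s (c j *\<^sub>C k j)))"
      by (rule sum_swap3)
    also have "\<dots> = (\<Sum>s\<in>UNIV. f (Some s) * cinner \<kappa> (?B s \<kappa>))"
      by (simp only: \<kappa>_def apply_bop_sum cinner_sum_sum sum_distrib_left)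
    also have "\<dots> = complex_of_real C * cinner \<kappa> (?B None \<kappa>) + complex_of_real \<delta> * cinner \<kappa> (?B s \<kappa>)"
      by (rule f_sum)
    also have "\<dots> = complex_of_real (C * (norm \<kappa>)\<^sup>2 + \<delta> * Re (cinner \<kappa> (?B s \<kappa>)))"
    proof -
      have "cinner \<kappa> (?B s \<kappa>) = cnj (cinner \<kappa> (?B s \<kappa>))"
        using pencil_coeff_self_adjoint[of A \<kappa> s \<kappa>, OF sa] cinner_commute[of \<kappa> "?B s \<kappa>"] by simp
      then have "cinner \<kappa> (?B s \<kappa>) = complex_of_real (Re (cinner \<kappa> (?B s \<kappa>)))" by (simp add: complex_eq_iff)
      then show ?thesis by (simp add: cinner_self)
    qed
    finally have e: "(\<Sum>i\<in>J. \<Sum>j\<in>J. \<Sum>s\<in>UNIV. t (Some s) i j * cinner (k i) (?B s (k j)))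
      = complex_of_real (C * (norm \<kappa>)\<^sup>2 + \<delta> * Re (cinner \<kappa> (?B s \<kappa>)))" .
    have "\<bar>\<delta> * Re (cinner \<kappa> (?B s \<kappa>))\<bar> \<le> 1 * cmod (cinner \<kappa> (?B s \<kappa>))"
      unfolding abs_mult by (intro mult_mono \<delta> abs_Re_le_cmod) auto
    also have "\<dots> \<le> norm \<kappa> * norm (?B s \<kappa>)" using cinner_Cauchy_Schwarz by simp
    also have "\<dots> \<le> norm \<kappa> * (C * norm \<kappa>)" by (intro mult_left_mono C) simp
    finally have "0 \<le> C * (norm \<kappa>)\<^sup>2 + \<delta> * Re (cinner \<kappa> (?B s \<kappa>))" by (simp add: power2_eq_square mult_ac)
    then show "0 \<le> (\<Sum>i\<in>J. \<Sum>j\<in>J. \<Sum>s\<in>UNIV. t (Some s) i j * cinner (k i) (?B s (k j)))"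
      unfolding e by (simp add: zero_le_complex_iff)
  qed (simp add: t_def f_def)
  from dual_positiveD[OF Z J this]
  have "0 \<le> (\<Sum>i\<in>J. \<Sum>j\<in>J. \<Sum>\<sigma>\<in>UNIV. t \<sigma> i j * Z \<sigma> i j)" .
  also have "(\<Sum>i\<in>J. \<Sum>j\<in>J. \<Sum>\<sigma>\<in>UNIV. t \<sigma> i j * Z \<sigma> i j)
    = (\<Sum>i\<in>J. \<Sum>j\<in>J. cnj (c i) * c j * (\<Sum>s\<in>UNIV. f (Some s) * Z (Some s) i j))"
    by (rule sum.cong[OF refl], rule sum.cong[OF refl], subst sum_UNIV_option)
      (simp add: t_def sum_distrib_left mult.assoc f_def[of None])
  finally show "0 \<le> (\<Sum>i\<in>J. \<Sum>j\<in>J. cnj (c i) * c j * (complex_of_real C * Z (Some None) i j + complex_of_real \<delta> * Z (Some s) i j))"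
    by (simp only: f_sum)
qed

lemma psd_kernel_dual_unit:
  fixes Z :: "'g::finite option option \<Rightarrow> 'i \<Rightarrow> 'i \<Rightarrow> complex" and A :: "'g \<Rightarrow> 'k::complex_hilbert_space bop"
  assumes Z: "dual_positive A Z" and sa: "\<And>g. self_adjoint (A g)"
  shows "psd_kernel (Z (Some None))"
  unfolding psd_kernel_def
proof (intro allI impI)
  fix J :: "'i set" and c :: "'i \<Rightarrow> complex" assume J: "finite J"
  obtain C where C: "1 \<le> C" "\<And>s x. norm (pencil_op A s x) \<le> C * norm x"
    by (rule pencil_coeff_bound[of A]) (rule that; assumption)
  have "0 \<le> complex_of_real (1 / C) * (\<Sum>i\<in>J. \<Sum>j\<in>J. cnj (c i) * c j * (complex_of_real C * Z (Some None) i j + complex_of_real 0 * Z (Some None) i j))"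
    by (rule complex_zero_le_scale[OF _ psd_kernelD[OF psd_kernel_dual_Some[OF Z sa C(2), of 0 None] J]]) (use C(1) in auto)
  also have "\<dots> = (\<Sum>i\<in>J. \<Sum>j\<in>J. cnj (c i) * c j * Z (Some None) i j)"
    unfolding sum_distrib_left by (intro sum.cong refl) (use C(1) in simp)
  finally show "0 \<le> (\<Sum>i\<in>J. \<Sum>j\<in>J. cnj (c i) * c j * Z (Some None) i j)" .
qed

lemma psd_kernel_entry_bound:
  assumes "psd_kernel K" shows "cmod (K i j) \<le> Re (K i i) + Re (K j j)"
proof (cases "i = j \<or> K i j = 0")
  case True
  have "0 \<le> Re (K i i)" "0 \<le> Re (K j j)" "Im (K i i) = 0"
    using psd_kernel_diag[OF assms, of i] psd_kernel_diag[OF assms, of j] by (auto simp: zero_le_complex_iff)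
  then show ?thesis using True by (auto simp: cmod_eq_Re)
next
  case False
  define b where "b = - cnj (K i j) / cmod (K i j)"
  have n: "cmod (K i j) \<noteq> 0" using False by simp
  have b1: "cnj b * b = 1"
    using n complex_norm_square[of "K i j"] by (simp add: b_def field_simps power2_eq_square)
  have b2: "b * K i j = - cmod (K i j)"
    using n complex_norm_square[of "K i j"] by (simp add: b_def field_simps power2_eq_square)
  have "cnj b * K j i = cnj (b * K i j)" using psd_kernel_hermitian[OF assms, of j i] by simp
  then have b3: "cnj b * K j i = - cmod (K i j)" by (simp only: b2) simp
  have "0 \<le> Re (K i i + b * K i j + cnj b * K j i + cnj b * b * K j j)"
    using psd_kernel_pair[OF assms, of i j b] False by (simp add: zero_le_complex_iff)
  then show ?thesis unfolding b1 b2 b3 using norm_ge_zero[of "K i j"] by (simp del: norm_ge_zero)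
qed

text \<open>
  The linear components of the Gram data are dominated by the constant one, so the diagonal
  entries of the two unit components control all others.
\<close>

lemma dual_positive_entry:
  fixes A :: "'g::finite \<Rightarrow> 'k::complex_hilbert_space bop"
  assumes Z: "dual_positive A Z" and sa: "\<And>g. self_adjoint (A g)"
    and C: "\<And>s x. norm (pencil_op A s x) \<le> C * norm x" and C1: "1 \<le> C"
  shows "cmod (Z \<sigma> i j) \<le> C * (Re (Z None i i) + Re (Z (Some None) i i) + Re (Z None j j) + Re (Z (Some None) j j))"
    and "Z \<sigma> j i = cnj (Z \<sigma> i j)"
    and "0 \<le> Re (Z None i i)" and "0 \<le> Re (Z (Some None) i i)"
proof -
  have p0: "psd_kernel (Z None)" by (rule psd_kernel_dual_None[OF Z])
  note p = psd_kernel_dual_Some[OF Z sa C]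
  have pos: "0 \<le> Re (Z None i i)" "0 \<le> Re (Z (Some None) i i)" for i
  proof -
    show "0 \<le> Re (Z None i i)" using psd_kernel_diag[OF p0, of i] by (simp add: zero_le_complex_iff)
    have "0 \<le> C * Re (Z (Some None) i i)" using psd_kernel_diag[OF p[of 0 None], of i] by (simp add: zero_le_complex_iff)
    then show "0 \<le> Re (Z (Some None) i i)" using C1 by (simp add: zero_le_mult_iff)
  qed
  then show "0 \<le> Re (Z None i i)" "0 \<le> Re (Z (Some None) i i)" by blast+
  show "Z \<sigma> j i = cnj (Z \<sigma> i j)"
  proof (cases \<sigma>)
    case (Some s)
    have "(complex_of_real C * Z (Some None) j i + complex_of_real 1 * Z (Some s) j i) - (complex_of_real C * Z (Some None) j i + complex_of_real (- 1) * Z (Some s) j i)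
      = cnj ((complex_of_real C * Z (Some None) i j + complex_of_real 1 * Z (Some s) i j) - (complex_of_real C * Z (Some None) i j + complex_of_real (- 1) * Z (Some s) i j))"
      using psd_kernel_hermitian[OF p[of 1 s], of j i] psd_kernel_hermitian[OF p[of "-1" s], of j i]
      by (simp only: complex_cnj_diff abs_one abs_minus_cancel order_refl)
    then show ?thesis using Some by (simp add: complex_eq_iff)
  qed (use psd_kernel_hermitian[OF p0] in blast)
  show "cmod (Z \<sigma> i j) \<le> C * (Re (Z None i i) + Re (Z (Some None) i i) + Re (Z None j j) + Re (Z (Some None) j j))"
  proof (cases \<sigma>)
    case None
    have "cmod (Z None i j) \<le> 1 * (Re (Z None i i) + Re (Z None j j))"
      using psd_kernel_entry_bound[OF p0] by simp
    also have "\<dots> \<le> C * (Re (Z None i i) + Re (Z (Some None) i i) + Re (Z None j j) + Re (Z (Some None) j j))"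
      using pos C1 by (intro mult_mono) (auto intro!: add_nonneg_nonneg)
    finally show ?thesis using None by simp
  next
    case (Some s)
    let ?P = "\<lambda>\<delta> i j. complex_of_real C * Z (Some None) i j + complex_of_real \<delta> * Z (Some s) i j"
    have "2 * cmod (Z (Some s) i j) = cmod (?P 1 i j - ?P (-1) i j)" by (simp flip: norm_mult add: norm_mult)
    also have "\<dots> \<le> cmod (?P 1 i j) + cmod (?P (-1) i j)" by (rule norm_triangle_ineq4)
    also have "\<dots> \<le> (Re (?P 1 i i) + Re (?P 1 j j)) + (Re (?P (-1) i i) + Re (?P (-1) j j))"
      by (intro add_mono psd_kernel_entry_bound[of "?P 1"] psd_kernel_entry_bound[of "?P (-1)"] p) auto
    also have "\<dots> = 2 * (C * (Re (Z (Some None) i i) + Re (Z (Some None) j j)))" by (simp add: algebra_simps)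
    finally have "cmod (Z (Some s) i j) \<le> C * (Re (Z (Some None) i i) + Re (Z (Some None) j j))" by simp
    also have "\<dots> \<le> C * (Re (Z None i i) + Re (Z (Some None) i i) + Re (Z None j j) + Re (Z (Some None) j j))"
      using pos C1 by (intro mult_left_mono) (auto intro!: add_nonneg_nonneg)
    finally show ?thesis using Some by simp
  qed
qed

definition words_upto :: "nat \<Rightarrow> 'g list set" where
  "words_upto d = {w. length w \<le> d}"

lemma finite_words_upto [simp]: "finite (words_upto d :: 'g::finite list set)"
  using finite_lists_length_le[of "UNIV :: 'g set" d] by (simp add: words_upto_def)

text \<open>
  The matrix entry \<open>(a, b)\<close> of the coefficient at \<open>u\<close> of the polynomial with Gram data \<open>Z\<close>: an index
  \<open>(w, b)\<close> stands for the word \<open>w\<close> of the column \<open>V\<close> and the basis vector with number \<open>b\<close>.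
\<close>

definition gram_coeff ::
    "nat \<Rightarrow> ('g::finite option option \<Rightarrow> 'g list \<times> nat \<Rightarrow> 'g list \<times> nat \<Rightarrow> complex) \<Rightarrow> 'g list \<Rightarrow> nat \<Rightarrow> nat \<Rightarrow> complex" where
  "gram_coeff d Z u a b = (\<Sum>v\<in>words_upto d. \<Sum>w\<in>words_upto d. \<Sum>\<sigma>\<in>UNIV.
     if rev v @ symbol_word \<sigma> @ w = u then Z \<sigma> (v, a) (w, b) else 0)"

lemma word_split_in_words_upto:
  "v \<in> words_upto d \<Longrightarrow> w \<in> words_upto d \<Longrightarrow> rev v @ symbol_word \<sigma> @ w \<in> words_upto (2 * d + 1)"
  using length_symbol_word[of \<sigma>] by (simp add: words_upto_def)

text \<open>
  A functional \<open>y\<close> on polynomials, pulled back to Gram data, is a Hankel matrix: its entries depend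
  only on the product of the words.
\<close>

lemma gram_coeff_pairing:
  fixes Z :: "'g::finite option option \<Rightarrow> 'g list \<times> nat \<Rightarrow> 'g list \<times> nat \<Rightarrow> complex"
  shows "(\<Sum>u\<in>words_upto (2 * d + 1). \<Sum>a<m. \<Sum>b<m. y u a b * gram_coeff d Z u a b)
    = (\<Sum>i\<in>words_upto d \<times> {..<m}. \<Sum>j\<in>words_upto d \<times> {..<m}. \<Sum>\<sigma>\<in>UNIV.
        y (rev (fst i) @ symbol_word \<sigma> @ fst j) (snd i) (snd j) * Z \<sigma> i j)"
proof -
  let ?W = "words_upto d :: 'g list set" and ?U = "words_upto (2 * d + 1) :: 'g list set"
  let ?f = "\<lambda>a b v w. \<Sum>\<sigma>\<in>UNIV. y (rev v @ symbol_word \<sigma> @ w) a b * Z \<sigma> (v, a) (w, b)"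
  have one: "(\<Sum>u\<in>?U. y u a b * gram_coeff d Z u a b) = (\<Sum>v\<in>?W. \<Sum>w\<in>?W. ?f a b v w)" for a b
  proof -
    have "(\<Sum>u\<in>?U. y u a b * gram_coeff d Z u a b)
      = (\<Sum>u\<in>?U. \<Sum>v\<in>?W. \<Sum>w\<in>?W. \<Sum>\<sigma>\<in>UNIV. if rev v @ symbol_word \<sigma> @ w = u then y u a b * Z \<sigma> (v, a) (w, b) else 0)"
      unfolding gram_coeff_def sum_distrib_left
      by (intro sum.cong refl) simp
    also have "\<dots> = (\<Sum>v\<in>?W. \<Sum>w\<in>?W. \<Sum>u\<in>?U. \<Sum>\<sigma>\<in>UNIV. if rev v @ symbol_word \<sigma> @ w = u then y u a b * Z \<sigma> (v, a) (w, b) else 0)"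
      by (rule sum_swap3[symmetric])
    also have "\<dots> = (\<Sum>v\<in>?W. \<Sum>w\<in>?W. \<Sum>\<sigma>\<in>UNIV. \<Sum>u\<in>?U. if rev v @ symbol_word \<sigma> @ w = u then y u a b * Z \<sigma> (v, a) (w, b) else 0)"
      by (rule sum.cong[OF refl], rule sum.cong[OF refl], rule sum.swap)
    also have "\<dots> = (\<Sum>v\<in>?W. \<Sum>w\<in>?W. ?f a b v w)"
      by (intro sum.cong refl) (use word_split_in_words_upto in \<open>auto simp: sum.delta\<close>)
    finally show ?thesis .
  qed
  have "(\<Sum>u\<in>?U. \<Sum>a<m. \<Sum>b<m. y u a b * gram_coeff d Z u a b) = (\<Sum>a<m. \<Sum>b<m. \<Sum>u\<in>?U. y u a b * gram_coeff d Z u a b)"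
    by (rule sum_swap3[symmetric])
  also have "\<dots> = (\<Sum>a<m. \<Sum>b<m. \<Sum>v\<in>?W. \<Sum>w\<in>?W. ?f a b v w)" by (simp only: one)
  also have "\<dots> = (\<Sum>v\<in>?W. \<Sum>w\<in>?W. \<Sum>a<m. \<Sum>b<m. ?f a b v w)" by (rule sum_swap4)
  also have "\<dots> = (\<Sum>v\<in>?W. \<Sum>a<m. \<Sum>w\<in>?W. \<Sum>b<m. ?f a b v w)" by (rule sum.cong[OF refl], rule sum.swap)
  also have "\<dots> = (\<Sum>i\<in>?W \<times> {..<m}. \<Sum>j\<in>?W \<times> {..<m}. ?f (snd i) (snd j) (fst i) (fst j))"
    by (simp add: sum.cartesian_product')
  finally show ?thesis by simp
qed

section \<open>A faithful point and its moments\<close>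

lemma word_entry_split:
  assumes X: "hermitian_tuple n X" and ab: "a < n" "b < n"
  shows "word_entry n X (rev v @ symbol_word \<sigma> @ w) a b
    = (\<Sum>i<n. \<Sum>l<n. cnj (word_entry n X v i a) * word_entry n X (symbol_word \<sigma>) i l * word_entry n X w l b)"
proof -
  have "word_entry n X (rev v @ symbol_word \<sigma> @ w) a b
    = (\<Sum>i<n. word_entry n X (rev v) a i * word_entry n X (symbol_word \<sigma> @ w) i b)"
    by (rule word_entry_append[OF X ab])
  also have "\<dots> = (\<Sum>i<n. cnj (word_entry n X v i a) * (\<Sum>l<n. word_entry n X (symbol_word \<sigma>) i l * word_entry n X w l b))"
    by (intro sum.cong refl) (simp add: word_entry_rev[OF X] word_entry_append[OF X] ab)
  finally show ?thesis by (simp add: sum_distrib_left mult.assoc)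
qed

lemma psd_pencil_iff:
  fixes A :: "'g::finite \<Rightarrow> 'k::complex_hilbert_space bop"
  assumes X: "hermitian_tuple n X"
  shows "psd (opoly_eval n X (pencil 1 A)) \<longleftrightarrow>
    (\<forall>k. 0 \<le> (\<Sum>i<n. \<Sum>j<n. \<Sum>s\<in>UNIV. word_entry n X (symbol_word (Some s)) i j * cinner (k i) (pencil_op A s (k j))))"
proof -
  have "cinner x (apply_bop (eval_entry n X (pencil 1 A) i j) y)
    = (\<Sum>s\<in>UNIV. word_entry n X (symbol_word (Some s)) i j * cinner x (pencil_op A s y))"
    if "i < n" "j < n" for i j x y
    unfolding eval_entry_pencil[OF X that]
    by (simp add: sum_UNIV_option word_entry_Nil word_entry_singleton[OF X] that apply_plus_bop apply_sum_bop
        apply_scaleC_bop cinner_add_right cinner.sum_right cinner_scaleC_right)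
  then show ?thesis by (simp add: psd_eval_iff)
qed

lemma hermitian_form_real:
  fixes A :: "'g::finite \<Rightarrow> 'k::complex_hilbert_space bop"
  assumes sa: "\<And>g. self_adjoint (A g)" and M: "\<And>s i j. i \<in> J \<Longrightarrow> j \<in> J \<Longrightarrow> M s j i = cnj (M s i j)"
  shows "Im (\<Sum>i\<in>J. \<Sum>j\<in>J. \<Sum>s\<in>UNIV. M s i j * cinner (k i) (pencil_op A s (k j))) = 0"
proof -
  let ?F = "\<Sum>i\<in>J. \<Sum>j\<in>J. \<Sum>s\<in>UNIV. M s i j * cinner (k i) (pencil_op A s (k j))"
  have "cnj ?F = (\<Sum>i\<in>J. \<Sum>j\<in>J. \<Sum>s\<in>UNIV. M s j i * cinner (k j) (pencil_op A s (k i)))"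
    unfolding cnj_sum
  proof (intro sum.cong refl)
    fix i j s assume ij: "i \<in> J" "j \<in> J"
    have "cnj (cinner (k i) (pencil_op A s (k j))) = cinner (k j) (pencil_op A s (k i))"
      using pencil_coeff_self_adjoint[of A "k i" s "k j", OF sa] cinner_commute by metis
    then show "cnj (M s i j * cinner (k i) (pencil_op A s (k j))) = M s j i * cinner (k j) (pencil_op A s (k i))"
      by (simp add: M[OF ij])
  qed
  also have "\<dots> = ?F" by (rule sum.swap)
  finally have "cnj ?F = ?F" .
  moreover have "Im z = 0" if "cnj z = z" for z using that by (simp add: complex_eq_iff)
  ultimately show ?thesis by blast
qed

text \<open>
  The truncated Fock space: the words of length at most \<open>D\<close> are an orthonormal basis, and \<open>X\<^sub>g\<close> is
  \<open>\<epsilon>\<close> times creation plus annihilation of the first letter. Applied to the empty word,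
  the operator of \<open>u\<close> yields \<open>\<epsilon>\<^bsup>|u|\<^esup> u\<close> plus shorter words. So the matrix of these vectors is
  triangular with respect to the length, and its left inverse is found from long words to
  short ones.
\<close>

lemma fock_left_inverse:
  fixes X :: "'g::finite \<Rightarrow> complex mat" and h :: "nat \<Rightarrow> 'g list"
  assumes h: "bij_betw h {..<n} (words_upto D)" and i0: "i0 < n" "h i0 = []"
    and X: "\<And>g. X g = mat n n (\<lambda>(i, j). if h i = g # h j \<or> h j = g # h i then complex_of_real \<epsilon> else 0)"
    and herm: "hermitian_tuple n X" and \<epsilon>: "\<epsilon> > 0"
  shows "\<exists>\<theta>. \<forall>u\<in>words_upto D. \<forall>w\<in>words_upto D. (\<Sum>i<n. \<theta> u i * word_entry n X w i i0) = (if u = w then 1 else 0)"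
proof -
  have inj: "i = j" if "i < n" "j < n" "h i = h j" for i j
    using h that by (auto simp: bij_betw_def inj_on_def)
  have hW: "h i \<in> words_upto D" if "i < n" for i using h that by (auto simp: bij_betw_def)
  have surj: "\<exists>i<n. h i = w" if "w \<in> words_upto D" for w
    using h that unfolding bij_betw_def by (metis imageE lessThan_iff)
  have X_entry: "X g $$ (i, k) = (if h i = g # h k \<or> h k = g # h i then complex_of_real \<epsilon> else 0)"
    if "i < n" "k < n" for g i k
    using that by (simp add: X)
  have tri: "word_entry n X u i i0 = (if h i = u then complex_of_real \<epsilon> ^ length u else 0)"
    if "length u \<le> length (h i)" "i < n" for u i
    using that
  proof (induction u arbitrary: i)
    case Nil
    have "h i = [] \<longleftrightarrow> i = i0" using inj[OF Nil.prems(2) i0(1)] i0(2) by auto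
    then show ?case using Nil.prems(2) i0(1) by (simp add: word_entry_Nil)
  next
    case (Cons g u)
    have "word_entry n X (g # u) i i0 = (\<Sum>k<n. X g $$ (i, k) * word_entry n X u k i0)"
      using word_entry_Cons[OF herm] Cons.prems i0 by simp
    also have "\<dots> = (\<Sum>k<n. if h i = g # h k \<and> h k = u then complex_of_real \<epsilon> ^ length (g # u) else 0)"
    proof (intro sum.cong refl)
      fix k assume "k \<in> {..<n}"
      then have k: "k < n" by simp
      show "X g $$ (i, k) * word_entry n X u k i0 = (if h i = g # h k \<and> h k = u then complex_of_real \<epsilon> ^ length (g # u) else 0)"
      proof (cases "h i = g # h k")
        case True
        then show ?thesis using Cons.IH[of k] Cons.prems k by (simp add: X_entry)
      next
        case False
        show ?thesis
        proof (cases "h k = g # h i")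
          case True
          then have "length u < length (h k)" using Cons.prems by simp
          then have "word_entry n X u k i0 = 0" using Cons.IH[of k] k by auto
          then show ?thesis using False by simp
        qed (use False Cons.prems k in \<open>simp add: X_entry\<close>)
      qed
    qed
    also have "\<dots> = (if h i = g # u then complex_of_real \<epsilon> ^ length (g # u) else 0)"
    proof (cases "h i = g # u")
      case True
      then have "u \<in> words_upto D" using hW[OF Cons.prems(2)] by (simp add: words_upto_def)
      then obtain k where k: "k < n" "h k = u" using surj by blast
      have "(\<Sum>k<n. if h i = g # h k \<and> h k = u then complex_of_real \<epsilon> ^ length (g # u) else 0)
        = (\<Sum>k'<n. if k' = k then complex_of_real \<epsilon> ^ length (g # u) else 0)"
      proof (intro sum.cong refl)
        fix k' assume "k' \<in> {..<n}"
        then have "h k' = u \<longleftrightarrow> k' = k" using inj[of k' k] k by auto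
        then show "(if h i = g # h k' \<and> h k' = u then complex_of_real \<epsilon> ^ length (g # u) else 0)
          = (if k' = k then complex_of_real \<epsilon> ^ length (g # u) else 0)"
          by (simp add: True k(2))
      qed
      also have "\<dots> = complex_of_real \<epsilon> ^ length (g # u)" using k(1) by simp
      finally show ?thesis by (simp only: True refl if_True)
    next
      case False
      have "(if h i = g # h k \<and> h k = u then complex_of_real \<epsilon> ^ length (g # u) else 0) = 0" for k
        using False by auto
      then show ?thesis by (simp only: False if_False sum.neutral_const)
    qed
    finally show ?case .
  qed
  have "u \<in> words_upto D \<Longrightarrow> \<exists>\<theta>. \<forall>w\<in>words_upto D. (\<Sum>i<n. \<theta> i * word_entry n X w i i0) = (if u = w then 1 else 0)" for u :: "'g list"
  proof (induction "D - length u" arbitrary: u rule: less_induct)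
    case less
    define L :: "'g list set" where "L = {w \<in> words_upto D. length u < length w}"
    have "\<exists>\<theta>. \<forall>w'\<in>words_upto D. (\<Sum>i<n. \<theta> i * word_entry n X w' i i0) = (if w = w' then 1 else 0)" if "w \<in> L" for w
      by (rule less.hyps) (use that in \<open>auto simp: L_def words_upto_def\<close>)
    then obtain T where T: "\<And>w w'. w \<in> L \<Longrightarrow> w' \<in> words_upto D \<Longrightarrow> (\<Sum>i<n. T w i * word_entry n X w' i i0) = (if w = w' then 1 else 0)"
      by metis
    obtain k where k: "k < n" "h k = u" using surj less.prems by blast
    define e where "e = complex_of_real \<epsilon> ^ length u"
    have e: "e \<noteq> 0" using \<epsilon> by (simp add: e_def)
    define \<theta> where "\<theta> i = ((if i = k then 1 else 0) - (\<Sum>w\<in>L. word_entry n X w k i0 * T w i)) / e" for i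
    have finL: "finite L" by (simp add: L_def)
    have "(\<Sum>i<n. \<theta> i * word_entry n X w' i i0) = (if u = w' then 1 else 0)" if w': "w' \<in> words_upto D" for w'
    proof -
      have "(\<Sum>i<n. \<theta> i * word_entry n X w' i i0)
        = ((\<Sum>i<n. (if i = k then 1 else 0) * word_entry n X w' i i0)
          - (\<Sum>i<n. (\<Sum>w\<in>L. word_entry n X w k i0 * T w i) * word_entry n X w' i i0)) / e"
        by (simp only: \<theta>_def times_divide_eq_left left_diff_distrib sum_subtractf sum_divide_distrib[symmetric])
      also have "(\<Sum>i<n. (if i = k then 1 else 0) * word_entry n X w' i i0) = word_entry n X w' k i0"
        using k(1) by (simp add: if_distrib[where f = "\<lambda>x. x * _"] cong: if_cong)
      also have "(\<Sum>i<n. (\<Sum>w\<in>L. word_entry n X w k i0 * T w i) * word_entry n X w' i i0)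
        = (\<Sum>w\<in>L. word_entry n X w k i0 * (\<Sum>i<n. T w i * word_entry n X w' i i0))"
        by (subst sum_distrib_right, subst sum.swap) (simp add: sum_distrib_left mult.assoc)
      also have "\<dots> = (\<Sum>w\<in>L. word_entry n X w k i0 * (if w = w' then 1 else 0))"
        by (intro sum.cong refl) (simp add: T w')
      also have "\<dots> = (if w' \<in> L then word_entry n X w' k i0 else 0)"
        using finL by (simp add: if_distrib cong: if_cong)
      also have "(word_entry n X w' k i0 - (if w' \<in> L then word_entry n X w' k i0 else 0)) / e = (if u = w' then 1 else 0)"
        using tri[of w' k] k e w' by (auto simp: L_def e_def)
      finally show ?thesis .
    qed
    then show ?case by blast
  qed
  then show ?thesis by metis
qed

text \<open>
  The linear part of \<open>L(X)\<close> is of order \<open>\<epsilon>\<close>, while the dimension of the truncated Fock space depends on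
  \<open>D\<close> only.
\<close>

lemma ex_faithful_point:
  fixes A :: "'g::finite \<Rightarrow> 'k::complex_hilbert_space bop"
  assumes sa: "\<And>g. self_adjoint (A g)"
  obtains n i0 and X :: "'g \<Rightarrow> complex mat" and \<theta> where
    "i0 < n" "hermitian_tuple n X"
    "\<forall>u\<in>words_upto D. \<forall>w\<in>words_upto D. (\<Sum>i<n. \<theta> u i * word_entry n X w i i0) = (if u = w then 1 else 0)"
    "\<forall>k::nat \<Rightarrow> 'k. (\<Sum>i<n. (norm (k i))\<^sup>2) / 2 \<le> Re (\<Sum>i<n. \<Sum>j<n. \<Sum>s\<in>UNIV.
        word_entry n X (symbol_word (Some s)) i j * cinner (k i) (pencil_op A s (k j)))"
    "psd (opoly_eval n X (pencil 1 A))"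
proof -
  define n where "n = card (words_upto D :: 'g list set)"
  obtain h :: "nat \<Rightarrow> 'g list" where h: "bij_betw h {..<n} (words_upto D)"
    using ex_bij_betw_nat_finite[OF finite_words_upto, of D] by (auto simp: n_def atLeast0LessThan)
  have "[] \<in> (words_upto D :: 'g list set)" by (simp add: words_upto_def)
  then obtain i0 where i0: "i0 < n" "h i0 = []"
    using h unfolding bij_betw_def by (metis imageE lessThan_iff)
  obtain C where C: "1 \<le> C" "\<And>s x. norm (pencil_op A s x) \<le> C * norm x"
    by (rule pencil_coeff_bound[of A]) (rule that; assumption)
  have C0: "C > 0" using C(1) by simp
  define N where "N = real CARD('g)"
  have N: "N > 0" by (simp add: N_def)
  define \<epsilon> where "\<epsilon> = 1 / (2 * N * C * real n)"
  have n0: "n > 0" using i0 by simp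
  have \<epsilon>: "\<epsilon> > 0" using C0 N n0 by (simp add: \<epsilon>_def)
  define X where "X g = mat n n (\<lambda>(i, j). if h i = g # h j \<or> h j = g # h i then complex_of_real \<epsilon> else 0)" for g
  have herm: "hermitian_tuple n X"
    unfolding hermitian_tuple_def by (intro allI conjI mat_adjointI[of _ n]) (auto simp: X_def)
  obtain \<theta> where \<theta>: "\<forall>u\<in>words_upto D. \<forall>w\<in>words_upto D. (\<Sum>i<n. \<theta> u i * word_entry n X w i i0) = (if u = w then 1 else 0)"
    using fock_left_inverse[OF h i0 X_def herm \<epsilon>] by metis
  let ?F = "\<lambda>k. \<Sum>i<n. \<Sum>j<n. \<Sum>s\<in>UNIV.
        word_entry n X (symbol_word (Some s)) i j * cinner (k i) (pencil_op A s (k j))"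
  have low: "(\<Sum>i<n. (norm (k i))\<^sup>2) / 2 \<le> Re (?F k)" for k :: "nat \<Rightarrow> 'k"
  proof -
    let ?S = "\<Sum>i<n. (norm (k i))\<^sup>2"
    let ?E = "\<Sum>i<n. \<Sum>j<n. \<Sum>g\<in>UNIV. X g $$ (i, j) * cinner (k i) (apply_bop (A g) (k j))"
    have "?F k = (\<Sum>i<n. \<Sum>j<n. (if i = j then 1 else 0) * cinner (k i) (k j)) + ?E"
      unfolding sum.distrib[symmetric]
      by (intro sum.cong refl, subst sum_UNIV_option)
        (simp add: word_entry_Nil word_entry_singleton[OF herm])
    also have "(\<Sum>i<n. \<Sum>j<n. (if i = j then 1 else 0) * cinner (k i) (k j)) = complex_of_real ?S"
      by (simp add: if_distrib[where f = "\<lambda>x. x * _"] cinner_self cong: if_cong)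
    finally have F: "?F k = complex_of_real ?S + ?E" .
    have "cmod ?E \<le> (\<Sum>i<n. \<Sum>j<n. \<Sum>g\<in>(UNIV::'g set). \<epsilon> * (C * (norm (k i) * norm (k j))))"
    proof (intro sum_norm_le)
      fix i j g assume ij: "i \<in> {..<n}" "j \<in> {..<n}"
      have "cmod (cinner (k i) (apply_bop (A g) (k j))) \<le> norm (k i) * (C * norm (k j))"
        using C(2)[of "Some g" "k j"]
        by (intro order_trans[OF cinner_Cauchy_Schwarz] mult_left_mono) auto
      moreover have "cmod (X g $$ (i, j)) \<le> \<epsilon>" using ij \<epsilon> by (simp add: X_def)
      ultimately have "cmod (X g $$ (i, j)) * cmod (cinner (k i) (apply_bop (A g) (k j))) \<le> \<epsilon> * (norm (k i) * (C * norm (k j)))"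
        using \<epsilon> by (intro mult_mono) auto
      then show "cmod (X g $$ (i, j) * cinner (k i) (apply_bop (A g) (k j))) \<le> \<epsilon> * (C * (norm (k i) * norm (k j)))"
        by (simp add: norm_mult mult.left_commute)
    qed
    also have "\<dots> = N * \<epsilon> * C * (\<Sum>i<n. norm (k i))\<^sup>2"
      by (simp add: N_def power2_eq_square sum_product sum_distrib_left mult_ac)
    also have "\<dots> \<le> N * \<epsilon> * C * (real n * ?S)"
      using Cauchy_Schwarz_ineq_sum[of "\<lambda>_. 1" "\<lambda>i. norm (k i)" "{..<n}"] N C0 \<epsilon>
      by (intro mult_left_mono) auto
    also have "\<dots> = ?S / 2" using C0 N n0 by (simp add: \<epsilon>_def field_simps)
    finally have "- Re ?E \<le> ?S / 2" using abs_Re_le_cmod[of ?E] by linarith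
    then show ?thesis unfolding F by simp
  qed
  have "Im (?F k) = 0" for k
  proof (rule hermitian_form_real[OF sa])
    fix s :: "'g option" and i j assume ij: "i \<in> {..<n}" "j \<in> {..<n}"
    have "rev (symbol_word (Some s)) = symbol_word (Some s)" by (cases s) auto
    then show "word_entry n X (symbol_word (Some s)) j i = cnj (word_entry n X (symbol_word (Some s)) i j)"
      using word_entry_rev[OF herm, of j i "symbol_word (Some s)"] ij by simp
  qed
  moreover have "0 \<le> Re (?F k)" for k
    using low[of k] by (rule order_trans[rotated]) (simp add: sum_nonneg)
  ultimately have "psd (opoly_eval n X (pencil 1 A))"
    unfolding psd_pencil_iff[OF herm] zero_le_complex_iff by blast
  then show ?thesis using that i0(1) herm \<theta> low by blast
qed

lemma opoly_degree_lookup: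
  assumes "opoly_degree p \<le> D" "D < length (letters w)"
  shows "Poly_Mapping.lookup p w = 0"
proof (rule ccontr)
  assume "Poly_Mapping.lookup p w \<noteq> 0"
  then have "length (letters w) \<in> (\<lambda>w. length (letters w)) ` Poly_Mapping.keys p" by (auto simp: in_keys_iff)
  then have "length (letters w) \<le> opoly_degree p" unfolding opoly_degree_def by (intro Max_ge) auto
  then show False using assms by simp
qed

lemma keys_subset_words_upto: "opoly_degree p \<le> D \<Longrightarrow> Poly_Mapping.keys p \<subseteq> Word ` words_upto D"
proof
  fix w assume "opoly_degree p \<le> D" "w \<in> Poly_Mapping.keys p"
  then have "letters w \<in> words_upto D"
    using opoly_degree_lookup[of p D w] by (auto simp: words_upto_def in_keys_iff not_less[symmetric])
  then show "w \<in> Word ` words_upto D" by (metis free_monoid.collapse image_eqI)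
qed

lemma eval_entry_words:
  fixes p :: "('g::finite, 'h::complex_hilbert_space) opoly"
  assumes "opoly_degree p \<le> D"
  shows "eval_entry n X p i j = (\<Sum>u\<in>words_upto D. word_entry n X u i j *\<^sub>C Poly_Mapping.lookup p (Word u))"
  by (subst eval_entry_superset[OF _ keys_subset_words_upto[OF assms]])
    (simp_all add: sum.reindex inj_on_def)

text \<open>
  A complex sesquilinear form with nonnegative values is Hermitian. The proof reads \<open>p(X)\<close> as a
  positive semidefinite kernel on pairs of a coordinate and a vector of \<open>\<H>\<close>.
\<close>

lemma psd_eval_hermitian:
  fixes p :: "('g, 'h::complex_hilbert_space) opoly"
  assumes p: "psd (opoly_eval n X p)" and ij: "i < n" "j < n"
  shows "cinner x (apply_bop (eval_entry n X p i j) y) = cnj (cinner y (apply_bop (eval_entry n X p j i) x))"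
proof -
  let ?E = "\<lambda>i j. apply_bop (eval_entry n X p i j)"
  define K where "K z w = (if fst z < n \<and> fst w < n then cinner (snd z) (?E (fst z) (fst w) (snd w)) else 0)"
    for z w :: "nat \<times> 'h"
  have "psd_kernel K"
    unfolding psd_kernel_def
  proof (intro allI impI)
    fix J :: "(nat \<times> 'h) set" and c :: "nat \<times> 'h \<Rightarrow> complex" assume J: "finite J"
    define v where "v i = (\<Sum>z\<in>J. (if fst z = i then c z else 0) *\<^sub>C snd z)" for i
    have "(\<Sum>i<n. \<Sum>j<n. cinner (v i) (?E i j (v j)))
      = (\<Sum>i<n. \<Sum>j<n. \<Sum>z\<in>J. \<Sum>w\<in>J. (if fst w = j then c w else 0) * (cnj (if fst z = i then c z else 0) * cinner (snd z) (?E i j (snd w))))"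
      by (simp only: v_def apply_bop_sum cinner_sum_sum apply_bop_scaleC cinner_scaleC_left cinner_scaleC_right)
    also have "\<dots> = (\<Sum>z\<in>J. \<Sum>w\<in>J. \<Sum>i<n. \<Sum>j<n. (if fst w = j then c w else 0) * (cnj (if fst z = i then c z else 0) * cinner (snd z) (?E i j (snd w))))"
      by (rule sum_swap4)
    also have "\<dots> = (\<Sum>z\<in>J. \<Sum>w\<in>J. cnj (c z) * c w * K z w)"
    proof (intro sum.cong refl)
      fix z w
      have "(\<Sum>i<n. \<Sum>j<n. (if fst w = j then c w else 0) * (cnj (if fst z = i then c z else 0) * cinner (snd z) (?E i j (snd w))))
        = (\<Sum>i<n. \<Sum>j<n. if fst z = i then (if fst w = j then cnj (c z) * c w * cinner (snd z) (?E i j (snd w)) else 0) else 0)"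
        by (intro sum.cong refl) auto
      also have "\<dots> = (\<Sum>i<n. if fst z = i then (\<Sum>j<n. if fst w = j then cnj (c z) * c w * cinner (snd z) (?E i j (snd w)) else 0) else 0)"
        by (intro sum.cong refl) auto
      also have "\<dots> = cnj (c z) * c w * K z w"
        by (simp add: K_def sum.delta)
      finally show "(\<Sum>i<n. \<Sum>j<n. (if fst w = j then c w else 0) * (cnj (if fst z = i then c z else 0) * cinner (snd z) (?E i j (snd w))))
        = cnj (c z) * c w * K z w" .
    qed
    finally show "0 \<le> (\<Sum>z\<in>J. \<Sum>w\<in>J. cnj (c z) * c w * K z w)"
      using p[unfolded psd_eval_iff, rule_format, of v] by (simp only:)
  qed
  from psd_kernel_hermitian[OF this, of "(i, x)" "(j, y)"] show ?thesis using ij by (simp add: K_def)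
qed

lemma bij_rev_words_upto: "bij_betw rev (words_upto D) (words_upto D)"
  by (rule bij_betwI[where g = rev]) (auto simp: words_upto_def)

text \<open>
  At a faithful point the column of \<open>p(X)\<close> at the vacuum determines all coefficients of \<open>p\<close>, so \<open>p\<close>
  inherits the symmetry of \<open>p(X)\<close>.
\<close>

lemma positive_imp_hermitian_coeffs:
  fixes p :: "('g::finite, 'h::complex_hilbert_space) opoly"
  assumes deg: "opoly_degree p \<le> D" and X: "hermitian_tuple n X" and i0: "i0 < n"
    and \<theta>: "\<forall>u\<in>words_upto D. \<forall>w\<in>words_upto D. (\<Sum>i<n. \<theta> u i * word_entry n X w i i0) = (if u = w then 1 else 0)"
    and p: "psd (opoly_eval n X p)" and u: "u \<in> words_upto D"
  shows "cinner x (apply_bop (Poly_Mapping.lookup p (Word u)) y) = cnj (cinner y (apply_bop (Poly_Mapping.lookup p (Word (rev u))) x))"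
proof -
  let ?W = "words_upto D :: 'g list set"
  let ?P = "\<lambda>u. apply_bop (Poly_Mapping.lookup p (Word u))"
  have E: "cinner a (apply_bop (eval_entry n X p i j) b) = (\<Sum>u\<in>?W. word_entry n X u i j * cinner a (?P u b))" for a b i j
    by (simp add: eval_entry_words[OF deg] apply_sum_bop apply_scaleC_bop cinner.sum_right cinner_scaleC_right)
  have eq: "(\<Sum>u\<in>?W. word_entry n X u i i0 * cinner x (?P u y)) = (\<Sum>u\<in>?W. word_entry n X u i i0 * cnj (cinner y (?P (rev u) x)))"
    if i: "i < n" for i
  proof -
    have "(\<Sum>u\<in>?W. word_entry n X u i i0 * cinner x (?P u y)) = cnj (\<Sum>u\<in>?W. word_entry n X u i0 i * cinner y (?P u x))"
      using psd_eval_hermitian[OF p i i0, of x y] by (simp only: E)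
    also have "(\<Sum>u\<in>?W. word_entry n X u i0 i * cinner y (?P u x)) = (\<Sum>u\<in>?W. word_entry n X (rev u) i0 i * cinner y (?P (rev u) x))"
      by (rule sum.reindex_bij_betw[OF bij_rev_words_upto, symmetric])
    finally show ?thesis by (simp add: word_entry_rev[OF X i0 i])
  qed
  have ex: "(\<Sum>i<n. \<theta> u i * (\<Sum>w\<in>?W. word_entry n X w i i0 * f w)) = f u" for f :: "'g list \<Rightarrow> complex"
  proof -
    have "(\<Sum>i<n. \<theta> u i * (\<Sum>w\<in>?W. word_entry n X w i i0 * f w)) = (\<Sum>w\<in>?W. (\<Sum>i<n. \<theta> u i * word_entry n X w i i0) * f w)"
      by (simp only: sum_distrib_left sum_distrib_right mult.assoc) (rule sum.swap)
    also have "\<dots> = (\<Sum>w\<in>?W. (if u = w then 1 else 0) * f w)"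
      by (intro sum.cong refl) (use \<theta> u in simp)
    also have "\<dots> = f u" using u by (simp add: if_distrib[where f = "\<lambda>x. x * _"] cong: if_cong)
    finally show ?thesis .
  qed
  have "cinner x (?P u y) = (\<Sum>i<n. \<theta> u i * (\<Sum>w\<in>?W. word_entry n X w i i0 * cinner x (?P w y)))" by (rule ex[symmetric])
  also have "\<dots> = (\<Sum>i<n. \<theta> u i * (\<Sum>w\<in>?W. word_entry n X w i i0 * cnj (cinner y (?P (rev w) x))))"
    by (intro sum.cong refl) (simp add: eq)
  also have "\<dots> = cnj (cinner y (?P (rev u) x))" by (rule ex)
  finally show ?thesis .
qed

lemma sum_squares_matrix_bound:
  fixes x :: "'u \<Rightarrow> real" and y :: "'i \<Rightarrow> real"
  assumes "\<And>u. u \<in> U \<Longrightarrow> 0 \<le> x u" "\<And>u. u \<in> U \<Longrightarrow> x u \<le> (\<Sum>i\<in>I. a u i * y i)"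
  shows "(\<Sum>u\<in>U. (x u)\<^sup>2) \<le> (\<Sum>u\<in>U. \<Sum>i\<in>I. (a u i)\<^sup>2) * (\<Sum>i\<in>I. (y i)\<^sup>2)"
proof -
  have "(\<Sum>u\<in>U. (x u)\<^sup>2) \<le> (\<Sum>u\<in>U. (\<Sum>i\<in>I. (a u i)\<^sup>2) * (\<Sum>i\<in>I. (y i)\<^sup>2))"
  proof (rule sum_mono)
    fix u assume u: "u \<in> U"
    have "(x u)\<^sup>2 \<le> (\<Sum>i\<in>I. a u i * y i)\<^sup>2" using assms[OF u] by (intro power_mono)
    also have "\<dots> \<le> (\<Sum>i\<in>I. (a u i)\<^sup>2) * (\<Sum>i\<in>I. (y i)\<^sup>2)" by (rule Cauchy_Schwarz_ineq_sum)
    finally show "(x u)\<^sup>2 \<le> (\<Sum>i\<in>I. (a u i)\<^sup>2) * (\<Sum>i\<in>I. (y i)\<^sup>2)" .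
  qed
  also have "\<dots> = (\<Sum>u\<in>U. \<Sum>i\<in>I. (a u i)\<^sup>2) * (\<Sum>i\<in>I. (y i)\<^sup>2)"
    by (rule sum_distrib_right[symmetric])
  finally show ?thesis .
qed

abbreviation strictly_positive_moments ::
    "('g::finite \<Rightarrow> 'k::complex_hilbert_space bop) \<Rightarrow> nat \<Rightarrow> ('g list \<Rightarrow> complex) \<Rightarrow> real \<Rightarrow> bool" where
  "strictly_positive_moments A d \<tau> \<kappa> \<equiv> coeff_positive A (words_upto d) (\<lambda>\<sigma> v w. \<tau> (rev v @ symbol_word \<sigma> @ w)
       - (if \<sigma> \<in> {None, Some None} \<and> v = w then complex_of_real \<kappa> else 0))"

text \<open>
  The moments of a faithful point in the interior of the matricial domain: as coefficients they are
  positive, even after subtracting a multiple of the two units. Hence the pairing with them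
  controls the trace of every dual positive kernel.
\<close>

lemma ex_strictly_positive_moments:
  fixes A :: "'g::finite \<Rightarrow> 'k::complex_hilbert_space bop"
  assumes sa: "\<And>g. self_adjoint (A g)"
  obtains \<tau> :: "'g list \<Rightarrow> complex" and \<kappa> :: real where
    "\<kappa> > 0" "\<And>u. \<tau> (rev u) = cnj (\<tau> u)"
    "strictly_positive_moments A d \<tau> \<kappa>"
proof -
  let ?W = "words_upto d :: 'g list set"
  obtain n i0 and X :: "'g \<Rightarrow> complex mat" and \<theta> where
    i0: "i0 < n" and X: "hermitian_tuple n X" and
    \<theta>: "\<forall>u\<in>?W. \<forall>w\<in>?W. (\<Sum>i<n. \<theta> u i * word_entry n X w i i0) = (if u = w then 1 else 0)" and
    low: "\<forall>k::nat \<Rightarrow> 'k. (\<Sum>i<n. (norm (k i))\<^sup>2) / 2 \<le> Re (\<Sum>i<n. \<Sum>j<n. \<Sum>s\<in>UNIV.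
        word_entry n X (symbol_word (Some s)) i j * cinner (k i) (pencil_op A s (k j)))" and
    L: "psd (opoly_eval n X (pencil 1 A))"
    by (rule ex_faithful_point[of A d, OF sa]) (rule that; assumption)
  define \<tau> where "\<tau> u = word_entry n X u i0 i0" for u
  define \<xi> where "\<xi> w i = word_entry n X w i i0" for w i
  define \<Theta> where "\<Theta> = (\<Sum>u\<in>?W. \<Sum>i<n. (cmod (\<theta> u i))\<^sup>2)"
  define \<kappa> where "\<kappa> = 1 / (2 * (\<Theta> + 1))"
  have \<Theta>: "\<Theta> \<ge> 0" by (simp add: \<Theta>_def sum_nonneg)
  have \<kappa>: "\<kappa> > 0" "\<kappa> * \<Theta> \<le> 1 / 2" using \<Theta> by (simp_all add: \<kappa>_def field_simps)
  have split: "\<tau> (rev v @ symbol_word \<sigma> @ w) = (\<Sum>i<n. \<Sum>l<n. cnj (\<xi> v i) * \<xi> w l * word_entry n X (symbol_word \<sigma>) i l)"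
    for v w \<sigma>
    unfolding \<tau>_def \<xi>_def word_entry_split[OF X i0 i0] by (simp only: mult_ac)
  have bound: "\<kappa> * (\<Sum>u\<in>?W. (x u)\<^sup>2) \<le> (\<Sum>i<n. (y i)\<^sup>2) / 2"
    if "\<And>u. u \<in> ?W \<Longrightarrow> 0 \<le> x u" "\<And>u. u \<in> ?W \<Longrightarrow> x u \<le> (\<Sum>i<n. cmod (\<theta> u i) * y i)" for x y
  proof -
    have "\<kappa> * (\<Sum>u\<in>?W. (x u)\<^sup>2) \<le> \<kappa> * (\<Theta> * (\<Sum>i<n. (y i)\<^sup>2))"
      unfolding \<Theta>_def by (intro mult_left_mono sum_squares_matrix_bound that) (use \<kappa> in auto)
    also have "\<dots> \<le> (1 / 2) * (\<Sum>i<n. (y i)\<^sup>2)"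
      unfolding mult.assoc[symmetric] by (intro mult_right_mono \<kappa>) (simp add: sum_nonneg)
    finally show ?thesis by simp
  qed
  have pos: "coeff_positive A ?W (\<lambda>\<sigma> v w. \<tau> (rev v @ symbol_word \<sigma> @ w)
       - (if \<sigma> \<in> {None, Some None} \<and> v = w then complex_of_real \<kappa> else 0))"
    unfolding coeff_positive_def
  proof (intro conjI allI)
    fix c :: "'g list \<Rightarrow> complex"
    define \<zeta> where "\<zeta> i = (\<Sum>w\<in>?W. \<xi> w i * c w)" for i
    have "c u = (\<Sum>i<n. \<theta> u i * \<zeta> i)" if "u \<in> ?W" for u
    proof -
      have "(\<Sum>i<n. \<theta> u i * \<zeta> i) = (\<Sum>w\<in>?W. (\<Sum>i<n. \<theta> u i * \<xi> w i) * c w)"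
        by (simp only: \<zeta>_def sum_distrib_left sum_distrib_right mult.assoc) (rule sum.swap)
      also have "\<dots> = (\<Sum>w\<in>?W. (if u = w then 1 else 0) * c w)"
        by (intro sum.cong refl) (use \<theta> that in \<open>simp add: \<xi>_def\<close>)
      finally show ?thesis using that by (simp add: if_distrib[where f = "\<lambda>x. x * _"] cong: if_cong)
    qed
    then have "cmod (c u) \<le> (\<Sum>i<n. cmod (\<theta> u i) * cmod (\<zeta> i))" if "u \<in> ?W" for u
      using that by (metis (no_types, lifting) norm_mult norm_sum sum.cong)
    then have *: "\<kappa> * (\<Sum>u\<in>?W. (cmod (c u))\<^sup>2) \<le> (\<Sum>i<n. (cmod (\<zeta> i))\<^sup>2) / 2"
      by (intro bound) auto
    have "(\<Sum>v\<in>?W. \<Sum>w\<in>?W. \<tau> (rev v @ symbol_word None @ w) * (cnj (c v) * c w))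
      = (\<Sum>v\<in>?W. \<Sum>w\<in>?W. \<Sum>i<n. cnj (\<xi> v i * c v) * (\<xi> w i * c w))"
    proof (intro sum.cong refl)
      fix v w
      have "\<tau> (rev v @ symbol_word None @ w) = (\<Sum>i<n. \<Sum>l<n. if l = i then cnj (\<xi> v i) * \<xi> w l else 0)"
        unfolding split by (intro sum.cong refl) (simp add: word_entry_Nil)
      also have "\<dots> = (\<Sum>i<n. cnj (\<xi> v i) * \<xi> w i)" by simp
      finally show "\<tau> (rev v @ symbol_word None @ w) * (cnj (c v) * c w) = (\<Sum>i<n. cnj (\<xi> v i * c v) * (\<xi> w i * c w))"
        by (simp add: sum_distrib_right sum_distrib_left mult_ac)
    qed
    also have "\<dots> = (\<Sum>i<n. \<Sum>v\<in>?W. \<Sum>w\<in>?W. cnj (\<xi> v i * c v) * (\<xi> w i * c w))" by (rule sum_swap3)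
    also have "\<dots> = (\<Sum>i<n. cnj (\<zeta> i) * \<zeta> i)" by (simp only: \<zeta>_def cnj_sum sum_product)
    also have "\<dots> = complex_of_real (\<Sum>i<n. (cmod (\<zeta> i))\<^sup>2)"
      by (simp add: complex_norm_square mult.commute del: of_real_power)
    finally have 1: "(\<Sum>v\<in>?W. \<Sum>w\<in>?W. \<tau> (rev v @ symbol_word None @ w) * (cnj (c v) * c w)) = complex_of_real (\<Sum>i<n. (cmod (\<zeta> i))\<^sup>2)" .
    have 2: "(\<Sum>v\<in>?W. \<Sum>w\<in>?W. (if v = w then complex_of_real \<kappa> else 0) * (cnj (c v) * c w)) = complex_of_real (\<kappa> * (\<Sum>u\<in>?W. (cmod (c u))\<^sup>2))"
    proof -
      have "(\<Sum>v\<in>?W. \<Sum>w\<in>?W. (if v = w then complex_of_real \<kappa> else 0) * (cnj (c v) * c w))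
        = (\<Sum>v\<in>?W. \<Sum>w\<in>?W. if v = w then complex_of_real \<kappa> * (c v * cnj (c v)) else 0)"
        by (intro sum.cong refl) auto
      also have "\<dots> = (\<Sum>v\<in>?W. complex_of_real \<kappa> * (c v * cnj (c v)))" by simp
      finally show ?thesis by (simp add: complex_norm_square sum_distrib_left del: of_real_power)
    qed
    have "(\<Sum>v\<in>?W. \<Sum>w\<in>?W. (\<tau> (rev v @ symbol_word None @ w) - (if (None::'g option option) \<in> {None, Some None} \<and> v = w then complex_of_real \<kappa> else 0)) * (cnj (c v) * c w))
      = complex_of_real ((\<Sum>i<n. (cmod (\<zeta> i))\<^sup>2) - \<kappa> * (\<Sum>u\<in>?W. (cmod (c u))\<^sup>2))"
      unfolding of_real_diff 1[symmetric] 2[symmetric] by (simp add: left_diff_distrib sum_subtractf)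
    moreover have "0 \<le> (\<Sum>i<n. (cmod (\<zeta> i))\<^sup>2)" by (simp add: sum_nonneg)
    ultimately show "0 \<le> (\<Sum>v\<in>?W. \<Sum>w\<in>?W. (\<tau> (rev v @ symbol_word None @ w) - (if (None::'g option option) \<in> {None, Some None} \<and> v = w then complex_of_real \<kappa> else 0)) * (cnj (c v) * c w))"
      using * by (simp add: zero_le_complex_iff del: of_real_diff)
  next
    fix k :: "'g list \<Rightarrow> 'k"
    let ?B = "\<lambda>s. pencil_op A s"
    let ?x = "\<lambda>s. word_entry n X (symbol_word (Some s))"
    define \<zeta> where "\<zeta> i = (\<Sum>w\<in>?W. \<xi> w i *\<^sub>C k w)" for i
    have "k u = (\<Sum>i<n. \<theta> u i *\<^sub>C \<zeta> i)" if "u \<in> ?W" for u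
    proof -
      have "(\<Sum>i<n. \<theta> u i *\<^sub>C \<zeta> i) = (\<Sum>w\<in>?W. (\<Sum>i<n. \<theta> u i * \<xi> w i) *\<^sub>C k w)"
        by (simp only: \<zeta>_def complex_vector.scale_sum_left complex_vector.scale_sum_right scaleC_scaleC) (rule sum.swap)
      also have "\<dots> = (\<Sum>w\<in>?W. (if u = w then 1 else 0) *\<^sub>C k w)"
        by (intro sum.cong refl) (use \<theta> that in \<open>simp add: \<xi>_def\<close>)
      finally show ?thesis using that by (simp add: if_distrib[where f = "\<lambda>x. x *\<^sub>C _"] cong: if_cong)
    qed
    then have "norm (k u) \<le> (\<Sum>i<n. cmod (\<theta> u i) * norm (\<zeta> i))" if "u \<in> ?W" for u
      using that by (metis (no_types, lifting) norm_scaleC norm_sum sum.cong)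
    then have *: "\<kappa> * (\<Sum>u\<in>?W. (norm (k u))\<^sup>2) \<le> (\<Sum>i<n. (norm (\<zeta> i))\<^sup>2) / 2"
      by (intro bound) auto
    let ?F = "\<Sum>i<n. \<Sum>l<n. \<Sum>s\<in>UNIV. ?x s i l * cinner (\<zeta> i) (?B s (\<zeta> l))"
    have "(\<Sum>v\<in>?W. \<Sum>w\<in>?W. \<Sum>s\<in>UNIV. \<tau> (rev v @ symbol_word (Some s) @ w) * cinner (k v) (?B s (k w)))
      = (\<Sum>v\<in>?W. \<Sum>w\<in>?W. \<Sum>s\<in>UNIV. \<Sum>i<n. \<Sum>l<n. ?x s i l * cinner (\<xi> v i *\<^sub>C k v) (?B s (\<xi> w l *\<^sub>C k w)))"
      unfolding split by (simp add: sum_distrib_right sum_distrib_left apply_bop_scaleC cinner_scaleC_left cinner_scaleC_right mult_ac)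
    also have "\<dots> = (\<Sum>v\<in>?W. \<Sum>w\<in>?W. \<Sum>i<n. \<Sum>l<n. \<Sum>s\<in>UNIV. ?x s i l * cinner (\<xi> v i *\<^sub>C k v) (?B s (\<xi> w l *\<^sub>C k w)))"
      by (rule sum.cong[OF refl], rule sum.cong[OF refl], rule sum_swap3[symmetric])
    also have "\<dots> = (\<Sum>i<n. \<Sum>l<n. \<Sum>v\<in>?W. \<Sum>w\<in>?W. \<Sum>s\<in>UNIV. ?x s i l * cinner (\<xi> v i *\<^sub>C k v) (?B s (\<xi> w l *\<^sub>C k w)))"
      by (rule sum_swap4)
    also have "\<dots> = (\<Sum>i<n. \<Sum>l<n. \<Sum>s\<in>UNIV. \<Sum>v\<in>?W. \<Sum>w\<in>?W. ?x s i l * cinner (\<xi> v i *\<^sub>C k v) (?B s (\<xi> w l *\<^sub>C k w)))"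
      by (rule sum.cong[OF refl], rule sum.cong[OF refl], rule sum_swap3)
    also have "\<dots> = ?F" by (simp only: \<zeta>_def apply_bop_sum cinner_sum_sum sum_distrib_left)
    finally have 1: "(\<Sum>v\<in>?W. \<Sum>w\<in>?W. \<Sum>s\<in>UNIV. \<tau> (rev v @ symbol_word (Some s) @ w) * cinner (k v) (?B s (k w))) = ?F" .
    have "(\<Sum>v\<in>?W. \<Sum>w\<in>?W. \<Sum>s\<in>UNIV. (if Some s \<in> {None, Some None} \<and> v = w then complex_of_real \<kappa> else 0) * cinner (k v) (?B s (k w)))
      = (\<Sum>v\<in>?W. \<Sum>w\<in>?W. if v = w then complex_of_real \<kappa> * cinner (k v) (k w) else 0)"
      by (intro sum.cong refl, subst sum_UNIV_option) simp
    also have "\<dots> = complex_of_real (\<kappa> * (\<Sum>u\<in>?W. (norm (k u))\<^sup>2))"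
      by (simp add: cinner_self sum_distrib_left)
    finally have 2: "(\<Sum>v\<in>?W. \<Sum>w\<in>?W. \<Sum>s\<in>UNIV. (if Some s \<in> {None, Some None} \<and> v = w then complex_of_real \<kappa> else 0) * cinner (k v) (?B s (k w)))
      = complex_of_real (\<kappa> * (\<Sum>u\<in>?W. (norm (k u))\<^sup>2))" .
    have F: "0 \<le> ?F" using L unfolding psd_pencil_iff[OF X] by blast
    have eq: "(\<Sum>v\<in>?W. \<Sum>w\<in>?W. \<Sum>s\<in>UNIV. (\<tau> (rev v @ symbol_word (Some s) @ w) - (if Some s \<in> {None, Some None} \<and> v = w then complex_of_real \<kappa> else 0)) * cinner (k v) (?B s (k w)))
      = ?F - complex_of_real (\<kappa> * (\<Sum>u\<in>?W. (norm (k u))\<^sup>2))"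
      unfolding 1[symmetric] 2[symmetric] by (simp only: left_diff_distrib sum_subtractf)
    have "\<kappa> * (\<Sum>u\<in>?W. (norm (k u))\<^sup>2) \<le> Re ?F" using * low[rule_format, of \<zeta>] by (rule order_trans)
    then show "0 \<le> (\<Sum>v\<in>?W. \<Sum>w\<in>?W. \<Sum>s\<in>UNIV. (\<tau> (rev v @ symbol_word (Some s) @ w) - (if Some s \<in> {None, Some None} \<and> v = w then complex_of_real \<kappa> else 0)) * cinner (k v) (?B s (k w)))"
      unfolding eq using F by (simp add: zero_le_complex_iff)
  qed
  have "\<tau> (rev u) = cnj (\<tau> u)" for u unfolding \<tau>_def by (rule word_entry_rev[OF X i0 i0])
  with \<kappa>(1) show ?thesis by (rule that) (rule pos)
qed

text \<open>
  Compress the moment coefficients by the scalars \<open>c\<close>: this pairs them with the Gram data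
  of the polynomial \<open>\<Sum>\<^sub>a\<^sub>b cnj (c a) c b p\<^sub>a\<^sub>b\<close>.
\<close>

lemma trace_bound:
  fixes A :: "'g::finite \<Rightarrow> 'k::complex_hilbert_space bop"
  assumes pos: "strictly_positive_moments A d \<tau> \<kappa>"
    and Z: "dual_positive A Z"
  shows "0 \<le> (\<Sum>u\<in>words_upto (2 * d + 1). \<Sum>a<m. \<Sum>b<m. \<tau> u * (cnj (c a) * c b) * gram_coeff d Z u a b)
    - complex_of_real \<kappa> * (\<Sum>w\<in>words_upto d. \<Sum>a<m. \<Sum>b<m. cnj (c a) * c b * (Z None (w, a) (w, b) + Z (Some None) (w, a) (w, b)))"
proof -
  let ?W = "words_upto d :: 'g list set" and ?J = "words_upto d \<times> {..<m} :: ('g list \<times> nat) set"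
  define \<delta> where "\<delta> \<sigma> v w = (if \<sigma> \<in> {None, Some None} \<and> v = w then complex_of_real \<kappa> else 0)"
    for \<sigma> :: "'g option option" and v w :: "'g list"
  define t where "t \<sigma> v w = \<tau> (rev v @ symbol_word \<sigma> @ w) - \<delta> \<sigma> v w" for \<sigma> and v w :: "'g list"
  define \<alpha> where "\<alpha> v p = (if v = fst p then c (snd p) else 0)" for v :: "'g list" and p :: "'g list \<times> nat"
  define t' where "t' \<sigma> p q = (\<Sum>i\<in>?W. \<Sum>j\<in>?W. cnj (\<alpha> i p) * \<alpha> j q * t \<sigma> i j)" for \<sigma> p q
  have "coeff_positive A ?J t'"
    unfolding t'_def by (rule coeff_positive_compress) (use pos in \<open>simp add: t_def \<delta>_def\<close>)
  then have "0 \<le> (\<Sum>i\<in>?J. \<Sum>j\<in>?J. \<Sum>\<sigma>\<in>UNIV. t' \<sigma> i j * Z \<sigma> i j)"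
    by (intro dual_positiveD[OF Z]) auto
  also have "\<dots> = (\<Sum>i\<in>?J. \<Sum>j\<in>?J. \<Sum>\<sigma>\<in>UNIV. cnj (c (snd i)) * c (snd j) * t \<sigma> (fst i) (fst j) * Z \<sigma> i j)"
  proof (intro sum.cong refl)
    fix p q \<sigma> assume p: "p \<in> ?J" and q: "q \<in> ?J"
    have "t' \<sigma> p q = (\<Sum>i\<in>?W. \<Sum>j\<in>?W. if i = fst p then (if j = fst q then cnj (c (snd p)) * c (snd q) * t \<sigma> i j else 0) else 0)"
      unfolding t'_def by (intro sum.cong refl) (simp add: \<alpha>_def)
    also have "\<dots> = (\<Sum>i\<in>?W. if i = fst p then (\<Sum>j\<in>?W. if j = fst q then cnj (c (snd p)) * c (snd q) * t \<sigma> i j else 0) else 0)"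
      by (rule sum.cong[OF refl]) simp
    also have "\<dots> = cnj (c (snd p)) * c (snd q) * t \<sigma> (fst p) (fst q)"
      using p q by (auto simp: sum.delta)
    finally show "t' \<sigma> p q * Z \<sigma> p q = cnj (c (snd p)) * c (snd q) * t \<sigma> (fst p) (fst q) * Z \<sigma> p q" by simp
  qed
  also have "\<dots> = (\<Sum>i\<in>?J. \<Sum>j\<in>?J. \<Sum>\<sigma>\<in>UNIV. \<tau> (rev (fst i) @ symbol_word \<sigma> @ fst j) * (cnj (c (snd i)) * c (snd j)) * Z \<sigma> i j)
      - (\<Sum>i\<in>?J. \<Sum>j\<in>?J. \<Sum>\<sigma>\<in>UNIV. cnj (c (snd i)) * c (snd j) * \<delta> \<sigma> (fst i) (fst j) * Z \<sigma> i j)"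
    by (simp add: t_def sum_subtractf[symmetric] algebra_simps)
  also have "(\<Sum>i\<in>?J. \<Sum>j\<in>?J. \<Sum>\<sigma>\<in>UNIV. \<tau> (rev (fst i) @ symbol_word \<sigma> @ fst j) * (cnj (c (snd i)) * c (snd j)) * Z \<sigma> i j)
      = (\<Sum>u\<in>words_upto (2 * d + 1). \<Sum>a<m. \<Sum>b<m. \<tau> u * (cnj (c a) * c b) * gram_coeff d Z u a b)"
    by (rule gram_coeff_pairing[of "\<lambda>u a b. \<tau> u * (cnj (c a) * c b)", symmetric])
  also have "(\<Sum>i\<in>?J. \<Sum>j\<in>?J. \<Sum>\<sigma>\<in>UNIV. cnj (c (snd i)) * c (snd j) * \<delta> \<sigma> (fst i) (fst j) * Z \<sigma> i j)
      = (\<Sum>i\<in>?J. \<Sum>j\<in>?J. if fst i = fst j then complex_of_real \<kappa> * (cnj (c (snd i)) * c (snd j) * (Z None i j + Z (Some None) i j)) else 0)"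
    by (intro sum.cong refl, subst sum_UNIV_option, subst sum_UNIV_option) (simp add: \<delta>_def algebra_simps)
  also have "\<dots> = (\<Sum>v\<in>?W. \<Sum>a<m. \<Sum>w\<in>?W. \<Sum>b<m. if v = w then complex_of_real \<kappa> * (cnj (c a) * c b * (Z None (v, a) (w, b) + Z (Some None) (v, a) (w, b))) else 0)"
    by (simp add: sum.cartesian_product' cong: if_cong)
  also have "\<dots> = (\<Sum>v\<in>?W. \<Sum>a<m. \<Sum>b<m. \<Sum>w\<in>?W. if v = w then complex_of_real \<kappa> * (cnj (c a) * c b * (Z None (v, a) (w, b) + Z (Some None) (v, a) (w, b))) else 0)"
    by (rule sum.cong[OF refl], rule sum.cong[OF refl], rule sum.swap)
  also have "\<dots> = complex_of_real \<kappa> * (\<Sum>w\<in>?W. \<Sum>a<m. \<Sum>b<m. cnj (c a) * c b * (Z None (w, a) (w, b) + Z (Some None) (w, a) (w, b)))"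
    by (simp add: sum_distrib_left)
  finally show ?thesis .
qed

section \<open>The truncated GNS construction\<close>

text \<open>
  The Cholesky factorisation \<open>M = \<beta>\<^sup>* \<beta>\<close>, where \<open>\<beta> k j = l j k\<close>. A vector in the kernel of \<open>\<beta>\<close> is a zero
  of the form of \<open>M\<close>, so by strict positivity \<open>\<beta>\<close> has an inverse, which is \<open>\<gamma>\<close>.
\<close>

lemma strictly_positive_factorization:
  fixes M :: "nat \<Rightarrow> nat \<Rightarrow> complex"
  assumes M: "\<And>c. 0 \<le> (\<Sum>i<n. \<Sum>j<n. M i j * (cnj (c i) * c j))"
    and strict: "\<And>c. (\<Sum>i<n. \<Sum>j<n. M i j * (cnj (c i) * c j)) = 0 \<Longrightarrow> \<forall>i<n. c i = 0"
  obtains l \<gamma> :: "nat \<Rightarrow> nat \<Rightarrow> complex" where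
    "\<And>i j. i < n \<Longrightarrow> j < n \<Longrightarrow> M i j = (\<Sum>k<n. cnj (l i k) * l j k)"
    "\<And>i j. i < n \<Longrightarrow> j < n \<Longrightarrow> (\<Sum>k<n. \<gamma> i k * l j k) = (if i = j then 1 else 0)"
    "\<And>k k'. k < n \<Longrightarrow> k' < n \<Longrightarrow> (\<Sum>j<n. l j k * \<gamma> j k') = (if k = k' then 1 else 0)"
proof -
  define K where "K i j = (if i < n \<and> j < n then M i j else 0)" for i j
  have "psd_kernel K"
    unfolding psd_kernel_def
  proof (intro allI impI)
    fix J :: "nat set" and c :: "nat \<Rightarrow> complex" assume J: "finite J"
    define c' where "c' i = (if i \<in> J then c i else 0)" for i
    have "(\<Sum>i\<in>J. \<Sum>j\<in>J. cnj (c i) * c j * K i j) = (\<Sum>i\<in>J. \<Sum>j<n. M i j * (cnj (c i) * c' j) * (if i < n then 1 else 0))"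
    proof (rule sum.cong[OF refl])
      fix i
      have "(\<Sum>j\<in>J. cnj (c i) * c j * K i j) = (\<Sum>j\<in>J \<union> {..<n}. cnj (c i) * c' j * K i j)"
        by (rule sum.mono_neutral_cong_left) (use J in \<open>auto simp: c'_def\<close>)
      also have "\<dots> = (\<Sum>j<n. cnj (c i) * c' j * K i j)"
        by (rule sum.mono_neutral_right) (use J in \<open>auto simp: K_def\<close>)
      also have "\<dots> = (\<Sum>j<n. M i j * (cnj (c i) * c' j) * (if i < n then 1 else 0))"
        by (intro sum.cong refl) (simp add: K_def mult_ac)
      finally show "(\<Sum>j\<in>J. cnj (c i) * c j * K i j) = (\<Sum>j<n. M i j * (cnj (c i) * c' j) * (if i < n then 1 else 0))" .
    qed
    also have "\<dots> = (\<Sum>i\<in>J \<union> {..<n}. \<Sum>j<n. M i j * (cnj (c' i) * c' j) * (if i < n then 1 else 0))"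
      by (rule sum.mono_neutral_cong_left) (use J in \<open>auto simp: c'_def\<close>)
    also have "\<dots> = (\<Sum>i<n. \<Sum>j<n. M i j * (cnj (c' i) * c' j))"
      by (rule sum.mono_neutral_cong_right) (use J in auto)
    finally show "0 \<le> (\<Sum>i\<in>J. \<Sum>j\<in>J. cnj (c i) * c j * K i j)" using M[of c'] by simp
  qed
  then obtain l :: "nat \<Rightarrow> nat \<Rightarrow> complex" where
    "\<And>i k. i < k \<Longrightarrow> l i k = 0" "\<And>i k. l k k = 0 \<Longrightarrow> l i k = 0" and
    l: "\<And>i j n. i < n \<Longrightarrow> K i j = (\<Sum>k<n. cnj (l i k) * l j k)"
    by (rule cholesky) (rule that; assumption)
  have Ml: "M i j = (\<Sum>k<n. cnj (l i k) * l j k)" if "i < n" "j < n" for i j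
    using l[OF that(1), of j] that by (simp add: K_def)
  define b where "b = mat n n (\<lambda>(k, j). l j k)"
  have b: "b \<in> carrier_mat n n" by (simp add: b_def)
  have "det b \<noteq> 0"
  proof
    assume "det b = 0"
    then obtain v where v: "v \<in> carrier_vec n" "v \<noteq> 0\<^sub>v n" "b *\<^sub>v v = 0\<^sub>v n"
      using det_0_iff_vec_prod_zero_field[OF b] by blast
    define c where "c j = v $ j" for j
    have z: "(\<Sum>j<n. l j k * c j) = 0" if "k < n" for k
    proof -
      have "(\<Sum>j<n. l j k * c j) = (b *\<^sub>v v) $ k"
        using that v(1) by (simp add: b_def scalar_prod_def c_def atLeast0LessThan)
      then show ?thesis using v(3) that by simp
    qed
    have "(\<Sum>i<n. \<Sum>j<n. M i j * (cnj (c i) * c j)) = (\<Sum>i<n. \<Sum>j<n. \<Sum>k<n. cnj (l i k * c i) * (l j k * c j))"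
      by (intro sum.cong refl) (simp add: Ml sum_distrib_left sum_distrib_right mult_ac)
    also have "\<dots> = (\<Sum>k<n. \<Sum>i<n. \<Sum>j<n. cnj (l i k * c i) * (l j k * c j))" by (rule sum_swap3)
    also have "\<dots> = (\<Sum>k<n. cnj (\<Sum>i<n. l i k * c i) * (\<Sum>j<n. l j k * c j))" by (simp only: cnj_sum sum_product)
    also have "\<dots> = 0" using z by simp
    finally have "\<forall>i<n. c i = 0" by (rule strict)
    then have "v = 0\<^sub>v n" using v(1) by (intro eq_vecI) (auto simp: c_def)
    then show False using v(2) by simp
  qed
  from det_non_zero_imp_unit[OF b this, of "()"]
  obtain C where C: "C \<in> carrier_mat n n" "C * b = 1\<^sub>m n" "b * C = 1\<^sub>m n"
    unfolding Units_def ring_mat_def by auto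
  have "(\<Sum>k<n. C $$ (i, k) * l j k) = (if i = j then 1 else 0)" if "i < n" "j < n" for i j
  proof -
    have "(\<Sum>k<n. C $$ (i, k) * l j k) = (C * b) $$ (i, j)"
      unfolding mat_mult_entry[OF C(1) b that] by (intro sum.cong refl) (use that in \<open>simp add: b_def\<close>)
    then show ?thesis using C(2) that by simp
  qed
  moreover have "(\<Sum>j<n. l j k * C $$ (j, k')) = (if k = k' then 1 else 0)" if "k < n" "k' < n" for k k'
  proof -
    have "(\<Sum>j<n. l j k * C $$ (j, k')) = (b * C) $$ (k, k')"
      unfolding mat_mult_entry[OF b C(1) that] by (intro sum.cong refl) (use that in \<open>simp add: b_def\<close>)
    then show ?thesis using C(3) that by simp
  qed
  ultimately show ?thesis using that[of l "\<lambda>i k. C $$ (i, k)"] Ml by blast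
qed

text \<open>
  Degree \<open>2 d + 1\<close> is the largest one for which two words of length at most \<open>d\<close> and a single
  letter suffice.
\<close>

lemma split_word_upto:
  assumes "u \<in> words_upto (2 * d + 1)"
  obtains v \<sigma> w where "v \<in> words_upto d" "w \<in> words_upto d" "u = rev v @ symbol_word \<sigma> @ w"
proof (cases "length u \<le> d")
  case True
  then show ?thesis using that[of "[]" u None] by (simp add: words_upto_def)
next
  case False
  define r where "r = length u - d - 1"
  have r: "r < length u" "r \<le> d" "length u - Suc r = d" using False assms by (auto simp: r_def words_upto_def)
  show ?thesis
  proof (rule that)
    show "rev (take r u) \<in> words_upto d" "drop (Suc r) u \<in> words_upto d"
      using r by (auto simp: words_upto_def)
    show "u = rev (rev (take r u)) @ symbol_word (Some (Some (u ! r))) @ drop (Suc r) u"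
      using id_take_nth_drop[OF r(1)] by simp
  qed
qed

text \<open>
  The truncated Gelfand-Naimark-Segal construction. The functional \<open>y\<close> on matrix polynomials of
  degree at most \<open>2 d + 1\<close> gives an inner product on the polynomials of degree at most \<open>d\<close> and, by
  inserting a letter between two words of length at most \<open>d\<close>, Hermitian forms for the letters.
  In an orthonormal basis these become Hermitian matrices that reproduce \<open>y\<close>.
\<close>

lemma truncated_GNS:
  fixes y :: "'g::finite list \<Rightarrow> nat \<Rightarrow> nat \<Rightarrow> complex" and A :: "'g \<Rightarrow> 'k::complex_hilbert_space bop"
  defines "M \<equiv> \<lambda>\<sigma> i j. y (rev (fst i) @ symbol_word \<sigma> @ fst j) (snd i) (snd j)"
  assumes herm: "\<And>u a b. u \<in> words_upto (2 * d + 1) \<Longrightarrow> a < m \<Longrightarrow> b < m \<Longrightarrow> y (rev u) b a = cnj (y u a b)"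
    and pos: "coeff_positive A (words_upto d \<times> {..<m}) M"
    and strict: "\<And>c. (\<Sum>i\<in>words_upto d \<times> {..<m}. \<Sum>j\<in>words_upto d \<times> {..<m}. M None i j * (cnj (c i) * c j)) = 0 \<Longrightarrow>
      \<forall>i\<in>words_upto d \<times> {..<m}. c i = 0"
  obtains n and X :: "'g \<Rightarrow> complex mat" and \<xi> where
    "hermitian_tuple n X" "psd (opoly_eval n X (pencil 1 A))"
    "\<And>u a b. u \<in> words_upto (2 * d + 1) \<Longrightarrow> a < m \<Longrightarrow> b < m \<Longrightarrow>
      (\<Sum>i<n. \<Sum>k<n. cnj (\<xi> a i) * word_entry n X u i k * \<xi> b k) = y u a b"
proof -
  let ?J = "words_upto d \<times> {..<m} :: ('g list \<times> nat) set"
  define n where "n = card ?J"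
  have finJ: "finite ?J" by simp
  obtain h where h: "bij_betw h {..<n} ?J"
    using ex_bij_betw_nat_finite[OF finJ] by (auto simp: n_def atLeast0LessThan)
  have hJ: "h i \<in> ?J" if "i < n" for i using h that by (auto simp: bij_betw_def)
  define hi where "hi = inv_into {..<n} h"
  have hi: "hi x < n" "h (hi x) = x" if "x \<in> ?J" for x
  proof -
    have "x \<in> h ` {..<n}" using h that by (simp add: bij_betw_def)
    then show "hi x < n" "h (hi x) = x" unfolding hi_def using inv_into_into[of x h "{..<n}"] by (auto intro: f_inv_into_f)
  qed
  have hih: "hi (h i) = i" if "i < n" for i
    unfolding hi_def using h that by (intro inv_into_f_f) (auto simp: bij_betw_def)
  have re: "(\<Sum>i\<in>?J. f i) = (\<Sum>i<n. f (h i))" for f :: "_ \<Rightarrow> complex"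
    by (rule sum.reindex_bij_betw[OF h, symmetric])
  let ?M = "\<lambda>\<sigma> i j. M \<sigma> (h i) (h j)"
  have M_herm: "M \<sigma> j i = cnj (M \<sigma> i j)" if "i \<in> ?J" "j \<in> ?J" for \<sigma> i j
  proof -
    have "rev (symbol_word \<sigma>) = symbol_word \<sigma>" by (cases \<sigma> rule: symbol_word.cases) auto
    then have "M \<sigma> j i = y (rev (rev (fst i) @ symbol_word \<sigma> @ fst j)) (snd j) (snd i)" by (simp add: M_def)
    also have "\<dots> = cnj (M \<sigma> i j)" unfolding M_def using that
      by (intro herm word_split_in_words_upto) auto
    finally show ?thesis .
  qed
  have M0: "0 \<le> (\<Sum>i<n. \<Sum>j<n. ?M None i j * (cnj (c i) * c j))" for c
  proof -
    have "0 \<le> (\<Sum>i\<in>?J. \<Sum>j\<in>?J. M None i j * (cnj (c (hi i)) * c (hi j)))"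
      using pos[unfolded coeff_positive_def, THEN conjunct1, rule_format, of "\<lambda>i. c (hi i)"] by (simp only:)
    also have "\<dots> = (\<Sum>i<n. \<Sum>j<n. ?M None i j * (cnj (c i) * c j))"
      unfolding re by (intro sum.cong refl) (simp add: hih)
    finally show ?thesis .
  qed
  have M1: "\<forall>i<n. c i = 0" if z: "(\<Sum>i<n. \<Sum>j<n. ?M None i j * (cnj (c i) * c j)) = 0" for c
  proof -
    have "(\<Sum>i\<in>?J. \<Sum>j\<in>?J. M None i j * (cnj (c (hi i)) * c (hi j))) = (\<Sum>i<n. \<Sum>j<n. ?M None i j * (cnj (c i) * c j))"
      unfolding re by (intro sum.cong refl) (simp add: hih)
    also note z
    finally have "\<forall>i\<in>?J. c (hi i) = 0" by (rule strict)
    then show ?thesis using hJ hih by metis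
  qed
  obtain l \<gamma> :: "nat \<Rightarrow> nat \<Rightarrow> complex" where
    l: "\<And>i j. i < n \<Longrightarrow> j < n \<Longrightarrow> ?M None i j = (\<Sum>k<n. cnj (l i k) * l j k)" and
    \<gamma>l: "\<And>i j. i < n \<Longrightarrow> j < n \<Longrightarrow> (\<Sum>k<n. \<gamma> i k * l j k) = (if i = j then 1 else 0)" and
    l\<gamma>: "\<And>k k'. k < n \<Longrightarrow> k' < n \<Longrightarrow> (\<Sum>j<n. l j k * \<gamma> j k') = (if k = k' then 1 else 0)"
    by (rule strictly_positive_factorization[of "?M None" n, OF M0 M1]) (assumption | rule that; assumption)+
  define X where "X g = mat n n (\<lambda>(p, q). \<Sum>i<n. \<Sum>j<n. cnj (\<gamma> i p) * \<gamma> j q * ?M (Some (Some g)) i j)" for g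
  have X: "hermitian_tuple n X"
    unfolding hermitian_tuple_def
  proof (intro allI conjI mat_adjointI[of _ n])
    fix g i j assume ij: "i < n" "j < n"
    have "cnj (X g $$ (i, j)) = (\<Sum>i'<n. \<Sum>j'<n. cnj (\<gamma> j' j) * \<gamma> i' i * ?M (Some (Some g)) j' i')"
      using ij by (simp add: X_def M_herm[OF hJ hJ, symmetric] mult_ac)
    also have "\<dots> = X g $$ (j, i)" using ij unfolding X_def by (subst sum.swap) simp
    finally show "cnj (X g $$ (i, j)) = X g $$ (j, i)" .
  qed (simp_all add: X_def)
  have sym: "word_entry n X (symbol_word \<sigma>) p q = (\<Sum>i<n. \<Sum>j<n. cnj (\<gamma> i p) * \<gamma> j q * ?M \<sigma> i j)"
    if pq: "p < n" "q < n" for \<sigma> p q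
  proof -
    have unit: "(\<Sum>i<n. \<Sum>j<n. cnj (\<gamma> i p) * \<gamma> j q * ?M None i j) = (if p = q then 1 else 0)"
    proof -
      have "(\<Sum>i<n. \<Sum>j<n. cnj (\<gamma> i p) * \<gamma> j q * ?M None i j)
        = (\<Sum>i<n. \<Sum>j<n. \<Sum>k<n. cnj (l i k * \<gamma> i p) * (l j k * \<gamma> j q))"
        by (intro sum.cong refl) (simp add: l sum_distrib_left mult_ac)
      also have "\<dots> = (\<Sum>k<n. \<Sum>i<n. \<Sum>j<n. cnj (l i k * \<gamma> i p) * (l j k * \<gamma> j q))" by (rule sum_swap3)
      also have "\<dots> = (\<Sum>k<n. cnj (\<Sum>i<n. l i k * \<gamma> i p) * (\<Sum>j<n. l j k * \<gamma> j q))" by (simp only: cnj_sum sum_product)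
      also have "\<dots> = (\<Sum>k<n. if k = p then (if p = q then 1 else 0) else 0)"
        by (intro sum.cong refl) (use pq in \<open>auto simp: l\<gamma>\<close>)
      finally show ?thesis using pq by simp
    qed
    consider "\<sigma> = None" | "\<sigma> = Some None" | g where "\<sigma> = Some (Some g)" by (metis option.exhaust)
    then show ?thesis
    proof cases
      case 1
      then show ?thesis using unit pq by (simp add: word_entry_Nil)
    next
      case 2
      moreover have "?M (Some None) = ?M None" by (simp add: M_def)
      ultimately show ?thesis using unit pq by (simp add: word_entry_Nil M_def)
    next
      case 3
      then show ?thesis using pq by (simp add: word_entry_singleton[OF X] X_def)
    qed
  qed
  have act: "(\<Sum>q<n. word_entry n X (symbol_word \<sigma>) p q * l j q) = (\<Sum>i<n. cnj (\<gamma> i p) * ?M \<sigma> i j)"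
    if pj: "p < n" "j < n" for \<sigma> p j
  proof -
    have "(\<Sum>q<n. word_entry n X (symbol_word \<sigma>) p q * l j q)
      = (\<Sum>q<n. \<Sum>i<n. \<Sum>j'<n. cnj (\<gamma> i p) * ?M \<sigma> i j' * (\<gamma> j' q * l j q))"
      by (intro sum.cong refl) (simp add: sym pj sum_distrib_right sum_distrib_left mult_ac)
    also have "\<dots> = (\<Sum>i<n. \<Sum>j'<n. \<Sum>q<n. cnj (\<gamma> i p) * ?M \<sigma> i j' * (\<gamma> j' q * l j q))"
      by (rule sum_swap3[symmetric])
    also have "\<dots> = (\<Sum>i<n. \<Sum>j'<n. if j' = j then cnj (\<gamma> i p) * ?M \<sigma> i j else 0)"
    proof (intro sum.cong refl)
      fix i j' assume "j' \<in> {..<n}"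
      then have "(\<Sum>q<n. \<gamma> j' q * l j q) = (if j' = j then 1 else 0)" using \<gamma>l pj by simp
      then show "(\<Sum>q<n. cnj (\<gamma> i p) * ?M \<sigma> i j' * (\<gamma> j' q * l j q)) = (if j' = j then cnj (\<gamma> i p) * ?M \<sigma> i j else 0)"
        by (simp flip: sum_distrib_left)
    qed
    finally show ?thesis using pj by simp
  qed
  have form: "(\<Sum>p<n. \<Sum>q<n. cnj (l i p) * word_entry n X (symbol_word \<sigma>) p q * l j q) = ?M \<sigma> i j"
    if ij: "i < n" "j < n" for \<sigma> i j
  proof -
    have "(\<Sum>p<n. \<Sum>q<n. cnj (l i p) * word_entry n X (symbol_word \<sigma>) p q * l j q)
      = (\<Sum>p<n. cnj (l i p) * (\<Sum>i'<n. cnj (\<gamma> i' p) * ?M \<sigma> i' j))"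
      by (intro sum.cong refl) (simp add: act[symmetric] ij sum_distrib_left mult.assoc)
    also have "\<dots> = (\<Sum>i'<n. cnj (\<Sum>p<n. \<gamma> i' p * l i p) * ?M \<sigma> i' j)"
      by (simp add: sum_distrib_left sum_distrib_right mult_ac) (rule sum.swap)
    also have "\<dots> = (\<Sum>i'<n. if i' = i then ?M \<sigma> i j else 0)"
      by (intro sum.cong refl) (use ij in \<open>simp add: \<gamma>l\<close>)
    finally show ?thesis using ij by simp
  qed
  define v where "v w b = l (hi (w, b))" for w b
  \<comment> \<open>Below the top degree the matrix \<open>X g\<close> acts as left multiplication by the letter \<open>g\<close>.\<close>
  have step: "(\<Sum>q<n. X g $$ (p, q) * v w b q) = v (g # w) b p"
    if w: "g # w \<in> words_upto d" and b: "b < m" and p: "p < n" for g w b p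
  proof -
    have w': "(w, b) \<in> ?J" "(g # w, b) \<in> ?J" using w b by (auto simp: words_upto_def)
    let ?j = "hi (w, b)" and ?j' = "hi (g # w, b)"
    have "(\<Sum>q<n. X g $$ (p, q) * v w b q) = (\<Sum>q<n. word_entry n X (symbol_word (Some (Some g))) p q * l ?j q)"
      by (intro sum.cong refl) (simp add: v_def word_entry_singleton[OF X] p)
    also have "\<dots> = (\<Sum>i<n. cnj (\<gamma> i p) * ?M (Some (Some g)) i ?j)"
      by (rule act) (use hi w' p in auto)
    also have "\<dots> = (\<Sum>i<n. cnj (\<gamma> i p) * ?M None i ?j')"
      by (simp add: M_def hi(2)[OF w'(1)] hi(2)[OF w'(2)])
    also have "\<dots> = (\<Sum>q<n. word_entry n X (symbol_word None) p q * l ?j' q)"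
      by (rule act[symmetric]) (use hi w' p in auto)
    also have "\<dots> = (\<Sum>q<n. if q = p then l ?j' q else 0)"
      by (intro sum.cong refl) (use p in \<open>auto simp: word_entry_Nil\<close>)
    finally show ?thesis using p by (simp add: v_def)
  qed
  have word: "(\<Sum>q<n. word_entry n X w p q * v [] b q) = v w b p"
    if "w \<in> words_upto d" "b < m" "p < n" for w b p
    using that
  proof (induction w arbitrary: p)
    case Nil
    have "(\<Sum>q<n. word_entry n X [] p q * v [] b q) = (\<Sum>q<n. if q = p then v [] b q else 0)"
      by (intro sum.cong refl) (use Nil in \<open>auto simp: word_entry_Nil\<close>)
    then show ?case using Nil by simp
  next
    case (Cons g w)
    have w: "w \<in> words_upto d" using Cons.prems by (simp add: words_upto_def)
    have "(\<Sum>q<n. word_entry n X (g # w) p q * v [] b q) = (\<Sum>q<n. \<Sum>r<n. X g $$ (p, r) * (word_entry n X w r q * v [] b q))"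
      by (intro sum.cong refl) (simp add: word_entry_Cons[OF X] Cons.prems sum_distrib_right mult.assoc)
    also have "\<dots> = (\<Sum>r<n. X g $$ (p, r) * (\<Sum>q<n. word_entry n X w r q * v [] b q))"
      by (subst sum.swap) (simp add: sum_distrib_left)
    also have "\<dots> = (\<Sum>r<n. X g $$ (p, r) * v w b r)"
      by (intro sum.cong refl) (simp add: Cons.IH w Cons.prems)
    also have "\<dots> = v (g # w) b p" using Cons.prems by (intro step)
    finally show ?case .
  qed
  have rep: "(\<Sum>i<n. \<Sum>k<n. cnj (v [] a i) * word_entry n X u i k * v [] b k) = y u a b"
    if u: "u \<in> words_upto (2 * d + 1)" and a: "a < m" and b: "b < m" for u a b
  proof -
    obtain v' \<sigma> w where s: "v' \<in> words_upto d" "w \<in> words_upto d" "u = rev v' @ symbol_word \<sigma> @ w"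
      by (rule split_word_upto[OF u])
    have "(\<Sum>i<n. \<Sum>k<n. cnj (v [] a i) * word_entry n X u i k * v [] b k)
      = (\<Sum>i<n. \<Sum>k<n. \<Sum>p<n. \<Sum>q<n. cnj (word_entry n X v' p i * v [] a i) * word_entry n X (symbol_word \<sigma>) p q * (word_entry n X w q k * v [] b k))"
      unfolding s(3) by (intro sum.cong refl) (simp add: word_entry_split[OF X] sum_distrib_left sum_distrib_right mult_ac)
    also have "\<dots> = (\<Sum>p<n. \<Sum>q<n. \<Sum>i<n. \<Sum>k<n. cnj (word_entry n X v' p i * v [] a i) * word_entry n X (symbol_word \<sigma>) p q * (word_entry n X w q k * v [] b k))"
      by (rule sum_swap4)
    also have "\<dots> = (\<Sum>p<n. \<Sum>q<n. cnj (\<Sum>i<n. word_entry n X v' p i * v [] a i) * word_entry n X (symbol_word \<sigma>) p q * (\<Sum>k<n. word_entry n X w q k * v [] b k))"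
      unfolding cnj_sum sum_distrib_right sum_distrib_left
      by (rule sum.cong[OF refl], rule sum.cong[OF refl], rule sum.swap)
    also have "\<dots> = (\<Sum>p<n. \<Sum>q<n. cnj (v v' a p) * word_entry n X (symbol_word \<sigma>) p q * v w b q)"
      by (intro sum.cong refl) (simp add: word s a b)
    also have "\<dots> = ?M \<sigma> (hi (v', a)) (hi (w, b))"
      unfolding v_def by (rule form) (use s a b hi in auto)
    also have "\<dots> = y u a b"
      using hi(2)[of "(v', a)"] hi(2)[of "(w, b)"] s a b by (simp add: M_def)
    finally show ?thesis .
  qed
  have "coeff_positive A {..<n} (\<lambda>\<sigma> p q. \<Sum>i\<in>?J. \<Sum>j\<in>?J. cnj (\<gamma> (hi i) p) * \<gamma> (hi j) q * M \<sigma> i j)"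
    by (rule coeff_positive_compress[OF pos])
  from this[unfolded coeff_positive_def, THEN conjunct2, rule_format]
  have "0 \<le> (\<Sum>p<n. \<Sum>q<n. \<Sum>s\<in>UNIV. (\<Sum>i\<in>?J. \<Sum>j\<in>?J. cnj (\<gamma> (hi i) p) * \<gamma> (hi j) q * M (Some s) i j)
      * cinner (k p) (pencil_op A s (k q)))" for k
    by (simp only:)
  moreover have "(\<Sum>p<n. \<Sum>q<n. \<Sum>s\<in>UNIV. (\<Sum>i\<in>?J. \<Sum>j\<in>?J. cnj (\<gamma> (hi i) p) * \<gamma> (hi j) q * M (Some s) i j)
      * cinner (k p) (pencil_op A s (k q)))
    = (\<Sum>p<n. \<Sum>q<n. \<Sum>s\<in>UNIV. word_entry n X (symbol_word (Some s)) p q * cinner (k p) (pencil_op A s (k q)))" for k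
  proof (intro sum.cong refl)
    fix p q s assume "p \<in> {..<n}" "q \<in> {..<n}"
    then have pq: "p < n" "q < n" by auto
    have "(\<Sum>i\<in>?J. \<Sum>j\<in>?J. cnj (\<gamma> (hi i) p) * \<gamma> (hi j) q * M (Some s) i j) = word_entry n X (symbol_word (Some s)) p q"
      unfolding sym[OF pq] re by (intro sum.cong refl) (simp add: hih)
    then show "(\<Sum>i\<in>?J. \<Sum>j\<in>?J. cnj (\<gamma> (hi i) p) * \<gamma> (hi j) q * M (Some s) i j) * cinner (k p) (pencil_op A s (k q))
      = word_entry n X (symbol_word (Some s)) p q * cinner (k p) (pencil_op A s (k q))" by simp
  qed
  ultimately have "psd (opoly_eval n X (pencil 1 A))" unfolding psd_pencil_iff[OF X] by simp
  with X show ?thesis by (rule that[of n X "\<lambda>b. v [] b"]) (rule rep)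
qed

section \<open>Finite compressions\<close>

lemma compact_function_box:
  fixes b :: "'a \<Rightarrow> real"
  shows "compact {z :: 'a \<Rightarrow> complex. \<forall>x. cmod (z x) \<le> b x}"
proof -
  have "compactin (product_topology (\<lambda>_. euclidean) UNIV) (PiE UNIV (\<lambda>x. cball (0::complex) (b x)))"
    by (subst compactin_PiE) auto
  then have "compact (PiE UNIV (\<lambda>x. cball (0::complex) (b x)))"
    by (simp only: euclidean_product_topology compactin_euclidean_iff)
  also have "PiE UNIV (\<lambda>x. cball (0::complex) (b x)) = {z. \<forall>x. cmod (z x) \<le> b x}"
    by (auto simp: PiE_def Pi_def)
  finally show ?thesis .
qed

lemma continuous_gram_coeff:
  "continuous_on UNIV (\<lambda>z. gram_coeff d (\<lambda>\<sigma> i j. z (\<sigma>, i, j)) u a b)"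
  unfolding gram_coeff_def
proof (intro continuous_on_sum)
  fix v w \<sigma>
  show "continuous_on UNIV (\<lambda>z. if rev v @ symbol_word \<sigma> @ w = u then z (\<sigma>, (v, a), w, b) else (0::complex))"
    by (cases "rev v @ symbol_word \<sigma> @ w = u") (simp_all add: continuous_on_product_coordinates)
qed

lemma gram_coeff_add:
  "gram_coeff d (\<lambda>\<sigma> i j. Z \<sigma> i j + Z' \<sigma> i j) u a b = gram_coeff d Z u a b + gram_coeff d Z' u a b"
  unfolding gram_coeff_def sum.distrib[symmetric] by (intro sum.cong refl) simp

lemma gram_coeff_scale:
  "gram_coeff d (\<lambda>\<sigma> i j. t * Z \<sigma> i j) u a b = t * gram_coeff d Z u a b"
  unfolding gram_coeff_def sum_distrib_left by (intro sum.cong refl) simp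

lemma gram_coeff_cong:
  assumes "\<And>\<sigma> v w. v \<in> words_upto d \<Longrightarrow> w \<in> words_upto d \<Longrightarrow> Z \<sigma> (v, a) (w, b) = Z' \<sigma> (v, a) (w, b)"
  shows "gram_coeff d Z u a b = gram_coeff d Z' u a b"
  unfolding gram_coeff_def by (intro sum.cong refl) (simp add: assms)

lemma gram_coeff_hermitian:
  fixes Z :: "'g::finite option option \<Rightarrow> 'g list \<times> nat \<Rightarrow> 'g list \<times> nat \<Rightarrow> complex"
  assumes "\<And>\<sigma> i j. Z \<sigma> j i = cnj (Z \<sigma> i j)"
  shows "gram_coeff d Z (rev u) b a = cnj (gram_coeff d Z u a b)"
proof -
  have eq: "rev v @ symbol_word \<sigma> @ w = rev u \<longleftrightarrow> rev w @ symbol_word \<sigma> @ v = u" for v w \<sigma>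
  proof -
    have "rev (rev v @ symbol_word \<sigma> @ w) = rev w @ symbol_word \<sigma> @ v"
      by (cases \<sigma> rule: symbol_word.cases) auto
    then show ?thesis by (metis rev_rev_ident)
  qed
  have "cnj (gram_coeff d Z u a b) = (\<Sum>v\<in>words_upto d. \<Sum>w\<in>words_upto d. \<Sum>\<sigma>\<in>UNIV.
     if rev v @ symbol_word \<sigma> @ w = u then Z \<sigma> (w, b) (v, a) else 0)"
    unfolding gram_coeff_def cnj_sum
    by (intro sum.cong refl) (simp add: assms[of _ "(_, b)" "(_, a)"])
  also have "\<dots> = (\<Sum>w\<in>words_upto d. \<Sum>v\<in>words_upto d. \<Sum>\<sigma>\<in>UNIV.
     if rev v @ symbol_word \<sigma> @ w = u then Z \<sigma> (w, b) (v, a) else 0)" by (rule sum.swap)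
  also have "\<dots> = gram_coeff d Z (rev u) b a" unfolding gram_coeff_def eq by (rule refl)
  finally show ?thesis by simp
qed

lemma trace_bound_at:
  fixes A :: "'g::finite \<Rightarrow> 'k::complex_hilbert_space bop"
  assumes pos: "strictly_positive_moments A d \<tau> \<kappa>"
    and Z: "dual_positive A Z"
  shows "\<kappa> * (\<Sum>w\<in>words_upto d. Re (Z None (w, a) (w, a)) + Re (Z (Some None) (w, a) (w, a)))
    \<le> Re (\<Sum>u\<in>words_upto (2 * d + 1). \<tau> u * gram_coeff d Z u a a)"
proof -
  define c where "c b = (if b = a then 1 else 0 :: complex)" for b
  have c: "(\<Sum>a'<Suc a. \<Sum>b<Suc a. F a' b * (cnj (c a') * c b)) = F a a" for F :: "nat \<Rightarrow> nat \<Rightarrow> complex"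
  proof -
    have "(\<Sum>a'<Suc a. \<Sum>b<Suc a. F a' b * (cnj (c a') * c b)) = (\<Sum>a'<Suc a. if a' = a then (\<Sum>b<Suc a. if b = a then F a' b else 0) else 0)"
      by (rule sum.cong[OF refl]) (auto simp: c_def intro!: sum.cong)
    then show ?thesis by (simp add: sum.delta)
  qed
  have "0 \<le> (\<Sum>u\<in>words_upto (2 * d + 1). \<Sum>a'<Suc a. \<Sum>b<Suc a. \<tau> u * (cnj (c a') * c b) * gram_coeff d Z u a' b)
    - complex_of_real \<kappa> * (\<Sum>w\<in>words_upto d. \<Sum>a'<Suc a. \<Sum>b<Suc a. cnj (c a') * c b * (Z None (w, a') (w, b) + Z (Some None) (w, a') (w, b)))"
    by (rule trace_bound[OF pos Z])
  also have "(\<Sum>u\<in>words_upto (2 * d + 1). \<Sum>a'<Suc a. \<Sum>b<Suc a. \<tau> u * (cnj (c a') * c b) * gram_coeff d Z u a' b)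
    = (\<Sum>u\<in>words_upto (2 * d + 1). \<tau> u * gram_coeff d Z u a a)"
    by (rule sum.cong[OF refl]) (subst c[symmetric], simp only: mult_ac)
  also have "(\<Sum>w\<in>words_upto d. \<Sum>a'<Suc a. \<Sum>b<Suc a. cnj (c a') * c b * (Z None (w, a') (w, b) + Z (Some None) (w, a') (w, b)))
    = (\<Sum>w\<in>words_upto d. Z None (w, a) (w, a) + Z (Some None) (w, a) (w, a))"
    by (rule sum.cong[OF refl]) (subst c[symmetric], simp only: mult_ac)
  finally show ?thesis by (simp add: zero_le_complex_iff)
qed

text \<open>
  A uniform bound on the entries of a dual positive kernel in terms of its coefficients
  \<open>gram_coeff\<close>; it yields compactness twice, in the minimisation and in the limit.
\<close>

lemma dual_positive_entry_bound:
  fixes A :: "'g::finite \<Rightarrow> 'k::complex_hilbert_space bop"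
  assumes sa: "\<And>g. self_adjoint (A g)"
    and pos: "strictly_positive_moments A d \<tau> \<kappa>" and \<kappa>: "\<kappa> > 0"
  shows "\<exists>C>0. \<forall>Z R \<sigma> i j. dual_positive A Z \<longrightarrow> fst i \<in> words_upto d \<longrightarrow> fst j \<in> words_upto d \<longrightarrow>
    (\<forall>u\<in>words_upto (2 * d + 1). \<forall>a\<in>{snd i, snd j}. cmod (gram_coeff d Z u a a) \<le> R) \<longrightarrow>
    cmod (Z \<sigma> i j) \<le> C * R"
proof -
  obtain C where C: "1 \<le> C" "\<And>s x. norm (pencil_op A s x) \<le> C * norm x"
    by (rule pencil_coeff_bound[of A]) (rule that; assumption)
  define T where "T = (\<Sum>u\<in>words_upto (2 * d + 1). cmod (\<tau> u)) + 1"
  have T: "T > 0" by (simp add: T_def add_nonneg_pos sum_nonneg)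
  note entry = dual_positive_entry[OF _ sa C(2) C(1)]
  have diag: "Re (Z None i i) + Re (Z (Some None) i i) \<le> T * R / \<kappa>"
    if Z: "dual_positive A Z" and i: "fst i \<in> words_upto d" and R: "\<And>u. u \<in> words_upto (2 * d + 1) \<Longrightarrow> cmod (gram_coeff d Z u (snd i) (snd i)) \<le> R"
    for Z i R
  proof -
    let ?a = "snd i"
    have "cmod (gram_coeff d Z [] ?a ?a) \<le> R" by (rule R) (simp add: words_upto_def)
    then have R0: "0 \<le> R" by (rule order_trans[OF norm_ge_zero])
    have "\<kappa> * (Re (Z None i i) + Re (Z (Some None) i i))
      \<le> \<kappa> * (\<Sum>w\<in>words_upto d. Re (Z None (w, ?a) (w, ?a)) + Re (Z (Some None) (w, ?a) (w, ?a)))"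
    proof (rule mult_left_mono)
      have "(\<lambda>w. Re (Z None (w, ?a) (w, ?a)) + Re (Z (Some None) (w, ?a) (w, ?a))) (fst i)
        \<le> (\<Sum>w\<in>words_upto d. Re (Z None (w, ?a) (w, ?a)) + Re (Z (Some None) (w, ?a) (w, ?a)))"
        by (rule member_le_sum[OF i]) (auto intro!: add_nonneg_nonneg entry(3,4)[OF Z])
      then show "Re (Z None i i) + Re (Z (Some None) i i) \<le> (\<Sum>w\<in>words_upto d. Re (Z None (w, ?a) (w, ?a)) + Re (Z (Some None) (w, ?a) (w, ?a)))"
        by simp
    qed (use \<kappa> in simp)
    also have "\<dots> \<le> Re (\<Sum>u\<in>words_upto (2 * d + 1). \<tau> u * gram_coeff d Z u ?a ?a)"
      by (rule trace_bound_at[OF pos Z])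
    also have "\<dots> \<le> cmod (\<Sum>u\<in>words_upto (2 * d + 1). \<tau> u * gram_coeff d Z u ?a ?a)" by (rule complex_Re_le_cmod)
    also have "\<dots> \<le> (\<Sum>u\<in>words_upto (2 * d + 1). cmod (\<tau> u) * R)"
      by (intro sum_norm_le) (simp add: norm_mult R mult_left_mono)
    also have "\<dots> \<le> T * R" using R0 by (simp add: T_def distrib_right sum_distrib_right)
    finally show ?thesis using \<kappa> by (simp add: field_simps)
  qed
  show ?thesis
  proof (intro exI[of _ "C * (2 * T / \<kappa>)"] conjI allI impI)
    show "0 < C * (2 * T / \<kappa>)" using C(1) T \<kappa> by (intro mult_pos_pos divide_pos_pos) auto
    fix Z :: "'g option option \<Rightarrow> 'g list \<times> nat \<Rightarrow> 'g list \<times> nat \<Rightarrow> complex" and R \<sigma> and i j :: "'g list \<times> nat"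
    assume Z: "dual_positive A Z" and i: "fst i \<in> words_upto d" and j: "fst j \<in> words_upto d"
      and R: "\<forall>u\<in>words_upto (2 * d + 1). \<forall>a\<in>{snd i, snd j}. cmod (gram_coeff d Z u a a) \<le> R"
    have "cmod (Z \<sigma> i j) \<le> C * (Re (Z None i i) + Re (Z (Some None) i i) + Re (Z None j j) + Re (Z (Some None) j j))"
      by (rule entry(1)[OF Z])
    also have "\<dots> \<le> C * (T * R / \<kappa> + T * R / \<kappa>)"
    proof (rule mult_left_mono)
      have "Re (Z None i i) + Re (Z (Some None) i i) \<le> T * R / \<kappa>" by (rule diag[OF Z i]) (use R in auto)
      moreover have "Re (Z None j j) + Re (Z (Some None) j j) \<le> T * R / \<kappa>" by (rule diag[OF Z j]) (use R in auto)
      ultimately show "Re (Z None i i) + Re (Z (Some None) i i) + Re (Z None j j) + Re (Z (Some None) j j)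
        \<le> T * R / \<kappa> + T * R / \<kappa>" by linarith
    qed (use C(1) in simp)
    finally show "cmod (Z \<sigma> i j) \<le> C * (2 * T / \<kappa>) * R" by (simp add: field_simps)
  qed
qed

lemma quadratic_nonneg_imp_linear_nonneg:
  fixes a b :: real
  assumes "\<And>t. 0 < t \<Longrightarrow> t < 1 \<Longrightarrow> 0 \<le> 2 * a * t + b * t\<^sup>2"
  shows "0 \<le> a"
proof (rule ccontr)
  assume "\<not> 0 \<le> a"
  define t where "t = min (1 / 2) (- a / (\<bar>b\<bar> + 1))"
  have a: "a < 0" using \<open>\<not> 0 \<le> a\<close> by simp
  have t: "0 < t" "t < 1" using a by (auto simp: t_def min_def divide_neg_pos field_simps)
  have "b * t \<le> \<bar>b\<bar> * (- a / (\<bar>b\<bar> + 1))"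
    using t by (intro mult_mono) (auto simp: t_def)
  also have "\<dots> \<le> - a" using a by (simp add: field_simps)
  finally have "2 * a + b * t < 0" using a by simp
  then have "t * (2 * a + b * t) < 0" using t by (simp add: mult_pos_neg)
  then have "2 * a * t + b * t\<^sup>2 < 0" by (simp add: power2_eq_square algebra_simps)
  with assms[OF t] show False by simp
qed

lemma hermitian_sum_real:
  assumes "\<And>i j. i \<in> J \<Longrightarrow> j \<in> J \<Longrightarrow> M j i = cnj (M i j)"
  shows "Im (\<Sum>i\<in>J. \<Sum>j\<in>J. M i j * (cnj (c i) * c j)) = 0"
proof -
  let ?F = "\<Sum>i\<in>J. \<Sum>j\<in>J. M i j * (cnj (c i) * c j)"
  have "cnj ?F = (\<Sum>i\<in>J. \<Sum>j\<in>J. M j i * (cnj (c j) * c i))"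
    unfolding cnj_sum
  proof (intro sum.cong refl)
    fix i j assume "i \<in> J" "j \<in> J"
    from assms[OF this] show "cnj (M i j * (cnj (c i) * c j)) = M j i * (cnj (c j) * c i)"
      by (simp add: mult_ac)
  qed
  also have "\<dots> = ?F" by (rule sum.swap)
  finally have "cnj ?F = ?F" .
  moreover have "Im z = 0" if "cnj z = z" for z using that by (simp add: complex_eq_iff)
  ultimately show ?thesis by blast
qed

text \<open>
  The finite-dimensional case. Take the element of the closed cone of certificates nearest to \<open>f\<close>.
  If it is not \<open>f\<close>, the residual defines a functional that is nonnegative on the cone and negative
  at \<open>f\<close>. Adding a small multiple of the strictly positive moments makes it strictly positive
  on squares, and the truncated GNS construction turns it into matrices violating the hypothesis.
\<close>

lemma finite_certificate:
  fixes A :: "'g::finite \<Rightarrow> 'k::complex_hilbert_space bop" and f :: "'g list \<Rightarrow> nat \<Rightarrow> nat \<Rightarrow> complex"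
  assumes sa: "\<And>g. self_adjoint (A g)"
    and fherm: "\<And>u a b. u \<in> words_upto (2 * d + 1) \<Longrightarrow> f (rev u) b a = cnj (f u a b)"
    and fpos: "\<And>n (X :: 'g \<Rightarrow> complex mat) \<xi>. hermitian_tuple n X \<Longrightarrow> psd (opoly_eval n X (pencil 1 A)) \<Longrightarrow>
      0 \<le> Re (\<Sum>u\<in>words_upto (2 * d + 1). \<Sum>a<m. \<Sum>b<m.
        (\<Sum>i<n. \<Sum>k<n. cnj (\<xi> a i) * word_entry n X u i k * \<xi> b k) * f u a b)"
  shows "\<exists>Z. dual_positive A Z \<and> (\<forall>u\<in>words_upto (2 * d + 1). \<forall>a<m. \<forall>b<m. gram_coeff d Z u a b = f u a b)"
proof -
  let ?U = "words_upto (2 * d + 1) :: 'g list set" and ?J = "words_upto d \<times> {..<m} :: ('g list \<times> nat) set"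
  obtain \<tau> :: "'g list \<Rightarrow> complex" and \<kappa> :: real where
    \<kappa>: "\<kappa> > 0" and \<tau>: "\<And>u. \<tau> (rev u) = cnj (\<tau> u)" and
    pos: "strictly_positive_moments A d \<tau> \<kappa>"
    by (rule ex_strictly_positive_moments[of A d, OF sa]) (assumption | rule that; assumption)+
  obtain C where C: "C > 0" "\<forall>Z R \<sigma> i j. dual_positive A Z \<longrightarrow> fst i \<in> words_upto d \<longrightarrow> fst j \<in> words_upto d \<longrightarrow>
    (\<forall>u\<in>words_upto (2 * d + 1). \<forall>a\<in>{snd i, snd j}. cmod (gram_coeff d Z u a a) \<le> R) \<longrightarrow>
    cmod (Z \<sigma> i j) \<le> C * R"
    using dual_positive_entry_bound[of A d \<tau> \<kappa>, OF sa pos \<kappa>] by (elim exE conjE) (rule that)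
  define cur where "cur z = (\<lambda>\<sigma> i j. z (\<sigma>, i, j))"
    for z :: "'g option option \<times> ('g list \<times> nat) \<times> ('g list \<times> nat) \<Rightarrow> complex"
  define G where "G z u a b = gram_coeff d (cur z) u a b" for z u a b
  define D where "D z = (\<Sum>u\<in>?U. \<Sum>a<m. \<Sum>b<m. (cmod (G z u a b - f u a b))\<^sup>2)" for z
  \<comment> \<open>The cone of Gram data for the first \<open>m\<close> basis vectors, and the squared distance to \<open>f\<close>.\<close>
  define \<C> where "\<C> = {z. dual_positive A (cur z) \<and> (\<forall>\<sigma> i j. i \<notin> ?J \<or> j \<notin> ?J \<longrightarrow> z (\<sigma>, i, j) = 0)}"
  have G_lin: "G (\<lambda>x. z x + complex_of_real t * z' x) u a b = G z u a b + complex_of_real t * G z' u a b" for z z' t u a b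
    by (simp add: G_def cur_def gram_coeff_add gram_coeff_scale)
  have C_lin: "(\<lambda>x. z x + complex_of_real t * z' x) \<in> \<C>" if "z \<in> \<C>" "z' \<in> \<C>" "0 \<le> t" for z z' t
    using that dual_positive_add[OF _ dual_positive_scale[of A "cur z'" t], of "cur z"]
    by (simp add: \<C>_def cur_def)
  have C_0: "(\<lambda>_. 0) \<in> \<C>" by (simp add: \<C>_def cur_def dual_positive_zero)
  have D_term: "(cmod (G z u a b - f u a b))\<^sup>2 \<le> D z" if "u \<in> ?U" "a < m" "b < m" for z u a b
  proof -
    have "(cmod (G z u a b - f u a b))\<^sup>2 \<le> (\<Sum>b<m. (cmod (G z u a b - f u a b))\<^sup>2)"
      using that by (intro member_le_sum[of b _ "\<lambda>b. (cmod (G z u a b - f u a b))\<^sup>2"]) auto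
    also have "\<dots> \<le> (\<Sum>a<m. \<Sum>b<m. (cmod (G z u a b - f u a b))\<^sup>2)"
      using that by (intro member_le_sum[of a _ "\<lambda>a. \<Sum>b<m. (cmod (G z u a b - f u a b))\<^sup>2"]) (auto intro: sum_nonneg)
    also have "\<dots> \<le> D z"
      unfolding D_def using that by (intro member_le_sum[of u _ "\<lambda>u. \<Sum>a<m. \<Sum>b<m. (cmod (G z u a b - f u a b))\<^sup>2"]) (auto intro!: sum_nonneg)
    finally show ?thesis .
  qed
  define R where "R = sqrt (D (\<lambda>_. 0)) + (\<Sum>u\<in>?U. \<Sum>a<m. cmod (f u a a))"
  define K where "K = \<C> \<inter> {z. \<forall>x. cmod (z x) \<le> C * R}"
  have D_nonneg: "0 \<le> D z" for z unfolding D_def by (intro sum_nonneg) auto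
  have R: "0 \<le> R" unfolding R_def using D_nonneg by (intro add_nonneg_nonneg sum_nonneg) auto
  have K_I: "z \<in> K" if z: "z \<in> \<C>" and le: "D z \<le> D (\<lambda>_. 0)" for z
  proof -
    have Gb: "cmod (G z u a a) \<le> R" if u: "u \<in> ?U" and a: "a < m" for u a
    proof -
      have "cmod (G z u a a - f u a a) \<le> sqrt (D (\<lambda>_. 0))"
        using D_term[OF u a a, of z] le by (intro real_le_rsqrt) auto
      moreover have "cmod (f u a a) \<le> (\<Sum>a<m. cmod (f u a a))"
        using a by (intro member_le_sum[of a _ "\<lambda>a. cmod (f u a a)"]) auto
      moreover have "(\<Sum>a<m. cmod (f u a a)) \<le> (\<Sum>u\<in>?U. \<Sum>a<m. cmod (f u a a))"
        using u by (intro member_le_sum[of u _ "\<lambda>u. \<Sum>a<m. cmod (f u a a)"]) (auto intro: sum_nonneg)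
      moreover have "cmod (G z u a a) \<le> cmod (G z u a a - f u a a) + cmod (f u a a)"
        by (metis diff_add_cancel norm_triangle_ineq)
      ultimately show ?thesis unfolding R_def by linarith
    qed
    have "cmod (z (\<sigma>, i, j)) \<le> C * R" for \<sigma> i j
    proof (cases "i \<in> ?J \<and> j \<in> ?J")
      case True
      have "cmod (cur z \<sigma> i j) \<le> C * R"
      proof (rule C(2)[rule_format])
        show "dual_positive A (cur z)" using z by (simp add: \<C>_def)
        show "cmod (gram_coeff d (cur z) u a a) \<le> R" if "u \<in> ?U" "a \<in> {snd i, snd j}" for u a
          using Gb[OF that(1), of a] that(2) True by (auto simp: G_def)
      qed (use True in auto)
      then show ?thesis by (simp add: cur_def)
    next
      case False
      then have "z (\<sigma>, i, j) = 0" using z unfolding \<C>_def by blast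
      then show ?thesis using C(1) R by simp
    qed
    then show ?thesis using z by (auto simp: K_def)
  qed
  have "compact K"
  proof -
    have "closed {z. dual_positive A (cur z)}" using closed_dual_positive[of A] by (simp add: cur_def)
    moreover have "closed {z :: 'g option option \<times> ('g list \<times> nat) \<times> ('g list \<times> nat) \<Rightarrow> complex. \<forall>\<sigma> i j. i \<notin> ?J \<or> j \<notin> ?J \<longrightarrow> z (\<sigma>, i, j) = 0}"
    proof (intro closed_Collect_all)
      fix \<sigma> and i j :: "'g list \<times> nat"
      have "closed {z :: 'g option option \<times> ('g list \<times> nat) \<times> ('g list \<times> nat) \<Rightarrow> complex. z (\<sigma>, i, j) = 0}"
        by (intro closed_Collect_eq continuous_on_product_coordinates continuous_on_const)
      then show "closed {z :: 'g option option \<times> ('g list \<times> nat) \<times> ('g list \<times> nat) \<Rightarrow> complex. i \<notin> ?J \<or> j \<notin> ?J \<longrightarrow> z (\<sigma>, i, j) = 0}"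
        by (cases "i \<notin> ?J \<or> j \<notin> ?J") auto
    qed
    ultimately have "closed \<C>" unfolding \<C>_def Collect_conj_eq by (rule closed_Int)
    then show ?thesis unfolding K_def by (intro closed_Int_compact compact_function_box)
  qed
  moreover have "K \<noteq> {}" using K_I[OF C_0] by auto
  moreover have "continuous_on K D"
  proof -
    have "continuous_on UNIV (\<lambda>z. G z u a b)" for u a b
      unfolding G_def cur_def by (rule continuous_gram_coeff)
    then have "continuous_on UNIV D" unfolding D_def by (intro continuous_intros)
    then show ?thesis by (rule continuous_on_subset) simp
  qed
  ultimately obtain z0 where z0: "z0 \<in> K" "\<And>z. z \<in> K \<Longrightarrow> D z0 \<le> D z"
    using continuous_attains_inf[of K D] by auto
  have z0C: "z0 \<in> \<C>" using z0(1) by (simp add: K_def)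
  have min: "D z0 \<le> D z" if "z \<in> \<C>" for z
  proof (cases "D z \<le> D (\<lambda>_. 0)")
    case True
    then show ?thesis using K_I[OF that] z0(2) by blast
  next
    case False
    then show ?thesis using z0(2)[OF K_I[OF C_0]] by simp
  qed
  show ?thesis
  proof (cases "D z0 = 0")
    case True
    have "G z0 u a b = f u a b" if "u \<in> ?U" "a < m" "b < m" for u a b
      using D_term[OF that, of z0] True by simp
    then show ?thesis using z0C by (intro exI[of _ "cur z0"]) (auto simp: \<C>_def G_def)
  next
    case False
    then have S: "D z0 > 0" using D_nonneg[of z0] by simp
    define r where "r u a b = G z0 u a b - f u a b" for u a b
    define ip where "ip g = Re (\<Sum>u\<in>?U. \<Sum>a<m. \<Sum>b<m. cnj (r u a b) * g u a b)" for g :: "'g list \<Rightarrow> nat \<Rightarrow> nat \<Rightarrow> complex"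
    have expand: "(\<Sum>u\<in>?U. \<Sum>a<m. \<Sum>b<m. (cmod (r u a b + complex_of_real t * g u a b))\<^sup>2)
      = D z0 + 2 * ip g * t + (\<Sum>u\<in>?U. \<Sum>a<m. \<Sum>b<m. (cmod (g u a b))\<^sup>2) * t\<^sup>2" for t g
    proof -
      have sq: "(cmod (x + complex_of_real t * y))\<^sup>2 = (cmod x)\<^sup>2 + 2 * t * Re (cnj x * y) + t\<^sup>2 * (cmod y)\<^sup>2" for x y
        unfolding cmod_power2 by (simp add: power2_eq_square algebra_simps)
      have D0: "D z0 = (\<Sum>u\<in>?U. \<Sum>a<m. \<Sum>b<m. (cmod (r u a b))\<^sup>2)" by (simp only: D_def r_def)
      have "(\<Sum>u\<in>?U. \<Sum>a<m. \<Sum>b<m. (cmod (r u a b + complex_of_real t * g u a b))\<^sup>2)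
        = D z0 + 2 * t * ip g + t\<^sup>2 * (\<Sum>u\<in>?U. \<Sum>a<m. \<Sum>b<m. (cmod (g u a b))\<^sup>2)"
        unfolding ip_def Re_sum D0 sq by (simp only: sum_distrib_left sum.distrib)
      then show ?thesis by (simp only: mult.commute mult.left_commute)
    qed
    \<comment> \<open>First-order optimality of \<open>z0\<close>, in the directions of the cone and along its own ray.\<close>
    have var: "0 \<le> ip (G z)" if z: "z \<in> \<C>" for z
    proof (rule quadratic_nonneg_imp_linear_nonneg)
      fix t :: real assume t: "0 < t" "t < 1"
      have "D z0 \<le> D (\<lambda>x. z0 x + complex_of_real t * z x)"
        using t by (intro min C_lin z0C z) simp
      also have "\<dots> = (\<Sum>u\<in>?U. \<Sum>a<m. \<Sum>b<m. (cmod (r u a b + complex_of_real t * G z u a b))\<^sup>2)"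
        unfolding D_def G_lin r_def by (simp add: algebra_simps)
      finally show "0 \<le> 2 * ip (G z) * t + (\<Sum>u\<in>?U. \<Sum>a<m. \<Sum>b<m. (cmod (G z u a b))\<^sup>2) * t\<^sup>2"
        unfolding expand by simp
    qed
    have "0 \<le> - ip (G z0)"
    proof (rule quadratic_nonneg_imp_linear_nonneg)
      fix t :: real assume t: "0 < t" "t < 1"
      have eq: "(\<lambda>x. 0 + complex_of_real (1 - t) * z0 x) = (\<lambda>x. z0 x + complex_of_real (- t) * z0 x)"
        by (simp add: algebra_simps)
      have "(\<lambda>x. 0 + complex_of_real (1 - t) * z0 x) \<in> \<C>"
        using t by (intro C_lin C_0 z0C) simp
      then have "D z0 \<le> D (\<lambda>x. z0 x + complex_of_real (- t) * z0 x)" unfolding eq by (rule min)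
      also have "\<dots> = (\<Sum>u\<in>?U. \<Sum>a<m. \<Sum>b<m. (cmod (r u a b + complex_of_real (- t) * G z0 u a b))\<^sup>2)"
        unfolding D_def G_lin r_def by (simp add: algebra_simps)
      finally show "0 \<le> 2 * (- ip (G z0)) * t + (\<Sum>u\<in>?U. \<Sum>a<m. \<Sum>b<m. (cmod (G z0 u a b))\<^sup>2) * t\<^sup>2"
        unfolding expand by simp
    qed
    moreover have "ip f = ip (G z0) - D z0"
    proof -
      have sq: "Re (cnj x * x) = (cmod x)\<^sup>2" for x
        unfolding cmod_power2 by (simp add: power2_eq_square)
      have rr: "cnj (r u a b) * r u a b = cnj (r u a b) * G z0 u a b - cnj (r u a b) * f u a b" for u a b
        by (simp add: r_def[of u a b] algebra_simps)
      have "D z0 = (\<Sum>u\<in>?U. \<Sum>a<m. \<Sum>b<m. Re (cnj (r u a b) * r u a b))"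
        by (simp only: D_def r_def sq)
      also have "\<dots> = ip (G z0) - ip f"
        unfolding ip_def rr by (simp only: Re_sum minus_complex.sel sum_subtractf)
      finally show ?thesis by simp
    qed
    ultimately have ipf: "ip f \<le> - D z0" by simp
    define T where "T = Re (\<Sum>u\<in>?U. \<Sum>a<m. \<tau> u * f u a a)"
    \<comment> \<open>The perturbation by \<open>\<epsilon> \<tau>\<close> must not spoil the sign at \<open>f\<close>.\<close>
    define N where "N = \<bar>T\<bar> + 1"
    have N: "N > 0" "T \<le> N" by (simp_all add: N_def add_nonneg_pos)
    define \<epsilon> where "\<epsilon> = D z0 / (2 * N)"
    have \<epsilon>: "\<epsilon> > 0" using S N by (simp add: \<epsilon>_def)
    have "\<epsilon> * T \<le> \<epsilon> * N" using \<epsilon> N by (intro mult_left_mono) auto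
    also have "\<dots> = D z0 / 2" using N by (simp add: \<epsilon>_def)
    finally have \<epsilon>T: "\<epsilon> * T < D z0" using S by simp
    define y where "y u a b = cnj (r u a b) + complex_of_real \<epsilon> * (if a = b then \<tau> u else 0)" for u a b
    have y_pair: "Re (\<Sum>u\<in>?U. \<Sum>a<m. \<Sum>b<m. y u a b * g u a b) = ip g + \<epsilon> * Re (\<Sum>u\<in>?U. \<Sum>a<m. \<tau> u * g u a a)" for g
    proof -
      have "(\<Sum>b<m. y u a b * g u a b) = (\<Sum>b<m. cnj (r u a b) * g u a b) + complex_of_real \<epsilon> * (\<tau> u * g u a a)" if "a < m" for u a
      proof -
        have "(\<Sum>b<m. y u a b * g u a b) = (\<Sum>b<m. cnj (r u a b) * g u a b) + (\<Sum>b<m. if b = a then complex_of_real \<epsilon> * (\<tau> u * g u a a) else 0)"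
          unfolding sum.distrib[symmetric] by (intro sum.cong refl) (simp add: y_def algebra_simps)
        then show ?thesis using that by simp
      qed
      then have "(\<Sum>u\<in>?U. \<Sum>a<m. \<Sum>b<m. y u a b * g u a b) = (\<Sum>u\<in>?U. \<Sum>a<m. \<Sum>b<m. cnj (r u a b) * g u a b)
        + complex_of_real \<epsilon> * (\<Sum>u\<in>?U. \<Sum>a<m. \<tau> u * g u a a)"
        by (simp add: sum.distrib sum_distrib_left)
      then show ?thesis by (simp add: ip_def)
    qed
    have y_f: "Re (\<Sum>u\<in>?U. \<Sum>a<m. \<Sum>b<m. y u a b * f u a b) < 0"
      unfolding y_pair using ipf \<epsilon>T by (simp add: T_def)
    let ?M = "\<lambda>\<sigma> i j. y (rev (fst i) @ symbol_word \<sigma> @ fst j) (snd i) (snd j)"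
    have y_Z: "\<epsilon> * \<kappa> * (\<Sum>i\<in>?J. Re (z (None, i, i)) + Re (z (Some None, i, i))) \<le> Re (\<Sum>i\<in>?J. \<Sum>j\<in>?J. \<Sum>\<sigma>\<in>UNIV. ?M \<sigma> i j * z (\<sigma>, i, j))"
      if z: "z \<in> \<C>" for z
    proof -
      have "dual_positive A (cur z)" using z by (simp add: \<C>_def)
      note tb = trace_bound_at[OF pos this]
      have "\<kappa> * (\<Sum>i\<in>?J. Re (z (None, i, i)) + Re (z (Some None, i, i)))
        = (\<Sum>a<m. \<kappa> * (\<Sum>w\<in>words_upto d. Re (cur z None (w, a) (w, a)) + Re (cur z (Some None) (w, a) (w, a))))"
        unfolding sum.cartesian_product' cur_def sum_distrib_left by (rule sum.swap)
      also have "\<dots> \<le> (\<Sum>a<m. Re (\<Sum>u\<in>?U. \<tau> u * G z u a a))"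
        unfolding G_def by (intro sum_mono tb)
      also have "\<dots> = Re (\<Sum>u\<in>?U. \<Sum>a<m. \<tau> u * G z u a a)"
        by (subst sum.swap) simp
      finally have "\<epsilon> * (\<kappa> * (\<Sum>i\<in>?J. Re (z (None, i, i)) + Re (z (Some None, i, i)))) \<le> \<epsilon> * Re (\<Sum>u\<in>?U. \<Sum>a<m. \<tau> u * G z u a a)"
        using \<epsilon> by (intro mult_left_mono) auto
      also have "\<dots> \<le> Re (\<Sum>u\<in>?U. \<Sum>a<m. \<Sum>b<m. y u a b * G z u a b)"
        unfolding y_pair using var[OF z] by simp
      also have "(\<Sum>u\<in>?U. \<Sum>a<m. \<Sum>b<m. y u a b * G z u a b) = (\<Sum>i\<in>?J. \<Sum>j\<in>?J. \<Sum>\<sigma>\<in>UNIV. ?M \<sigma> i j * cur z \<sigma> i j)"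
        unfolding G_def by (rule gram_coeff_pairing)
      finally show ?thesis by (simp add: cur_def mult.assoc)
    qed
    have y_herm: "y (rev u) b a = cnj (y u a b)" if "u \<in> ?U" for u a b
    proof -
      have "dual_positive A (cur z0)" using z0C by (simp add: \<C>_def)
      obtain C where C: "1 \<le> C" "\<And>s x. norm (pencil_op A s x) \<le> C * norm x"
        by (rule pencil_coeff_bound[of A]) (rule that; assumption)
      have "G z0 (rev u) b a = cnj (G z0 u a b)"
        unfolding G_def
        by (rule gram_coeff_hermitian) (rule dual_positive_entry(2)[OF \<open>dual_positive A (cur z0)\<close> sa C(2,1)])
      then show ?thesis by (simp add: y_def r_def fherm[OF that] \<tau>)
    qed
    have M_herm: "?M \<sigma> j i = cnj (?M \<sigma> i j)" if "i \<in> ?J" "j \<in> ?J" for \<sigma> i j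
    proof -
      have "rev (symbol_word \<sigma>) = symbol_word \<sigma>" by (cases \<sigma> rule: symbol_word.cases) auto
      then have "?M \<sigma> j i = y (rev (rev (fst i) @ symbol_word \<sigma> @ fst j)) (snd j) (snd i)" by simp
      also have "\<dots> = cnj (?M \<sigma> i j)"
        using that by (intro y_herm word_split_in_words_upto) auto
      finally show ?thesis .
    qed
    have atom: "\<epsilon> * \<kappa> * (\<Sum>i\<in>?J. (cmod (c i))\<^sup>2 + (norm (k i))\<^sup>2)
      \<le> Re (\<Sum>i\<in>?J. \<Sum>j\<in>?J. ?M None i j * (cnj (c i) * c j))
       + Re (\<Sum>i\<in>?J. \<Sum>j\<in>?J. \<Sum>s\<in>UNIV. ?M (Some s) i j * cinner (k i) (pencil_op A s (k j)))"
      for c and k :: "_ \<Rightarrow> 'k"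
    proof -
      define Z where "Z = atom_kernel A (\<lambda>i. if i \<in> ?J then c i else 0) (\<lambda>i. if i \<in> ?J then k i else 0)"
      define z where "z = (\<lambda>(\<sigma>, i, j). Z \<sigma> i j)"
      have "Z \<sigma> i j = 0" if "i \<notin> ?J \<or> j \<notin> ?J" for \<sigma> i j
        using that unfolding Z_def by (cases \<sigma>) (auto simp: cinner.zero_left cinner.zero_right)
      then have zC: "z \<in> \<C>" by (auto simp: \<C>_def cur_def z_def Z_def dual_positive_atom)
      have Zc: "Z \<sigma> i j = atom_kernel A c k \<sigma> i j" if "i \<in> ?J" "j \<in> ?J" for \<sigma> i j
        using that unfolding Z_def by (cases \<sigma>) auto
      have "(\<Sum>i\<in>?J. (cmod (c i))\<^sup>2 + (norm (k i))\<^sup>2) = (\<Sum>i\<in>?J. Re (z (None, i, i)) + Re (z (Some None, i, i)))"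
      proof (intro sum.cong refl)
        fix i assume i: "i \<in> ?J"
        have "Re (z (None, i, i)) = (cmod (c i))\<^sup>2"
          unfolding cmod_power2 by (simp add: z_def Zc[OF i i] power2_eq_square)
        moreover have "Re (z (Some None, i, i)) = (norm (k i))\<^sup>2"
          by (simp add: z_def Zc[OF i i] cinner_self)
        ultimately show "(cmod (c i))\<^sup>2 + (norm (k i))\<^sup>2 = Re (z (None, i, i)) + Re (z (Some None, i, i))" by simp
      qed
      moreover have "(\<Sum>i\<in>?J. \<Sum>j\<in>?J. \<Sum>\<sigma>\<in>UNIV. ?M \<sigma> i j * z (\<sigma>, i, j)) = (\<Sum>i\<in>?J. \<Sum>j\<in>?J. \<Sum>\<sigma>\<in>UNIV. ?M \<sigma> i j * atom_kernel A c k \<sigma> i j)"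
        by (intro sum.cong refl) (simp add: z_def Zc)
      ultimately show ?thesis using y_Z[OF zC] unfolding sum_atom_kernel by simp
    qed
    have M_None: "0 \<le> (\<Sum>i\<in>?J. \<Sum>j\<in>?J. ?M None i j * (cnj (c i) * c j))"
      "\<epsilon> * \<kappa> * (\<Sum>i\<in>?J. (cmod (c i))\<^sup>2) \<le> Re (\<Sum>i\<in>?J. \<Sum>j\<in>?J. ?M None i j * (cnj (c i) * c j))" for c
    proof -
      show 1: "\<epsilon> * \<kappa> * (\<Sum>i\<in>?J. (cmod (c i))\<^sup>2) \<le> Re (\<Sum>i\<in>?J. \<Sum>j\<in>?J. ?M None i j * (cnj (c i) * c j))"
        using atom[of c "\<lambda>_. 0"] by (simp add: cinner.zero_right)
      have "0 \<le> \<epsilon> * \<kappa> * (\<Sum>i\<in>?J. (cmod (c i))\<^sup>2)"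
        using \<epsilon> \<kappa> by (intro mult_nonneg_nonneg sum_nonneg) auto
      with 1 show "0 \<le> (\<Sum>i\<in>?J. \<Sum>j\<in>?J. ?M None i j * (cnj (c i) * c j))"
        unfolding zero_le_complex_iff using hermitian_sum_real[of ?J "?M None" c, OF M_herm] by linarith
    qed
    have M_Some: "0 \<le> (\<Sum>i\<in>?J. \<Sum>j\<in>?J. \<Sum>s\<in>UNIV. ?M (Some s) i j * cinner (k i) (pencil_op A s (k j)))"
      for k :: "_ \<Rightarrow> 'k"
    proof -
      have "0 \<le> \<epsilon> * \<kappa> * (\<Sum>i\<in>?J. (norm (k i))\<^sup>2)"
        using \<epsilon> \<kappa> by (intro mult_nonneg_nonneg sum_nonneg) auto
      also have "\<dots> \<le> Re (\<Sum>i\<in>?J. \<Sum>j\<in>?J. \<Sum>s\<in>UNIV. ?M (Some s) i j * cinner (k i) (pencil_op A s (k j)))"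
        using atom[of "\<lambda>_. 0" k] by simp
      finally show ?thesis
        unfolding zero_le_complex_iff using hermitian_form_real[of A ?J "\<lambda>s. ?M (Some s)" k, OF sa M_herm] by blast
    qed
    have Mpos: "coeff_positive A ?J ?M"
      unfolding coeff_positive_def using M_None(1) M_Some by blast
    have strict: "\<forall>i\<in>?J. c i = 0" if "(\<Sum>i\<in>?J. \<Sum>j\<in>?J. ?M None i j * (cnj (c i) * c j)) = 0" for c
    proof -
      have "\<epsilon> * \<kappa> * (\<Sum>i\<in>?J. (cmod (c i))\<^sup>2) \<le> 0" using M_None(2)[of c] unfolding that by simp
      then have "(\<Sum>i\<in>?J. (cmod (c i))\<^sup>2) \<le> 0" using \<epsilon> \<kappa> by (simp add: mult_le_0_iff not_le[symmetric] zero_less_mult_iff)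
      then have "(\<Sum>i\<in>?J. (cmod (c i))\<^sup>2) = 0" by (intro antisym sum_nonneg) auto
      then show ?thesis by (subst (asm) sum_nonneg_eq_0_iff) auto
    qed
    obtain n and X :: "'g \<Rightarrow> complex mat" and \<xi> where
      X: "hermitian_tuple n X" "psd (opoly_eval n X (pencil 1 A))" and
      rep: "\<And>u a b. u \<in> ?U \<Longrightarrow> a < m \<Longrightarrow> b < m \<Longrightarrow>
        (\<Sum>i<n. \<Sum>k<n. cnj (\<xi> a i) * word_entry n X u i k * \<xi> b k) = y u a b"
      by (rule truncated_GNS[of d m y A, OF y_herm Mpos strict]) (assumption | rule that; assumption)+
    have "(\<Sum>u\<in>?U. \<Sum>a<m. \<Sum>b<m. (\<Sum>i<n. \<Sum>k<n. cnj (\<xi> a i) * word_entry n X u i k * \<xi> b k) * f u a b)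
      = (\<Sum>u\<in>?U. \<Sum>a<m. \<Sum>b<m. y u a b * f u a b)"
      by (intro sum.cong refl) (simp add: rep)
    then show ?thesis using fpos[OF X, of \<xi>] y_f by simp
  qed
qed

section \<open>The limit of the compressions\<close>

text \<open>
  Passing to infinitely many basis vectors: the certificates of the finite compressions lie in a
  product of discs, where the nested closed sets have a common point by Tychonoff's theorem.
\<close>

lemma infinite_certificate:
  fixes A :: "'g::finite \<Rightarrow> 'k::complex_hilbert_space bop" and f :: "'g list \<Rightarrow> nat \<Rightarrow> nat \<Rightarrow> complex"
  assumes sa: "\<And>g. self_adjoint (A g)"
    and fherm: "\<And>u a b. u \<in> words_upto (2 * d + 1) \<Longrightarrow> f (rev u) b a = cnj (f u a b)"
    and fpos: "\<And>n m (X :: 'g \<Rightarrow> complex mat) \<xi>. hermitian_tuple n X \<Longrightarrow> psd (opoly_eval n X (pencil 1 A)) \<Longrightarrow>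
      0 \<le> Re (\<Sum>u\<in>words_upto (2 * d + 1). \<Sum>a<m. \<Sum>b<m.
        (\<Sum>i<n. \<Sum>k<n. cnj (\<xi> a i) * word_entry n X u i k * \<xi> b k) * f u a b)"
    and fbound: "\<And>u a. u \<in> words_upto (2 * d + 1) \<Longrightarrow> cmod (f u a a) \<le> R"
  shows "\<exists>Z. dual_positive A Z \<and> (\<forall>u\<in>words_upto (2 * d + 1). \<forall>a b. gram_coeff d Z u a b = f u a b)"
proof -
  let ?U = "words_upto (2 * d + 1) :: 'g list set"
  obtain \<tau> :: "'g list \<Rightarrow> complex" and \<kappa> :: real where
    \<kappa>: "\<kappa> > 0" and \<tau>: "\<And>u. \<tau> (rev u) = cnj (\<tau> u)" and
    pos: "strictly_positive_moments A d \<tau> \<kappa>"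
    by (rule ex_strictly_positive_moments[of A d, OF sa]) (assumption | rule that; assumption)+
  obtain C where C: "C > 0" "\<forall>Z R \<sigma> i j. dual_positive A Z \<longrightarrow> fst i \<in> words_upto d \<longrightarrow> fst j \<in> words_upto d \<longrightarrow>
    (\<forall>u\<in>words_upto (2 * d + 1). \<forall>a\<in>{snd i, snd j}. cmod (gram_coeff d Z u a a) \<le> R) \<longrightarrow>
    cmod (Z \<sigma> i j) \<le> C * R"
    using dual_positive_entry_bound[of A d \<tau> \<kappa>, OF sa pos \<kappa>] by (elim exE conjE) (rule that)
  define cur where "cur z = (\<lambda>\<sigma> i j. z (\<sigma>, i, j))"
    for z :: "'g option option \<times> ('g list \<times> nat) \<times> ('g list \<times> nat) \<Rightarrow> complex"
  define B where "B = {z :: 'g option option \<times> ('g list \<times> nat) \<times> ('g list \<times> nat) \<Rightarrow> complex. \<forall>x. cmod (z x) \<le> C * R}"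
  define E where "E m = {z. dual_positive A (cur z) \<and> (\<forall>u\<in>?U. \<forall>a<m. \<forall>b<m. gram_coeff d (cur z) u a b = f u a b)}" for m :: nat
  have R: "0 \<le> R" using fbound[of "[]" 0] by (rule order_trans[OF norm_ge_zero]) (simp add: words_upto_def)
  have B: "compact B" unfolding B_def by (rule compact_function_box)
  have closed_E: "closed (E m)" for m
  proof -
    have "closed {z. gram_coeff d (cur z) u a b = f u a b}" for u a b
      unfolding cur_def by (intro closed_Collect_eq continuous_gram_coeff continuous_on_const)
    then have "closed (\<Inter>u\<in>?U. \<Inter>a\<in>{..<m}. \<Inter>b\<in>{..<m}. {z. gram_coeff d (cur z) u a b = f u a b})"
      by (intro closed_INT ballI)
    moreover have "closed {z. dual_positive A (cur z)}" using closed_dual_positive[of A] by (simp add: cur_def)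
    ultimately have "closed ({z. dual_positive A (cur z)} \<inter> (\<Inter>u\<in>?U. \<Inter>a\<in>{..<m}. \<Inter>b\<in>{..<m}. {z. gram_coeff d (cur z) u a b = f u a b}))"
      by (intro closed_Int)
    also have "\<dots> = E m" by (auto simp: E_def)
    finally show ?thesis .
  qed
  have nonempty: "B \<inter> E m \<noteq> {}" for m
  proof -
    obtain Z where Z: "dual_positive A Z" "\<forall>u\<in>?U. \<forall>a<m. \<forall>b<m. gram_coeff d Z u a b = f u a b"
      using finite_certificate[of A d f m, OF sa fherm fpos] by blast
    let ?J = "words_upto d \<times> {..<m} :: ('g list \<times> nat) set"
    define z where "z = (\<lambda>(\<sigma>, i, j). if i \<in> ?J \<and> j \<in> ?J then Z \<sigma> i j else 0)"
    have cz: "cur z = (\<lambda>\<sigma> i j. if i \<in> ?J \<and> j \<in> ?J then Z \<sigma> i j else 0)" by (simp add: cur_def z_def)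
    have g: "gram_coeff d (cur z) u a b = f u a b" if "u \<in> ?U" "a < m" "b < m" for u a b
    proof -
      have "gram_coeff d (cur z) u a b = gram_coeff d Z u a b"
        by (rule gram_coeff_cong) (use that in \<open>simp add: cz\<close>)
      then show ?thesis using Z(2) that by simp
    qed
    have dz: "dual_positive A (cur z)" unfolding cz by (rule dual_positive_restrict[OF Z(1)])
    have "cmod (z (\<sigma>, i, j)) \<le> C * R" for \<sigma> i j
    proof (cases "i \<in> ?J \<and> j \<in> ?J")
      case True
      have "cmod (cur z \<sigma> i j) \<le> C * R"
      proof (rule C(2)[rule_format])
        show "dual_positive A (cur z)" by (rule dz)
        show "cmod (gram_coeff d (cur z) u a a) \<le> R" if "u \<in> ?U" "a \<in> {snd i, snd j}" for u a
        proof -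
          have "a < m" using that(2) True by auto
          then show ?thesis using g[OF that(1), of a a] fbound[OF that(1), of a] by simp
        qed
      qed (use True in auto)
      then show ?thesis by (simp add: cur_def)
    next
      case False
      then have "z (\<sigma>, i, j) = 0" unfolding z_def split by (rule if_not_P)
      then show ?thesis using C(1) R by simp
    qed
    then have "z \<in> B \<inter> E m" using g dz by (auto simp: B_def E_def)
    then show ?thesis by blast
  qed
  have mono: "E m \<subseteq> E m'" if "m' \<le> m" for m m'
    using that unfolding E_def by (auto dest: less_le_trans)
  have "B \<inter> \<Inter> (range E) \<noteq> {}"
  proof (rule compact_imp_fip[OF B])
    show "closed T" if "T \<in> range E" for T using that closed_E by auto
    fix F assume F: "finite F" "F \<subseteq> range E"
    then obtain N where N: "finite N" "F = E ` N" by (metis finite_subset_image)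
    have "E (Max (insert 0 N)) \<subseteq> \<Inter> F"
    proof (rule Inter_greatest)
      fix T assume "T \<in> F"
      then obtain k where k: "k \<in> N" "T = E k" using N by blast
      have "k \<le> Max (insert 0 N)" by (rule Max_ge) (use k N in auto)
      then show "E (Max (insert 0 N)) \<subseteq> T" unfolding k(2) by (rule mono)
    qed
    then show "B \<inter> \<Inter> F \<noteq> {}" using nonempty[of "Max (insert 0 N)"] by blast
  qed
  then obtain z where z: "\<And>m. z \<in> E m" by auto
  have "gram_coeff d (cur z) u a b = f u a b" if "u \<in> ?U" for u a b
  proof -
    have "a < Suc (max a b)" "b < Suc (max a b)" by auto
    then show ?thesis using z[of "Suc (max a b)"] that unfolding E_def by blast
  qed
  moreover have "dual_positive A (cur z)" using z[of 0] by (simp add: E_def)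
  ultimately show ?thesis by (intro exI[of _ "cur z"]) simp
qed

section \<open>From Gram data to operators\<close>

text \<open>
  The direct sum with copies of the vector state of \<open>k0\<close>, one for each \<open>k \<in> V\<close>. It prescribes the
  completely positive map on the basis vectors orthogonal to the range of \<open>q\<close>, where the Gram data say
  nothing.
\<close>

fun state_extension ::
    "('g::finite \<Rightarrow> 'k::complex_hilbert_space bop) \<Rightarrow> 'k \<Rightarrow> nat set \<Rightarrow> ('g option option \<Rightarrow> 'i \<Rightarrow> 'i \<Rightarrow> complex) \<Rightarrow>
      'g option option \<Rightarrow> 'i + nat \<Rightarrow> 'i + nat \<Rightarrow> complex" where
  "state_extension A k0 V Z \<sigma> (Inl i) (Inl j) = Z \<sigma> i j"
| "state_extension A k0 V Z \<sigma> (Inr k) (Inr l) =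
     (if k = l \<and> k \<in> V then atom_kernel A (\<lambda>_. 0) (\<lambda>_. k0) \<sigma> () () else 0)"
| "state_extension A k0 V Z \<sigma> (Inl i) (Inr l) = 0"
| "state_extension A k0 V Z \<sigma> (Inr k) (Inl j) = 0"

lemma dual_positive_state_extension:
  fixes A :: "'g::finite \<Rightarrow> 'k::complex_hilbert_space bop" and Z :: "'g option option \<Rightarrow> 'i \<Rightarrow> 'i \<Rightarrow> complex"
  assumes Z: "dual_positive A Z"
  shows "dual_positive A (state_extension A k0 V Z)"
  unfolding dual_positive_def
proof (intro allI impI)
  fix J :: "('i + nat) set" and t assume J: "finite J" and t: "coeff_positive A J t"
  define J1 where "J1 = Inl -` J"
  define J2 where "J2 = Inr -` J \<inter> V"
  have fin: "finite J1" "finite J2" unfolding J1_def J2_def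
    using finite_vimageI[OF J, of Inl] finite_vimageI[OF J, of Inr] by auto
  define Z1 where "Z1 \<sigma> x y = (case (x, y) of (Inl i, Inl j) \<Rightarrow> Z \<sigma> i j | _ \<Rightarrow> 0)" for \<sigma> and x y :: "'i + nat"
  define a where "a k = atom_kernel A (\<lambda>_. 0) (\<lambda>x :: 'i + nat. if x = Inr k then k0 else 0)" for k :: nat
  have split: "state_extension A k0 V Z \<sigma> x y = Z1 \<sigma> x y + (\<Sum>k\<in>J2. a k \<sigma> x y)" if xy: "x \<in> J" "y \<in> J" for \<sigma> x y
  proof (cases x)
    case (Inl i)
    then show ?thesis by (cases y; cases \<sigma>) (auto simp: Z1_def a_def cinner.zero_left)
  next
    case (Inr k)
    show ?thesis
    proof (cases y)
      case (Inl j)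
      then show ?thesis using Inr by (cases \<sigma>) (auto simp: Z1_def a_def cinner.zero_right)
    next
      case inr: (Inr l)
      have "(\<Sum>k'\<in>J2. a k' \<sigma> x y) = (\<Sum>k'\<in>J2. if k' = k then (if k = l then atom_kernel A (\<lambda>_. 0) (\<lambda>_. k0) \<sigma> () () else 0) else 0)"
        by (rule sum.cong[OF refl], cases \<sigma>) (auto simp: a_def Inr inr cinner.zero_left cinner.zero_right)
      also have "\<dots> = state_extension A k0 V Z \<sigma> x y"
        using fin(2) xy by (auto simp: Inr inr J2_def)
      finally show ?thesis by (simp add: Z1_def Inr inr)
    qed
  qed
  have "(\<Sum>x\<in>J. \<Sum>y\<in>J. \<Sum>\<sigma>\<in>UNIV. t \<sigma> x y * state_extension A k0 V Z \<sigma> x y)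
    = (\<Sum>x\<in>J. \<Sum>y\<in>J. \<Sum>\<sigma>\<in>UNIV. t \<sigma> x y * Z1 \<sigma> x y)
     + (\<Sum>x\<in>J. \<Sum>y\<in>J. \<Sum>\<sigma>\<in>UNIV. \<Sum>k\<in>J2. t \<sigma> x y * a k \<sigma> x y)"
    unfolding sum.distrib[symmetric]
    by (intro sum.cong refl) (simp add: split distrib_left sum_distrib_left)
  also have "(\<Sum>x\<in>J. \<Sum>y\<in>J. \<Sum>\<sigma>\<in>UNIV. \<Sum>k\<in>J2. t \<sigma> x y * a k \<sigma> x y)
    = (\<Sum>x\<in>J. \<Sum>y\<in>J. \<Sum>k\<in>J2. \<Sum>\<sigma>\<in>UNIV. t \<sigma> x y * a k \<sigma> x y)"
    by (rule sum.cong[OF refl], rule sum.cong[OF refl], rule sum.swap)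
  also have "\<dots> = (\<Sum>k\<in>J2. \<Sum>x\<in>J. \<Sum>y\<in>J. \<Sum>\<sigma>\<in>UNIV. t \<sigma> x y * a k \<sigma> x y)" by (rule sum_swap3)
  finally have eq: "(\<Sum>x\<in>J. \<Sum>y\<in>J. \<Sum>\<sigma>\<in>UNIV. t \<sigma> x y * state_extension A k0 V Z \<sigma> x y)
    = (\<Sum>x\<in>J. \<Sum>y\<in>J. \<Sum>\<sigma>\<in>UNIV. t \<sigma> x y * Z1 \<sigma> x y) + (\<Sum>k\<in>J2. \<Sum>x\<in>J. \<Sum>y\<in>J. \<Sum>\<sigma>\<in>UNIV. t \<sigma> x y * a k \<sigma> x y)" .
  have 2: "0 \<le> (\<Sum>k\<in>J2. \<Sum>x\<in>J. \<Sum>y\<in>J. \<Sum>\<sigma>\<in>UNIV. t \<sigma> x y * a k \<sigma> x y)"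
    by (rule complex_zero_le_sum) (unfold a_def, rule dual_positiveD[OF dual_positive_atom J t])
  define \<alpha> where "\<alpha> x i = (if x = Inl i then 1 else 0 :: complex)" for x :: "'i + nat" and i
  define t' where "t' \<sigma> p q = (\<Sum>x\<in>J. \<Sum>y\<in>J. cnj (\<alpha> x p) * \<alpha> y q * t \<sigma> x y)" for \<sigma> and p q :: 'i
  have "coeff_positive A J1 t'" unfolding t'_def by (rule coeff_positive_compress[OF t])
  then have "0 \<le> (\<Sum>i\<in>J1. \<Sum>j\<in>J1. \<Sum>\<sigma>\<in>UNIV. t' \<sigma> i j * Z \<sigma> i j)"
    by (rule dual_positiveD[OF Z fin(1)])
  also have "\<dots> = (\<Sum>i\<in>J1. \<Sum>j\<in>J1. \<Sum>\<sigma>\<in>UNIV. t \<sigma> (Inl i) (Inl j) * Z1 \<sigma> (Inl i) (Inl j))"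
  proof (intro sum.cong refl)
    fix i j \<sigma> assume ij: "i \<in> J1" "j \<in> J1"
    have "t' \<sigma> i j = (\<Sum>x\<in>J. if x = Inl i then (\<Sum>y\<in>J. if y = Inl j then t \<sigma> x y else 0) else 0)"
      unfolding t'_def by (rule sum.cong[OF refl]) (auto simp: \<alpha>_def intro!: sum.cong)
    also have "\<dots> = t \<sigma> (Inl i) (Inl j)" using J ij by (simp add: J1_def)
    finally show "t' \<sigma> i j * Z \<sigma> i j = t \<sigma> (Inl i) (Inl j) * Z1 \<sigma> (Inl i) (Inl j)" by (simp add: Z1_def)
  qed
  also have "\<dots> = (\<Sum>x\<in>Inl ` J1. \<Sum>y\<in>Inl ` J1. \<Sum>\<sigma>\<in>UNIV. t \<sigma> x y * Z1 \<sigma> x y)"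
    by (simp add: sum.reindex)
  also have "\<dots> = (\<Sum>x\<in>J. \<Sum>y\<in>J. \<Sum>\<sigma>\<in>UNIV. t \<sigma> x y * Z1 \<sigma> x y)"
  proof (rule sum.mono_neutral_cong_left)
    have z: "Z1 \<sigma> x y = 0" if "x \<in> J" "y \<in> J" "x \<notin> Inl ` J1 \<or> y \<notin> Inl ` J1" for \<sigma> x y
      using that by (cases x; cases y) (auto simp: Z1_def J1_def)
    show "\<forall>x\<in>J - Inl ` J1. (\<Sum>y\<in>J. \<Sum>\<sigma>\<in>UNIV. t \<sigma> x y * Z1 \<sigma> x y) = 0" by (simp add: z)
    show "(\<Sum>y\<in>Inl ` J1. \<Sum>\<sigma>\<in>UNIV. t \<sigma> x y * Z1 \<sigma> x y) = (\<Sum>y\<in>J. \<Sum>\<sigma>\<in>UNIV. t \<sigma> x y * Z1 \<sigma> x y)" if "x \<in> Inl ` J1" for x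
      by (rule sum.mono_neutral_left) (use J that z in \<open>auto simp: J1_def\<close>)
  qed (use J in \<open>auto simp: J1_def\<close>)
  finally show "0 \<le> (\<Sum>x\<in>J. \<Sum>y\<in>J. \<Sum>\<sigma>\<in>UNIV. t \<sigma> x y * state_extension A k0 V Z \<sigma> x y)"
    unfolding eq using 2 by (rule complex_zero_le_add)
qed

lemma norm_lincomb_gram:
  fixes \<rho> :: "'i \<Rightarrow> 'h::complex_hilbert_space"
  assumes "\<And>i j. cinner (\<rho> i) (\<rho> j) = K i j"
  shows "(norm (\<Sum>i\<in>J. c i *\<^sub>C \<rho> i))\<^sup>2 = Re (\<Sum>i\<in>J. \<Sum>j\<in>J. cnj (c i) * c j * K i j)"
proof -
  have "complex_of_real ((norm (\<Sum>i\<in>J. c i *\<^sub>C \<rho> i))\<^sup>2) = (\<Sum>i\<in>J. \<Sum>j\<in>J. cnj (c i) * c j * K i j)"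
    unfolding cinner_self[symmetric] cinner_sum_sum
    by (intro sum.cong refl) (simp add: cinner_scaleC_left cinner_scaleC_right assms)
  from arg_cong[OF this, of Re] show ?thesis by simp
qed

lemma norm_le_from_squares:
  fixes x :: "'a::real_normed_vector" and y :: "'b::real_normed_vector"
  assumes "(norm x)\<^sup>2 \<le> M * (norm y)\<^sup>2" "0 \<le> M"
  shows "norm x \<le> sqrt M * norm y"
proof -
  have "(norm x)\<^sup>2 \<le> (sqrt M * norm y)\<^sup>2" using assms by (simp add: power_mult_distrib)
  then show ?thesis using assms(2) by (intro power2_le_imp_le[of "norm x"]) auto
qed

text \<open>
  Let \<open>C\<close> bound the norms of the coefficients and let \<open>S\<close> send \<open>\<rho> i\<close>, the Gram vectors of the unit
  component, to Gram vectors of the kernel \<open>C Z(1) + Z(A g)\<close>. Then \<open>S\<^sup>* S - C\<close> has the matrix entries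
  \<open>Z(A g)\<close>. Boundedness of \<open>S\<close> is the positivity of \<open>C Z(1) - Z(A g)\<close>.
\<close>

lemma realize_dual_kernel:
  fixes A :: "'g::finite \<Rightarrow> 'k::complex_hilbert_space bop" and \<rho> :: "'i::countable \<Rightarrow> 'h::complex_hilbert_space"
    and e :: "nat \<Rightarrow> 'h"
  assumes e: "orthonormal_basis e" and sa: "\<And>g. self_adjoint (A g)" and Z: "dual_positive A Z"
    and tot: "total_family \<rho>" and gram: "\<And>i j. cinner (\<rho> i) (\<rho> j) = Z (Some None) i j"
  shows "\<exists>T. \<forall>s i j. cinner (\<rho> i) (pencil_op T s (\<rho> j)) = Z (Some s) i j"
proof -
  obtain C where C: "1 \<le> C" "\<And>s x. norm (pencil_op A s x) \<le> C * norm x"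
    by (rule pencil_coeff_bound[of A]) (rule that; assumption)
  have "\<exists>T. \<forall>i j. cinner (\<rho> i) (apply_bop T (\<rho> j)) = Z (Some (Some g)) i j" for g
  proof -
    define K where "K \<delta> i j = complex_of_real C * Z (Some None) i j + complex_of_real \<delta> * Z (Some (Some g)) i j" for \<delta> i j
    have psd: "psd_kernel (K \<delta>)" if "\<bar>\<delta>\<bar> \<le> 1" for \<delta>
      using psd_kernel_dual_Some[OF Z sa C(2) that, of "Some g"] by (simp add: K_def[abs_def])
    have "psd_kernel (K 1)" by (rule psd) simp
    then obtain \<eta> :: "'i \<Rightarrow> 'h" where \<eta>: "\<And>i j. cinner (\<eta> i) (\<eta> j) = K 1 i j"
      by (rule kolmogorov_decomposition[OF e]) (rule that; assumption)
    have "norm (\<Sum>i\<in>J. c i *\<^sub>C \<eta> i) \<le> sqrt (2 * C) * norm (\<Sum>i\<in>J. c i *\<^sub>C \<rho> i)" if J: "finite J" for J c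
    proof (rule norm_le_from_squares)
      have "0 \<le> Re (\<Sum>i\<in>J. \<Sum>j\<in>J. cnj (c i) * c j * K (- 1) i j)"
        using psd_kernelD[OF psd[of "- 1"] J, of c] by (simp add: zero_le_complex_iff del: Re_sum)
      moreover have "(\<Sum>i\<in>J. \<Sum>j\<in>J. cnj (c i) * c j * K 1 i j) + (\<Sum>i\<in>J. \<Sum>j\<in>J. cnj (c i) * c j * K (- 1) i j)
        = complex_of_real (2 * C) * (\<Sum>i\<in>J. \<Sum>j\<in>J. cnj (c i) * c j * Z (Some None) i j)"
        unfolding sum.distrib[symmetric] sum_distrib_left by (intro sum.cong refl) (simp add: K_def algebra_simps)
      from arg_cong[OF this, of Re]
      have "Re (\<Sum>i\<in>J. \<Sum>j\<in>J. cnj (c i) * c j * K 1 i j) + Re (\<Sum>i\<in>J. \<Sum>j\<in>J. cnj (c i) * c j * K (- 1) i j)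
        = 2 * C * Re (\<Sum>i\<in>J. \<Sum>j\<in>J. cnj (c i) * c j * Z (Some None) i j)"
        by (simp only: plus_complex.sel times_complex.sel Re_complex_of_real Im_complex_of_real mult_zero_left diff_zero)
      ultimately show "(norm (\<Sum>i\<in>J. c i *\<^sub>C \<eta> i))\<^sup>2 \<le> 2 * C * (norm (\<Sum>i\<in>J. c i *\<^sub>C \<rho> i))\<^sup>2"
        unfolding norm_lincomb_gram[of \<eta>, OF \<eta>] norm_lincomb_gram[of \<rho>, OF gram] by linarith
    qed (use C(1) in simp)
    from bop_extension[OF tot this] obtain S where S: "\<And>i. apply_bop S (\<rho> i) = \<eta> i" by blast
    let ?T = "adj S * S - complex_of_real C *\<^sub>C 1"
    have "cinner (\<rho> i) (apply_bop ?T (\<rho> j)) = Z (Some (Some g)) i j" for i j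
      by (simp add: apply_minus_bop apply_times_bop apply_scaleC_bop cinner.diff_right cinner_adj_right
          cinner_scaleC_right S \<eta> gram K_def)
    then show ?thesis by blast
  qed
  then obtain T where T: "\<And>g i j. cinner (\<rho> i) (apply_bop (T g) (\<rho> j)) = Z (Some (Some g)) i j" by metis
  have "cinner (\<rho> i) (pencil_op T s (\<rho> j)) = Z (Some s) i j" for s i j
    by (cases s) (simp_all add: T gram)
  then show ?thesis by blast
qed

text \<open>
  On linear combinations of the total family \<open>\<rho>\<close> this is dual positivity of \<open>Z\<close>, tested with the
  compression of \<open>t\<close> by the coefficients; the general case follows by density.
\<close>

lemma realized_kernel_positive:
  fixes A :: "'g::finite \<Rightarrow> 'k::complex_hilbert_space bop" and \<rho> :: "'i \<Rightarrow> 'h::complex_hilbert_space"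
  assumes Z: "dual_positive A Z" and tot: "total_family \<rho>"
    and T: "\<And>s i j. cinner (\<rho> i) (pencil_op T s (\<rho> j)) = Z (Some s) i j"
    and t: "\<And>k :: nat \<Rightarrow> 'k. 0 \<le> (\<Sum>i<n. \<Sum>j<n. \<Sum>s\<in>UNIV. t s i j * cinner (k i) (pencil_op A s (k j)))"
  shows "0 \<le> (\<Sum>i<n. \<Sum>j<n. \<Sum>s\<in>UNIV. t s i j * cinner (h i) (pencil_op T s (h j)))"
proof -
  let ?T = "\<lambda>s. pencil_op T s"
  let ?\<Phi> = "\<lambda>h. \<Sum>i<n. \<Sum>j<n. \<Sum>s\<in>UNIV. t s i j * cinner (h i) (?T s (h j))"
  define t' where "t' \<sigma> i j = (case \<sigma> of None \<Rightarrow> 0 | Some s \<Rightarrow> t s i j)" for \<sigma> and i j :: nat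
  have t': "coeff_positive A {..<n} t'" unfolding coeff_positive_def using t by (simp add: t'_def)
  have fin: "0 \<le> ?\<Phi> (\<lambda>i. \<Sum>x\<in>F i. c i x *\<^sub>C \<rho> x)" if F: "\<And>i. finite (F i)" for F c
  proof -
    define N where "N = (\<Union>i<n. F i)"
    have N: "finite N" using F by (simp add: N_def)
    define \<alpha> where "\<alpha> i x = (if x \<in> F i then c i x else 0)" for i x
    have h: "(\<Sum>x\<in>F i. c i x *\<^sub>C \<rho> x) = (\<Sum>x\<in>N. \<alpha> i x *\<^sub>C \<rho> x)" if "i < n" for i
      by (rule sum.mono_neutral_cong_left) (use N that in \<open>auto simp: N_def \<alpha>_def\<close>)
    have "?\<Phi> (\<lambda>i. \<Sum>x\<in>F i. c i x *\<^sub>C \<rho> x) = (\<Sum>i<n. \<Sum>j<n. \<Sum>s\<in>UNIV. \<Sum>x\<in>N. \<Sum>y\<in>N. cnj (\<alpha> i x) * \<alpha> j y * t s i j * Z (Some s) x y)"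
    proof (intro sum.cong refl)
      fix i j s assume "i \<in> {..<n}" "j \<in> {..<n}"
      then have ij: "i < n" "j < n" by auto
      show "t s i j * cinner (\<Sum>x\<in>F i. c i x *\<^sub>C \<rho> x) (?T s (\<Sum>x\<in>F j. c j x *\<^sub>C \<rho> x))
        = (\<Sum>x\<in>N. \<Sum>y\<in>N. cnj (\<alpha> i x) * \<alpha> j y * t s i j * Z (Some s) x y)"
        unfolding h[OF ij(1)] h[OF ij(2)] apply_bop_sum cinner_sum_sum sum_distrib_left
        by (intro sum.cong refl) (simp add: apply_bop_scaleC cinner_scaleC_left cinner_scaleC_right T mult_ac)
    qed
    also have "\<dots> = (\<Sum>i<n. \<Sum>j<n. \<Sum>x\<in>N. \<Sum>y\<in>N. \<Sum>s\<in>UNIV. cnj (\<alpha> i x) * \<alpha> j y * t s i j * Z (Some s) x y)"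
      by (rule sum.cong[OF refl], rule sum.cong[OF refl], rule sum_swap3[symmetric])
    also have "\<dots> = (\<Sum>x\<in>N. \<Sum>y\<in>N. \<Sum>i<n. \<Sum>j<n. \<Sum>s\<in>UNIV. cnj (\<alpha> i x) * \<alpha> j y * t s i j * Z (Some s) x y)"
      by (rule sum_swap4)
    also have "\<dots> = (\<Sum>x\<in>N. \<Sum>y\<in>N. \<Sum>s\<in>UNIV. \<Sum>i<n. \<Sum>j<n. cnj (\<alpha> i x) * \<alpha> j y * t s i j * Z (Some s) x y)"
      by (rule sum.cong[OF refl], rule sum.cong[OF refl], rule sum_swap3)
    also have "\<dots> = (\<Sum>x\<in>N. \<Sum>y\<in>N. \<Sum>\<sigma>\<in>UNIV. (\<Sum>i<n. \<Sum>j<n. cnj (\<alpha> i x) * \<alpha> j y * t' \<sigma> i j) * Z \<sigma> x y)"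
      by (rule sum.cong[OF refl], rule sum.cong[OF refl], subst (2) sum_UNIV_option) (simp add: t'_def sum_distrib_right)
    finally show ?thesis
      using dual_positiveD[OF Z N coeff_positive_compress[OF t', of N \<alpha>]] by simp
  qed
  have "\<forall>i. \<exists>J c. (\<forall>m. finite (J m)) \<and> (\<lambda>m. \<Sum>x\<in>J m. c m x *\<^sub>C \<rho> x) \<longlonglongrightarrow> h i"
    using total_family_seq[OF tot] by blast
  then obtain J c where J: "\<forall>i m. finite (J i m)" "\<forall>i. (\<lambda>m. \<Sum>x\<in>J i m. c i m x *\<^sub>C \<rho> x) \<longlonglongrightarrow> h i"
    unfolding choice_iff by blast
  have lim: "(\<lambda>m. ?\<Phi> (\<lambda>i. \<Sum>x\<in>J i m. c i m x *\<^sub>C \<rho> x)) \<longlonglongrightarrow> ?\<Phi> h"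
    by (intro tendsto_sum tendsto_mult tendsto_const cinner.tendsto J(2)[rule_format]
        bounded_linear.tendsto[OF bounded_linear_apply_bop])
  have mem: "?\<Phi> (\<lambda>i. \<Sum>x\<in>J i m. c i m x *\<^sub>C \<rho> x) \<in> {z. 0 \<le> z}" for m
    using fin[of "\<lambda>i. J i m" "\<lambda>i. c i m"] J(1) by simp
  have "closed {z::complex. 0 \<le> z}"
    unfolding zero_le_complex_iff
    by (intro closed_Collect_conj closed_Collect_le closed_Collect_eq continuous_intros)
  then have "?\<Phi> h \<in> {z. 0 \<le> z}" by (rule closed_sequentially[OF _ _ lim]) (rule mem)
  then show ?thesis by simp
qed

lemma sum_unit_scaleC:
  fixes F :: "'s::finite \<Rightarrow> 'x::complex_vector"
  shows "(\<Sum>s'\<in>UNIV. (if s' = s then 1 else 0) *\<^sub>C F s') = F s"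
proof -
  have "(\<Sum>s'\<in>UNIV. (if s' = s then 1 else 0) *\<^sub>C F s') = (\<Sum>s'\<in>UNIV. if s' = s then F s' else 0)"
    by (rule sum.cong[OF refl]) simp
  then show ?thesis by simp
qed

text \<open>
  Positivity of the operator pencil makes the assignment \<open>A g \<mapsto> T g\<close> well defined on the operator
  system, although the \<open>A g\<close> and the identity may be linearly dependent, and completely positive.
\<close>

lemma ex_unital_cp:
  fixes A :: "'g::finite \<Rightarrow> 'k::complex_hilbert_space bop" and T :: "'g \<Rightarrow> 'h::complex_hilbert_space bop"
  assumes pos: "\<And>n t (h :: nat \<Rightarrow> 'h). (\<And>k :: nat \<Rightarrow> 'k. 0 \<le> (\<Sum>i<n. \<Sum>j<n. \<Sum>s\<in>UNIV. t s i j * cinner (k i) (pencil_op A s (k j)))) \<Longrightarrow>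
    0 \<le> (\<Sum>i<n. \<Sum>j<n. \<Sum>s\<in>UNIV. t s i j * cinner (h i) (pencil_op T s (h j)))"
  obtains \<pi> where "unital_cp_on (cspan (insert 1 (range A))) \<pi>" "\<And>g. \<pi> (A g) = T g"
proof -
  let ?S = "cspan (insert 1 (range A))"
  define lA where "lA c = (\<Sum>s\<in>UNIV. c s *\<^sub>C pencil_coeff A s)" for c
  define lT where "lT c = (\<Sum>s\<in>UNIV. c s *\<^sub>C pencil_coeff T s)" for c
  have cA: "cinner x (apply_bop (lA c) y) = (\<Sum>s\<in>UNIV. c s * cinner x (pencil_op A s y))" for c x y
    by (simp add: lA_def apply_sum_bop apply_scaleC_bop cinner.sum_right cinner_scaleC_right)
  have cT: "cinner x (apply_bop (lT c) y) = (\<Sum>s\<in>UNIV. c s * cinner x (pencil_op T s y))" for c x y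
    by (simp add: lT_def apply_sum_bop apply_scaleC_bop cinner.sum_right cinner_scaleC_right)
  have lin: "lA (\<lambda>s. c s + c' s) = lA c + lA c'" "lT (\<lambda>s. c s + c' s) = lT c + lT c'"
    "lA (\<lambda>s. b * c s) = b *\<^sub>C lA c" "lT (\<lambda>s. b * c s) = b *\<^sub>C lT c" for b c c'
    by (simp_all add: lA_def lT_def scaleC_add_left sum.distrib complex_vector.scale_sum_right scaleC_scaleC)
  have zero: "lT c = 0" if c: "lA c = 0" for c
  proof (rule bop_eqI, rule cinner_ext)
    fix x y
    \<comment> \<open>An off-diagonal entry with an arbitrary complex factor has to be nonnegative.\<close>
    have "0 \<le> \<omega> * cinner y (apply_bop (lT c) x)" for \<omega>
    proof -
      define t where "t s i j = (if i = (0::nat) \<and> j = (1::nat) then \<omega> * c s else 0)" for s i j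
      have "0 \<le> (\<Sum>i<2. \<Sum>j<2. \<Sum>s\<in>UNIV. t s i j * cinner (k i) (pencil_op A s (k j)))" for k :: "nat \<Rightarrow> 'k"
      proof -
        have "(\<Sum>i<2. \<Sum>j<2. \<Sum>s\<in>UNIV. t s i j * cinner (k i) (pencil_op A s (k j))) = \<omega> * cinner (k 0) (apply_bop (lA c) (k 1))"
          by (simp add: cA t_def numeral_2_eq_2 sum_distrib_left mult.assoc)
        then show ?thesis by (simp add: c cinner.zero_right)
      qed
      from pos[where n = 2 and t = t and h = "\<lambda>i. if i = 0 then y else x", OF this]
      show ?thesis by (simp add: cT t_def numeral_2_eq_2 sum_distrib_left mult.assoc)
    qed
    from this[of 1] this[of "- 1"] this[of \<i>] this[of "- \<i>"]
    have "cinner y (apply_bop (lT c) x) = 0" by (simp add: zero_le_complex_iff complex_eq_iff)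
    then show "cinner y (apply_bop (lT c) x) = cinner y (apply_bop 0 x)" by (simp add: cinner.zero_right)
  qed
  have wd: "lT c = lT c'" if "lA c = lA c'" for c c'
  proof -
    have "lA (\<lambda>s. c s + (- 1) * c' s) = 0" unfolding lin that by simp
    from zero[OF this] show ?thesis unfolding lin by simp
  qed
  define \<pi> where "\<pi> a = lT (SOME c. a = lA c)" for a
  have \<pi>: "\<pi> (lA c) = lT c" for c
    unfolding \<pi>_def by (rule wd) (rule someI[of "\<lambda>c'. lA c = lA c'", OF refl, symmetric])
  have unit: "lA (\<lambda>s'. if s' = s then 1 else 0) = pencil_coeff A s" "lT (\<lambda>s'. if s' = s then 1 else 0) = pencil_coeff T s" for s
    by (simp_all only: lA_def lT_def sum_unit_scaleC)
  have \<pi>s: "\<pi> (pencil_coeff A s) = pencil_coeff T s" for s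
    using \<pi>[of "\<lambda>s'. if s' = s then 1 else 0"] by (simp only: unit)
  have span: "\<exists>c. a = lA c" if "a \<in> ?S" for a
  proof -
    have "?S \<subseteq> range lA"
    proof (rule complex_vector.span_minimal)
      have 1: "1 = lA (\<lambda>s'. if s' = None then 1 else 0)" "A g = lA (\<lambda>s'. if s' = Some g then 1 else 0)" for g
        by (simp_all only: unit pencil_coeff.simps)
      show "insert 1 (range A) \<subseteq> range lA"
        using range_eqI[where f = lA, OF 1(1)] range_eqI[where f = lA, OF 1(2)] by blast
      show "complex_vector.subspace (range lA)"
      proof (rule complex_vector.subspaceI)
        show "0 \<in> range lA" by (rule range_eqI[of _ _ "\<lambda>_. 0"]) (simp add: lA_def)
        show "x + y \<in> range lA" if xy: "x \<in> range lA" "y \<in> range lA" for x y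
        proof -
          obtain c c' where "x = lA c" "y = lA c'" using xy by blast
          then show ?thesis by (simp only: lin(1)[symmetric] rangeI)
        qed
        show "b *\<^sub>C x \<in> range lA" if x: "x \<in> range lA" for b x
        proof -
          obtain c where "x = lA c" using x by blast
          then show ?thesis by (simp only: lin(3)[symmetric] rangeI)
        qed
      qed
    qed
    then show ?thesis using that by blast
  qed
  have "unital_cp_on ?S \<pi>"
    unfolding unital_cp_on_def
  proof (intro conjI ballI allI impI)
    fix a b assume "a \<in> ?S" "b \<in> ?S"
    then obtain c c' where "a = lA c" "b = lA c'" using span by metis
    then show "\<pi> (a + b) = \<pi> a + \<pi> b" by (simp only: lin[symmetric] \<pi>)
  next
    fix z a assume "a \<in> ?S"
    then obtain c where "a = lA c" using span by metis
    then show "\<pi> (z *\<^sub>C a) = z *\<^sub>C \<pi> a" by (simp only: lin[symmetric] \<pi>)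
  next
    show "\<pi> 1 = 1" using \<pi>s[of None] by simp
  next
    fix n and M :: "'k bop mat"
    assume M: "M \<in> carrier_mat n n" and el: "elements_mat M \<subseteq> ?S" and psd: "psd M"
    have "\<forall>i j. \<exists>c. i < n \<longrightarrow> j < n \<longrightarrow> M $$ (i, j) = lA c"
    proof (intro allI)
      fix i j
      show "\<exists>c. i < n \<longrightarrow> j < n \<longrightarrow> M $$ (i, j) = lA c"
      proof (cases "i < n \<and> j < n")
        case True
        then have "M $$ (i, j) \<in> ?S" using el M by (intro subsetD[OF el] elements_matI) auto
        then show ?thesis using span by blast
      qed auto
    qed
    then obtain t where "\<forall>i j. i < n \<longrightarrow> j < n \<longrightarrow> M $$ (i, j) = lA (t i j)"
      unfolding choice_iff by blast
    then have t: "\<And>i j. i < n \<Longrightarrow> j < n \<Longrightarrow> M $$ (i, j) = lA (t i j)" by blast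
    have d: "dim_row M = n" "dim_col M = n" using M by auto
    have "0 \<le> (\<Sum>i<n. \<Sum>j<n. \<Sum>s\<in>UNIV. t i j s * cinner (k i) (pencil_op A s (k j)))" for k :: "nat \<Rightarrow> 'k"
    proof -
      have "(\<Sum>i<n. \<Sum>j<n. cinner (k i) (apply_bop (M $$ (i, j)) (k j)))
        = (\<Sum>i<n. \<Sum>j<n. \<Sum>s\<in>UNIV. t i j s * cinner (k i) (pencil_op A s (k j)))"
        by (intro sum.cong refl) (simp add: t cA)
      then show ?thesis using psd[unfolded psd_def d, THEN conjunct2, rule_format, of k] by (simp only:)
    qed
    from pos[where n = n and t = "\<lambda>s i j. t i j s", OF this]
    have "0 \<le> (\<Sum>i<n. \<Sum>j<n. \<Sum>s\<in>UNIV. t i j s * cinner (h i) (pencil_op T s (h j)))" for h .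
    moreover have "(\<Sum>i<n. \<Sum>j<n. cinner (h i) (apply_bop (map_mat \<pi> M $$ (i, j)) (h j)))
      = (\<Sum>i<n. \<Sum>j<n. \<Sum>s\<in>UNIV. t i j s * cinner (h i) (pencil_op T s (h j)))" for h
      by (intro sum.cong refl) (simp add: d t \<pi> cT)
    ultimately show "psd (map_mat \<pi> M)" by (simp add: psd_def d)
  qed
  moreover have "\<pi> (A g) = T g" for g using \<pi>s[of "Some g"] by simp
  ultimately show ?thesis by (rule that)
qed

lemma opoly_star_superset:
  fixes p :: "('g, 'h::complex_hilbert_space) opoly"
  assumes "finite S" "Poly_Mapping.keys p \<subseteq> S"
  shows "opoly_star p = (\<Sum>w\<in>S. Poly_Mapping.single (Word (rev (letters w))) (adj (Poly_Mapping.lookup p w)))"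
  unfolding opoly_star_def
  by (rule sum.mono_neutral_left) (use assms in \<open>auto simp: in_keys_iff\<close>)

definition word_poly :: "nat \<Rightarrow> ('g::finite list \<Rightarrow> 'h::complex_hilbert_space bop) \<Rightarrow> ('g, 'h) opoly" where
  "word_poly d R = (\<Sum>w\<in>words_upto d. Poly_Mapping.single (Word w) (R w))"

lemma lookup_word_poly:
  "Poly_Mapping.lookup (word_poly d R) (Word w) = (if w \<in> words_upto d then R w else 0)"
  by (simp add: word_poly_def lookup_sum lookup_single when_def)

lemma keys_word_poly: "Poly_Mapping.keys (word_poly d R) \<subseteq> Word ` words_upto d"
proof
  fix w assume w: "w \<in> Poly_Mapping.keys (word_poly d R)"
  obtain v where v: "w = Word v" by (cases w)
  show "w \<in> Word ` words_upto d"
    using w lookup_word_poly[of d R v] by (auto simp: v in_keys_iff split: if_splits)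
qed

lemma degree_word_poly: "opoly_degree (word_poly d R) \<le> d"
  unfolding opoly_degree_def
  by (rule Max.boundedI) (use keys_word_poly[of d R] in \<open>auto simp: words_upto_def\<close>)

lemma star_word_poly:
  "opoly_star (word_poly d R) = (\<Sum>w\<in>words_upto d. Poly_Mapping.single (Word (rev w)) (adj (R w)))"
  by (subst opoly_star_superset[OF _ keys_word_poly])
    (simp_all add: sum.reindex inj_on_def lookup_word_poly)

lemma pencil_sum_symbols:
  "pencil 1 T = (\<Sum>s\<in>UNIV. Poly_Mapping.single (Word (symbol_word (Some s))) (pencil_coeff T s))"
  by (simp add: pencil_def sum_UNIV_option zero_free_monoid_def)

lemma lookup_certificate:
  fixes e :: "nat \<Rightarrow> 'h::complex_hilbert_space" and T :: "'g::finite \<Rightarrow> 'h bop"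
  assumes R: "\<And>v w a b. cinner (apply_bop (R v) (e a)) (apply_bop (R w) (e b)) = Z None (v, a) (w, b)"
    and Q: "\<And>v w a b s. cinner (apply_bop (Q v) (e a)) (pencil_op T s (apply_bop (Q w) (e b))) = Z (Some s) (v, a) (w, b)"
  shows "cinner (e a) (apply_bop (Poly_Mapping.lookup (opoly_star (word_poly d R) * word_poly d R
      + opoly_star (word_poly d Q) * pencil 1 T * word_poly d Q) (Word u)) (e b)) = gram_coeff d Z u a b"
proof -
  let ?W = "words_upto d :: 'g list set"
  have 1: "opoly_star (word_poly d R) * word_poly d R
    = (\<Sum>v\<in>?W. \<Sum>w\<in>?W. Poly_Mapping.single (Word (rev v @ w)) (adj (R v) * R w))"
    unfolding star_word_poly unfolding word_poly_def sum_product mult_single by (simp add: plus_free_monoid_def)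
  have 2: "opoly_star (word_poly d Q) * pencil 1 T * word_poly d Q
    = (\<Sum>v\<in>?W. \<Sum>w\<in>?W. \<Sum>s\<in>UNIV. Poly_Mapping.single (Word (rev v @ symbol_word (Some s) @ w)) (adj (Q v) * pencil_coeff T s * Q w))"
  proof -
    have "opoly_star (word_poly d Q) * pencil 1 T * word_poly d Q
      = (\<Sum>v\<in>?W. \<Sum>s\<in>UNIV. \<Sum>w\<in>?W. Poly_Mapping.single (Word (rev v @ symbol_word (Some s) @ w)) (adj (Q v) * pencil_coeff T s * Q w))"
      unfolding star_word_poly pencil_sum_symbols unfolding word_poly_def sum_product
      by (simp add: sum_distrib_right sum_distrib_left mult_single plus_free_monoid_def)
        (rule sum.cong[OF refl], rule sum.swap)
    also have "\<dots> = (\<Sum>v\<in>?W. \<Sum>w\<in>?W. \<Sum>s\<in>UNIV. Poly_Mapping.single (Word (rev v @ symbol_word (Some s) @ w)) (adj (Q v) * pencil_coeff T s * Q w))"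
      by (rule sum.cong[OF refl], rule sum.swap)
    finally show ?thesis .
  qed
  have l1: "cinner (e a) (apply_bop (Poly_Mapping.lookup (opoly_star (word_poly d R) * word_poly d R) (Word u)) (e b))
    = (\<Sum>v\<in>?W. \<Sum>w\<in>?W. if rev v @ symbol_word None @ w = u then Z None (v, a) (w, b) else 0)"
    unfolding 1 lookup_sum lookup_single when_def apply_sum_bop cinner.sum_right
    by (intro sum.cong refl) (auto simp: apply_times_bop cinner_adj_right R cinner.zero_right)
  have l2: "cinner (e a) (apply_bop (Poly_Mapping.lookup (opoly_star (word_poly d Q) * pencil 1 T * word_poly d Q) (Word u)) (e b))
    = (\<Sum>v\<in>?W. \<Sum>w\<in>?W. \<Sum>s\<in>UNIV. if rev v @ symbol_word (Some s) @ w = u then Z (Some s) (v, a) (w, b) else 0)"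
    unfolding 2 lookup_sum lookup_single when_def apply_sum_bop cinner.sum_right
    by (intro sum.cong refl) (auto simp: apply_times_bop cinner_adj_right Q cinner.zero_right)
  have "gram_coeff d Z u a b = (\<Sum>v\<in>?W. \<Sum>w\<in>?W. if rev v @ symbol_word None @ w = u then Z None (v, a) (w, b) else 0)
    + (\<Sum>v\<in>?W. \<Sum>w\<in>?W. \<Sum>s\<in>UNIV. if rev v @ symbol_word (Some s) @ w = u then Z (Some s) (v, a) (w, b) else 0)"
    unfolding gram_coeff_def sum.distrib[symmetric]
    by (rule sum.cong[OF refl], rule sum.cong[OF refl], rule sum_UNIV_option)
  then show ?thesis by (simp only: lookup_add apply_plus_bop cinner_add_right l1 l2)
qed

text \<open>
  The trace bound for all finite combinations of basis vectors, where the pairing with the moments is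
  the quadratic form of the bounded operator \<open>\<Sum>\<^sub>u \<tau>(u) P(u)\<close>. It makes the columns of Gram vectors
  bounded operators.
\<close>

lemma certificate_columns_bounded:
  fixes A :: "'g::finite \<Rightarrow> 'k::complex_hilbert_space bop" and e :: "nat \<Rightarrow> 'h::complex_hilbert_space"
    and P :: "'g list \<Rightarrow> 'h bop"
  assumes sa: "\<And>g. self_adjoint (A g)" and Z: "dual_positive A Z"
    and gram: "\<And>u a b. u \<in> words_upto (2 * d + 1) \<Longrightarrow> gram_coeff d Z u a b = cinner (e a) (apply_bop (P u) (e b))"
  shows "\<exists>M\<ge>0. \<forall>w\<in>words_upto d. \<forall>\<sigma>\<in>{None, Some None}. \<forall>J c. finite J \<longrightarrow>
    Re (\<Sum>a\<in>J. \<Sum>b\<in>J. cnj (c a) * c b * Z \<sigma> (w, a) (w, b)) \<le> M * (norm (\<Sum>a\<in>J. c a *\<^sub>C e a))\<^sup>2"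
proof -
  let ?U = "words_upto (2 * d + 1) :: 'g list set"
  obtain \<tau> :: "'g list \<Rightarrow> complex" and \<kappa> :: real where
    \<kappa>: "\<kappa> > 0" and \<tau>: "\<And>u. \<tau> (rev u) = cnj (\<tau> u)" and
    pos: "strictly_positive_moments A d \<tau> \<kappa>"
    by (rule ex_strictly_positive_moments[of A d, OF sa]) (assumption | rule that; assumption)+
  have "\<forall>u. \<exists>K>0. \<forall>x. norm (apply_bop (P u) x) \<le> K * norm x" by (metis apply_bop_bound)
  then obtain K where K: "\<And>u. K u > 0" "\<And>u x. norm (apply_bop (P u) x) \<le> K u * norm x" by metis
  define M where "M = (\<Sum>u\<in>?U. cmod (\<tau> u) * K u) / \<kappa>"
  have M: "0 \<le> M" unfolding M_def using \<kappa> K(1) by (intro divide_nonneg_pos sum_nonneg mult_nonneg_nonneg) (auto intro: less_imp_le)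
  have psd: "psd_kernel (Z \<sigma>)" if "\<sigma> \<in> {None, Some None}" for \<sigma>
    using that psd_kernel_dual_None[OF Z] psd_kernel_dual_unit[OF Z sa] by auto
  have psd_col: "0 \<le> Re (\<Sum>a<m. \<Sum>b<m. cnj (c a) * c b * Z \<sigma> (w, a) (w, b))" if "\<sigma> \<in> {None, Some None}" for \<sigma> w m c
  proof -
    have "0 \<le> (\<Sum>i\<in>Pair w ` {..<m}. \<Sum>j\<in>Pair w ` {..<m}. cnj (c (snd i)) * c (snd j) * Z \<sigma> i j)"
      by (rule psd_kernelD[OF psd[OF that]]) simp
    also have "\<dots> = (\<Sum>a<m. \<Sum>b<m. cnj (c a) * c b * Z \<sigma> (w, a) (w, b))"
      by (simp add: sum.reindex inj_on_def)
    finally show ?thesis by (simp add: zero_le_complex_iff del: Re_sum)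
  qed
  have main: "Re (\<Sum>a<m. \<Sum>b<m. cnj (c a) * c b * Z \<sigma> (w, a) (w, b)) \<le> M * (norm (\<Sum>a<m. c a *\<^sub>C e a))\<^sup>2"
    if w: "w \<in> words_upto d" and \<sigma>: "\<sigma> \<in> {None, Some None}" for w \<sigma> m c
  proof -
    define h where "h = (\<Sum>a<m. c a *\<^sub>C e a)"
    let ?S = "\<lambda>\<sigma> w. Re (\<Sum>a<m. \<Sum>b<m. cnj (c a) * c b * Z \<sigma> (w, a) (w, b))"
    have "?S \<sigma> w \<le> ?S None w + ?S (Some None) w"
      using \<sigma> psd_col[where \<sigma> = None and w = w and m = m and c = c]
        psd_col[where \<sigma> = "Some None" and w = w and m = m and c = c] by (auto simp del: Re_sum)
    also have "\<dots> \<le> (\<Sum>w\<in>words_upto d. ?S None w + ?S (Some None) w)"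
      using w psd_col by (intro member_le_sum[of w _ "\<lambda>w. ?S None w + ?S (Some None) w"]) (auto intro!: add_nonneg_nonneg simp del: Re_sum)
    also have "\<dots> = Re (\<Sum>w\<in>words_upto d. \<Sum>a<m. \<Sum>b<m. cnj (c a) * c b * (Z None (w, a) (w, b) + Z (Some None) (w, a) (w, b)))"
      by (simp only: distrib_left sum.distrib Re_sum plus_complex.sel)
    finally have "\<kappa> * ?S \<sigma> w \<le> \<kappa> * Re (\<Sum>w\<in>words_upto d. \<Sum>a<m. \<Sum>b<m. cnj (c a) * c b * (Z None (w, a) (w, b) + Z (Some None) (w, a) (w, b)))"
      using \<kappa> by (intro mult_left_mono) auto
    also have "\<dots> \<le> Re (\<Sum>u\<in>?U. \<Sum>a<m. \<Sum>b<m. \<tau> u * (cnj (c a) * c b) * gram_coeff d Z u a b)"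
      using trace_bound[OF pos Z, where m = m and c = c] by (simp add: zero_le_complex_iff del: Re_sum)
    also have "(\<Sum>u\<in>?U. \<Sum>a<m. \<Sum>b<m. \<tau> u * (cnj (c a) * c b) * gram_coeff d Z u a b) = (\<Sum>u\<in>?U. \<tau> u * cinner h (apply_bop (P u) h))"
    proof (rule sum.cong[OF refl])
      fix u assume u: "u \<in> ?U"
      show "(\<Sum>a<m. \<Sum>b<m. \<tau> u * (cnj (c a) * c b) * gram_coeff d Z u a b) = \<tau> u * cinner h (apply_bop (P u) h)"
        unfolding h_def apply_bop_sum cinner_sum_sum sum_distrib_left
        by (intro sum.cong refl) (simp add: gram[OF u] apply_bop_scaleC cinner_scaleC_left cinner_scaleC_right)
    qed
    also have "Re (\<Sum>u\<in>?U. \<tau> u * cinner h (apply_bop (P u) h)) \<le> cmod (\<Sum>u\<in>?U. \<tau> u * cinner h (apply_bop (P u) h))"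
      by (rule complex_Re_le_cmod)
    also have "\<dots> \<le> (\<Sum>u\<in>?U. cmod (\<tau> u) * K u * (norm h)\<^sup>2)"
    proof (rule sum_norm_le)
      fix u
      have "cmod (cinner h (apply_bop (P u) h)) \<le> norm h * (K u * norm h)"
        by (rule order_trans[OF cinner_Cauchy_Schwarz]) (intro mult_left_mono K(2) norm_ge_zero)
      then have "cmod (\<tau> u) * cmod (cinner h (apply_bop (P u) h)) \<le> cmod (\<tau> u) * (norm h * (K u * norm h))"
        by (intro mult_left_mono) auto
      then show "cmod (\<tau> u * cinner h (apply_bop (P u) h)) \<le> cmod (\<tau> u) * K u * (norm h)\<^sup>2"
        by (simp add: norm_mult power2_eq_square mult_ac)
    qed
    also have "\<dots> = \<kappa> * (M * (norm h)\<^sup>2)" using \<kappa> by (simp add: M_def sum_distrib_right)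
    finally have "\<kappa> * ?S \<sigma> w \<le> \<kappa> * (M * (norm h)\<^sup>2)" .
    then show ?thesis using \<kappa> unfolding h_def by (rule mult_left_le_imp_le)
  qed
  have "Re (\<Sum>a\<in>J. \<Sum>b\<in>J. cnj (c a) * c b * Z \<sigma> (w, a) (w, b)) \<le> M * (norm (\<Sum>a\<in>J. c a *\<^sub>C e a))\<^sup>2"
    if w: "w \<in> words_upto d" and \<sigma>: "\<sigma> \<in> {None, Some None}" and J: "finite J" for w \<sigma> J c
  proof -
    define c' where "c' a = (if a \<in> J then c a else 0)" for a
    obtain m where m: "J \<subseteq> {..<m}" using finite_nat_iff_bounded[of J] J by auto
    have "(\<Sum>a\<in>J. \<Sum>b\<in>J. cnj (c a) * c b * Z \<sigma> (w, a) (w, b)) = (\<Sum>a<m. \<Sum>b<m. cnj (c' a) * c' b * Z \<sigma> (w, a) (w, b))"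
    proof (rule sum.mono_neutral_cong_left)
      show "(\<Sum>b\<in>J. cnj (c a) * c b * Z \<sigma> (w, a) (w, b)) = (\<Sum>b<m. cnj (c' a) * c' b * Z \<sigma> (w, a) (w, b))" if "a \<in> J" for a
        by (rule sum.mono_neutral_cong_left) (use m that in \<open>auto simp: c'_def\<close>)
    qed (use m in \<open>auto simp: c'_def\<close>)
    moreover have "(\<Sum>a\<in>J. c a *\<^sub>C e a) = (\<Sum>a<m. c' a *\<^sub>C e a)"
      by (rule sum.mono_neutral_cong_left) (use m in \<open>auto simp: c'_def\<close>)
    ultimately show ?thesis using main[OF w \<sigma>, where m = m and c = c'] by (simp only:)
  qed
  with M show ?thesis by blast
qed

text \<open>
  \<open>R w\<close> and \<open>Q w\<close> send the basis vector \<open>e a\<close> to the Gram vector with index \<open>(w, a)\<close> of the square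
  component and of the unit component of \<open>Z\<close>.
\<close>

lemma ex_certificate_operators:
  fixes A :: "'g::finite \<Rightarrow> 'k::complex_hilbert_space bop" and e :: "nat \<Rightarrow> 'h::complex_hilbert_space"
    and P :: "'g list \<Rightarrow> 'h bop" and k0 :: 'k
  assumes e: "orthonormal_basis e" and sa: "\<And>g. self_adjoint (A g)" and Z: "dual_positive A Z" and k0: "norm k0 = 1"
    and gram: "\<And>u a b. u \<in> words_upto (2 * d + 1) \<Longrightarrow> gram_coeff d Z u a b = cinner (e a) (apply_bop (P u) (e b))"
  obtains q r :: "('g, 'h) opoly" and \<pi> where
    "opoly_degree q \<le> d" "opoly_degree r \<le> d" "unital_cp_on (cspan (insert 1 (range A))) \<pi>"
    "\<And>u a b. cinner (e a) (apply_bop (Poly_Mapping.lookup (opoly_star r * r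
      + opoly_star q * pencil (\<pi> 1) (\<lambda>j. \<pi> (A j)) * q) (Word u)) (e b)) = gram_coeff d Z u a b"
proof -
  obtain M where M: "0 \<le> M" "\<forall>w\<in>words_upto d. \<forall>\<sigma>\<in>{None, Some None}. \<forall>J c. finite J \<longrightarrow>
    Re (\<Sum>a\<in>J. \<Sum>b\<in>J. cnj (c a) * c b * Z \<sigma> (w, a) (w, b)) \<le> M * (norm (\<Sum>a\<in>J. c a *\<^sub>C e a))\<^sup>2"
    using certificate_columns_bounded[of A Z d e P, OF sa Z gram] by blast
  have tot: "total_family e" using e by (simp add: orthonormal_basis_def)
  have ee: "cinner (e i) (e j) = (if i = j then 1 else 0)" for i j using e by (simp add: orthonormal_basis_def)
  \<comment> \<open>Only the columns of words of length at most \<open>d\<close> are known to be bounded; the others are set to zero.\<close>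
  define W where "W = (words_upto d :: 'g list set) \<times> (UNIV :: nat set)"
  define Y where "Y = (\<lambda>\<sigma> i j. if i \<in> W \<and> j \<in> W then Z \<sigma> i j else 0)"
  have Y: "dual_positive A Y" unfolding Y_def by (rule dual_positive_restrict[OF Z])
  have gY: "gram_coeff d Y u a b = gram_coeff d Z u a b" for u a b
    by (rule gram_coeff_cong) (simp add: Y_def W_def)
  have columns: "\<exists>R. \<forall>w a. apply_bop (R w) (e a) = \<rho> (w, a)"
    if g: "\<And>i j. cinner (\<rho> i) (\<rho> j) = Y \<sigma> i j" and \<sigma>: "\<sigma> \<in> {None, Some None}" for \<rho> :: "'g list \<times> nat \<Rightarrow> 'h" and \<sigma>
  proof -
    have "\<exists>T. \<forall>a. apply_bop T (e a) = \<rho> (w, a)" for w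
    proof (rule bop_extension[OF tot])
      fix J :: "nat set" and c :: "nat \<Rightarrow> complex" assume J: "finite J"
      show "norm (\<Sum>a\<in>J. c a *\<^sub>C \<rho> (w, a)) \<le> sqrt M * norm (\<Sum>a\<in>J. c a *\<^sub>C e a)"
      proof (rule norm_le_from_squares[OF _ M(1)])
        have 1: "(norm (\<Sum>a\<in>J. c a *\<^sub>C \<rho> (w, a)))\<^sup>2 = Re (\<Sum>a\<in>J. \<Sum>b\<in>J. cnj (c a) * c b * Y \<sigma> (w, a) (w, b))"
          by (rule norm_lincomb_gram) (rule g)
        show "(norm (\<Sum>a\<in>J. c a *\<^sub>C \<rho> (w, a)))\<^sup>2 \<le> M * (norm (\<Sum>a\<in>J. c a *\<^sub>C e a))\<^sup>2"
        proof (cases "w \<in> words_upto d")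
          case True
          then have "Re (\<Sum>a\<in>J. \<Sum>b\<in>J. cnj (c a) * c b * Z \<sigma> (w, a) (w, b)) \<le> M * (norm (\<Sum>a\<in>J. c a *\<^sub>C e a))\<^sup>2"
            using M(2) \<sigma> J by blast
          then show ?thesis using True unfolding 1 by (simp add: Y_def W_def del: Re_sum)
        next
          case False
          then show ?thesis unfolding 1 using M(1) by (simp add: Y_def W_def)
        qed
      qed
    qed
    then show ?thesis by metis
  qed
  obtain \<rho>r :: "'g list \<times> nat \<Rightarrow> 'h" and V0 where \<rho>r: "\<And>i j. cinner (\<rho>r i) (\<rho>r j) = Y None i j"
    by (rule kolmogorov_decomposition[OF e psd_kernel_dual_None[OF Y]]) (rule that; assumption)
  obtain R where R: "\<And>w a. apply_bop (R w) (e a) = \<rho>r (w, a)"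
    using columns[of \<rho>r None, OF \<rho>r] by auto
  obtain \<rho> :: "'g list \<times> nat \<Rightarrow> 'h" and V where
    \<rho>: "\<And>i j. cinner (\<rho> i) (\<rho> j) = Y (Some None) i j"
      "\<And>k i. k \<in> V \<Longrightarrow> cinner (e k) (\<rho> i) = 0"
      "total_family (case_sum \<rho> (\<lambda>k. if k \<in> V then e k else 0))"
    by (rule kolmogorov_decomposition[OF e psd_kernel_dual_unit[OF Y sa]]) (rule that; assumption)
  obtain Q where Q: "\<And>w a. apply_bop (Q w) (e a) = \<rho> (w, a)"
    using columns[of \<rho> "Some None", OF \<rho>(1)] by auto
  let ?\<rho> = "case_sum \<rho> (\<lambda>k. if k \<in> V then e k else 0)" and ?Y = "state_extension A k0 V Y"
  have Y': "dual_positive A ?Y" by (rule dual_positive_state_extension[OF Y])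
  have kk: "cinner k0 k0 = 1" by (simp add: cinner_self k0)
  have "cinner (?\<rho> x) (?\<rho> y) = ?Y (Some None) x y" for x y
  proof (cases x; cases y)
    fix i l assume "x = Inl i" "y = Inr l"
    moreover have "cinner (\<rho> i) (e l) = 0" if "l \<in> V" using \<rho>(2)[OF that, of i] cinner_commute[of "\<rho> i" "e l"] by simp
    ultimately show ?thesis by (simp add: cinner.zero_right)
  qed (auto simp: \<rho> ee kk cinner.zero_left cinner.zero_right)
  then obtain T where T: "\<forall>s x y. cinner (?\<rho> x) (pencil_op T s (?\<rho> y)) = ?Y (Some s) x y"
    using realize_dual_kernel[of e A ?Y ?\<rho>, OF e sa Y' \<rho>(3)] by blast
  have Tpos: "0 \<le> (\<Sum>i<n. \<Sum>j<n. \<Sum>s\<in>UNIV. t s i j * cinner (h i) (pencil_op T s (h j)))"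
    if "\<And>k :: nat \<Rightarrow> 'k. 0 \<le> (\<Sum>i<n. \<Sum>j<n. \<Sum>s\<in>UNIV. t s i j * cinner (k i) (pencil_op A s (k j)))" for n t h
    by (rule realized_kernel_positive[OF Y' \<rho>(3) T[rule_format] that])
  obtain \<pi> where \<pi>: "unital_cp_on (cspan (insert 1 (range A))) \<pi>" "\<And>g. \<pi> (A g) = T g"
    by (rule ex_unital_cp[of A T, OF Tpos]) (assumption | rule that; assumption)+
  have \<pi>1: "\<pi> 1 = 1" using \<pi>(1) by (simp add: unital_cp_on_def)
  show ?thesis
  proof (rule that[of "word_poly d Q" "word_poly d R" \<pi>])
    fix u a b
    show "cinner (e a) (apply_bop (Poly_Mapping.lookup (opoly_star (word_poly d R) * word_poly d R
      + opoly_star (word_poly d Q) * pencil (\<pi> 1) (\<lambda>j. \<pi> (A j)) * word_poly d Q) (Word u)) (e b)) = gram_coeff d Z u a b"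
      unfolding \<pi> \<pi>1 gY[symmetric]
    proof (rule lookup_certificate)
      show "cinner (apply_bop (R v) (e a)) (apply_bop (R w) (e b)) = Y None (v, a) (w, b)" for v w a b
        by (simp add: R \<rho>r)
      show "cinner (apply_bop (Q v) (e a)) (pencil_op T s (apply_bop (Q w) (e b))) = Y (Some s) (v, a) (w, b)" for v w a b s
        using T[rule_format, of "Inl (v, a)" s "Inl (w, b)"] by (simp add: Q)
    qed
  qed (use \<pi>(1) degree_word_poly in auto)
qed

section \<open>The Positivstellensatz\<close>

theorem theorem1:
  fixes p :: "('g::finite, 'h::complex_hilbert_space) opoly"
    and A :: "'g \<Rightarrow> 'k::complex_hilbert_space bop"
    and d :: nat
  assumes separable: "separable_space (euclidean :: 'h topology)"
    and infinite_dim: "\<not> (\<exists>B :: 'h set. finite B \<and> cspan B = UNIV)"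
    and nonzero: "\<exists>v :: 'k. v \<noteq> 0"
    and degree: "opoly_degree p \<le> 2 * d + 1"
    and self_adj: "\<And>j. self_adjoint (A j)"
  shows
    "(\<forall>n. \<forall>X :: 'g \<Rightarrow> complex mat.
        (\<forall>j. X j \<in> carrier_mat n n \<and> mat_adjoint (X j) = X j) \<longrightarrow>
        psd (opoly_eval n X (pencil 1 A)) \<longrightarrow> psd (opoly_eval n X p)) \<longleftrightarrow>
     (\<exists>(q :: ('g, 'h) opoly) (r :: ('g, 'h) opoly) (\<pi> :: 'k bop \<Rightarrow> 'h bop).
        opoly_degree q \<le> d \<and> opoly_degree r \<le> d \<and>
        unital_cp_on (cspan (insert 1 (range A))) \<pi> \<and>
        p = opoly_star r * r + opoly_star q * pencil (\<pi> 1) (\<lambda>j. \<pi> (A j)) * q)"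
  (is "?positive \<longleftrightarrow> ?certificate")
proof
  assume ?certificate
  then show ?positive
    using psd_certificate by (auto simp: hermitian_tuple_def)
next
  assume ?positive
  then have p_pos: "psd (opoly_eval n X p)"
    if "hermitian_tuple n X" "psd (opoly_eval n X (pencil 1 A))" for n and X :: "'g \<Rightarrow> complex mat"
    using that by (simp add: hermitian_tuple_def)
  let ?U = "words_upto (2 * d + 1) :: 'g list set"
  let ?P = "\<lambda>u. Poly_Mapping.lookup p (Word u)"
  obtain e :: "nat \<Rightarrow> 'h" where e: "orthonormal_basis e"
    using ex_orthonormal_basis[OF separable infinite_dim] by blast
  have norm_e: "norm (e a) = 1" for a
  proof -
    have "complex_of_real ((norm (e a))\<^sup>2) = 1" unfolding cinner_self[symmetric] using e by (simp add: orthonormal_basis_def)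
    then have "(norm (e a))\<^sup>2 = 1" by (simp only: of_real_eq_1_iff)
    then show ?thesis by (simp add: power2_eq_1_iff) (metis norm_ge_zero not_one_le_zero neg_0_le_iff_le)
  qed
  define f where "f u a b = cinner (e a) (apply_bop (?P u) (e b))" for u a b
  obtain v0 :: 'k where "v0 \<noteq> 0" using nonzero by blast
  then obtain k0 :: 'k where k0: "norm k0 = 1" using norm_sgn[of v0] by auto
  obtain n0 i0 and X0 :: "'g \<Rightarrow> complex mat" and \<theta> where
    i0: "i0 < n0" and X0: "hermitian_tuple n0 X0" and
    \<theta>: "\<forall>u\<in>?U. \<forall>w\<in>?U. (\<Sum>i<n0. \<theta> u i * word_entry n0 X0 w i i0) = (if u = w then 1 else 0)" and
    "\<forall>k::nat \<Rightarrow> 'k. (\<Sum>i<n0. (norm (k i))\<^sup>2) / 2 \<le> Re (\<Sum>i<n0. \<Sum>j<n0. \<Sum>s\<in>UNIV.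
        word_entry n0 X0 (symbol_word (Some s)) i j * cinner (k i) (pencil_op A s (k j)))" and
    L0: "psd (opoly_eval n0 X0 (pencil 1 A))"
    by (rule ex_faithful_point[of A "2 * d + 1", OF self_adj]) (rule that; assumption)
  have fherm: "f (rev u) b a = cnj (f u a b)" if u: "u \<in> ?U" for u a b
    using positive_imp_hermitian_coeffs[OF degree X0 i0 \<theta> p_pos[OF X0 L0] u, of "e a" "e b"] by (simp add: f_def)
  have fpos: "0 \<le> Re (\<Sum>u\<in>?U. \<Sum>a<m. \<Sum>b<m. (\<Sum>i<n. \<Sum>k<n. cnj (\<xi> a i) * word_entry n X u i k * \<xi> b k) * f u a b)"
    if X: "hermitian_tuple n X" and L: "psd (opoly_eval n X (pencil 1 A))" for n m and X :: "'g \<Rightarrow> complex mat" and \<xi>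
  proof -
    define v where "v i = (\<Sum>a<m. \<xi> a i *\<^sub>C e a)" for i
    have "(\<Sum>i<n. \<Sum>k<n. cinner (v i) (apply_bop (eval_entry n X p i k) (v k)))
      = (\<Sum>i<n. \<Sum>k<n. \<Sum>a<m. \<Sum>b<m. \<Sum>u\<in>?U. cnj (\<xi> a i) * word_entry n X u i k * \<xi> b k * f u a b)"
    proof (intro sum.cong refl)
      fix i k
      show "cinner (v i) (apply_bop (eval_entry n X p i k) (v k)) = (\<Sum>a<m. \<Sum>b<m. \<Sum>u\<in>?U. cnj (\<xi> a i) * word_entry n X u i k * \<xi> b k * f u a b)"
        unfolding v_def apply_bop_sum cinner_sum_sum
        by (intro sum.cong refl) (simp add: eval_entry_words[OF degree] apply_bop_scaleC apply_sum_bop apply_scaleC_bop cinner_scaleC_left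
            cinner_scaleC_right cinner.sum_right sum_distrib_left f_def mult_ac complex_vector.scale_sum_right scaleC_scaleC)
    qed
    also have "\<dots> = (\<Sum>a<m. \<Sum>b<m. \<Sum>i<n. \<Sum>k<n. \<Sum>u\<in>?U. cnj (\<xi> a i) * word_entry n X u i k * \<xi> b k * f u a b)"
      by (rule sum_swap4)
    also have "\<dots> = (\<Sum>a<m. \<Sum>b<m. \<Sum>u\<in>?U. \<Sum>i<n. \<Sum>k<n. cnj (\<xi> a i) * word_entry n X u i k * \<xi> b k * f u a b)"
      by (rule sum.cong[OF refl], rule sum.cong[OF refl], rule sum_swap3)
    also have "\<dots> = (\<Sum>u\<in>?U. \<Sum>a<m. \<Sum>b<m. \<Sum>i<n. \<Sum>k<n. cnj (\<xi> a i) * word_entry n X u i k * \<xi> b k * f u a b)"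
      by (rule sum_swap3)
    also have "\<dots> = (\<Sum>u\<in>?U. \<Sum>a<m. \<Sum>b<m. (\<Sum>i<n. \<Sum>k<n. cnj (\<xi> a i) * word_entry n X u i k * \<xi> b k) * f u a b)"
      by (simp only: sum_distrib_right)
    finally have eq: "(\<Sum>i<n. \<Sum>k<n. cinner (v i) (apply_bop (eval_entry n X p i k) (v k)))
      = (\<Sum>u\<in>?U. \<Sum>a<m. \<Sum>b<m. (\<Sum>i<n. \<Sum>k<n. cnj (\<xi> a i) * word_entry n X u i k * \<xi> b k) * f u a b)" .
    have "0 \<le> (\<Sum>i<n. \<Sum>k<n. cinner (v i) (apply_bop (eval_entry n X p i k) (v k)))"
      using p_pos[OF X L] unfolding psd_eval_iff by blast
    then show ?thesis unfolding eq by (simp add: zero_le_complex_iff del: Re_sum)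
  qed
  have "\<forall>u. \<exists>K>0. \<forall>x. norm (apply_bop (?P u) x) \<le> K * norm x" by (metis apply_bop_bound)
  then obtain K where K: "\<And>u. K u > 0" "\<And>u x. norm (apply_bop (?P u) x) \<le> K u * norm x" by metis
  have fbound: "cmod (f u a a) \<le> (\<Sum>u\<in>?U. K u)" if u: "u \<in> ?U" for u a
  proof -
    have "cmod (f u a a) \<le> K u"
      using cinner_Cauchy_Schwarz[of "e a" "apply_bop (?P u) (e a)"] K(2)[of u "e a"] by (simp add: f_def norm_e)
    also have "\<dots> \<le> (\<Sum>u\<in>?U. K u)" using u K(1) by (intro member_le_sum) (auto intro: less_imp_le)
    finally show ?thesis .
  qed
  obtain Z where Z: "dual_positive A Z" "\<forall>u\<in>?U. \<forall>a b. gram_coeff d Z u a b = f u a b"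
    using infinite_certificate[of A d f, OF self_adj fherm fpos fbound] by blast
  have gram: "gram_coeff d Z u a b = cinner (e a) (apply_bop (?P u) (e b))" if "u \<in> ?U" for u a b
    using Z(2) that by (simp add: f_def)
  obtain q r :: "('g, 'h) opoly" and \<pi> where
    qr: "opoly_degree q \<le> d" "opoly_degree r \<le> d" "unital_cp_on (cspan (insert 1 (range A))) \<pi>" and
    lookup: "\<And>u a b. cinner (e a) (apply_bop (Poly_Mapping.lookup (opoly_star r * r
      + opoly_star q * pencil (\<pi> 1) (\<lambda>j. \<pi> (A j)) * q) (Word u)) (e b)) = gram_coeff d Z u a b"
    by (rule ex_certificate_operators[of e A Z k0 d ?P, OF e self_adj Z(1) k0 gram]) (assumption | rule that; assumption)+
  have "p = opoly_star r * r + opoly_star q * pencil (\<pi> 1) (\<lambda>j. \<pi> (A j)) * q"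
  proof (rule poly_mapping_eqI)
    fix w :: "'g free_monoid"
    obtain u where w: "w = Word u" by (cases w)
    show "Poly_Mapping.lookup p w = Poly_Mapping.lookup (opoly_star r * r + opoly_star q * pencil (\<pi> 1) (\<lambda>j. \<pi> (A j)) * q) w"
      unfolding w
    proof (rule bop_eqI_total)
      show "total_family e" using e by (simp add: orthonormal_basis_def)
      fix a b
      show "cinner (e a) (apply_bop (?P u) (e b)) = cinner (e a) (apply_bop (Poly_Mapping.lookup (opoly_star r * r
        + opoly_star q * pencil (\<pi> 1) (\<lambda>j. \<pi> (A j)) * q) (Word u)) (e b))"
        unfolding lookup
      proof (cases "u \<in> ?U")
        case False
        have "rev v @ symbol_word \<sigma> @ w \<noteq> u" if "v \<in> words_upto d" "w \<in> words_upto d" for v w and \<sigma> :: "'g option option"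
          using word_split_in_words_upto[OF that, of \<sigma>] False by blast
        then have "gram_coeff d Z u a b = 0" unfolding gram_coeff_def by simp
        moreover have "?P u = 0" using opoly_degree_lookup[OF degree, of "Word u"] False by (simp add: words_upto_def)
        ultimately show "cinner (e a) (apply_bop (?P u) (e b)) = gram_coeff d Z u a b" by (simp add: cinner.zero_right)
      qed (simp add: gram)
    qed
  qed
  with qr show ?certificate by blast
qed

end
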